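(* Let $R=\bigoplus_{\alpha\in\Gamma}R_\alpha$ be a graded integral domain, $H$ be the set of nonzero homogeneous elements of $R$, and $Q$ be a prime $t$-ideal of $R$ with $C(Q)_t=R$ (e.g., $Q$ is a maximal $t$-ideal of $R$ such that $Q\cap H=\emptyset$). Then: (1) $R_Q$ is a valuation domain. (2) $QR_H$ is a prime $t$-ideal of $R_H$. Hence, if $Q$ is a maximal $t$-ideal of $R$, then $QR_H$ is a maximal $t$-ideal of $R_H$.
   Context: $\Gamma$ is a nonzero torsionless (i.e. $n\alpha=n\beta$ with $n\ge1$ implies $\alpha=\beta$) commutative cancellative monoid, written additively, with quotient group $\langle\Gamma\rangle$. $R=\bigoplus_{\alpha\in\Gamma}R_\alpha$ is an integral domain graded by $\Gamma$, with $R_\alpha\neq\{0\}$ for all $\alpha\in\Gamma$. $H=\bigcup_\alpha(R_\alpha\setminus\{0\})$ is the multiplicative set of nonzero homogeneous elements; $R_H$ is $\langle\Gamma\rangle$-graded. For $f\in R_H$, $C(f)$ is the fractional ideal of $R$ generated by the homogeneous components of $f$; for a fractional ideal $A\subseteq R_H$ of $R$, $C(A)=\sum_{f\in A}C(f)$. For an integral domain $D$ with quotient field $K$ and a nonzero fractional ideal $A$ of $D$: $A^{-1}=\{x\in K\mid xA\subseteq D\}$, $A_v=(A^{-1})^{-1}$, $A_t=\bigcup\{I_v\mid I\subseteq A$ a nonzero finitely generated ideal$\}$. A (nonzero) ideal $A$ is a $t$-ideal if $A_t=A$; a maximal $t$-ideal is a $t$-ideal maximal among proper integral $t$-ideals of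 $D$. *)

theory Defs
  imports "HOL-Algebra.Algebraic_Closure_Type"
begin

text \<open>
  An integral domain is a subring \<open>D\<close> of a field \<open>K\<close>, the type \<open>'k\<close>, such that \<open>K\<close> is the quotient
  field of \<open>D\<close>. All overrings, ideals and fractional ideals are then subsets of \<open>K\<close>.
\<close>

definition ring_on :: "'k::field set \<Rightarrow> 'k ring" where
  "ring_on D = ring_of_type_algebra\<lparr>carrier := D\<rparr>"

definition domain_with_quotient_field :: "'k::field set \<Rightarrow> bool" where
  "domain_with_quotient_field D \<longleftrightarrow>
     subring D (ring_of_type_algebra :: 'k ring) \<and> (\<forall>x. \<exists>a\<in>D. \<exists>b\<in>D - {0}. x = a / b)"

definition valuation_domain :: "'k::field set \<Rightarrow> bool" where
  "valuation_domain V \<longleftrightarrow>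
     domain_with_quotient_field V \<and> (\<forall>x. x \<noteq> 0 \<longrightarrow> x \<in> V \<or> inverse x \<in> V)"

definition localization :: "'k::field set \<Rightarrow> 'k set \<Rightarrow> 'k set" where
  "localization D S = {a / s | a s. a \<in> D \<and> s \<in> S}"

text \<open>Closure under negation follows from \<open>-1 \<in> D\<close>.\<close>

definition is_submodule :: "'k::field set \<Rightarrow> 'k set \<Rightarrow> bool" where
  "is_submodule D A \<longleftrightarrow>
     0 \<in> A \<and> (\<forall>x\<in>A. \<forall>y\<in>A. x + y \<in> A) \<and> (\<forall>d\<in>D. \<forall>x\<in>A. d * x \<in> A)"

definition fractional_ideal :: "'k::field set \<Rightarrow> 'k set \<Rightarrow> bool" where
  "fractional_ideal D A \<longleftrightarrow> is_submodule D A \<and> (\<exists>d\<in>D - {0}. \<forall>x\<in>A. d * x \<in> D)"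

definition fin_gen_fractional_ideal :: "'k::field set \<Rightarrow> 'k set \<Rightarrow> bool" where
  "fin_gen_fractional_ideal D A \<longleftrightarrow>
     fractional_ideal D A \<and> (\<exists>F. finite F \<and> A = is_submodule D hull F)"

definition inv_ideal :: "'k::field set \<Rightarrow> 'k set \<Rightarrow> 'k set" where
  "inv_ideal D A = {x. \<forall>a\<in>A. x * a \<in> D}"

definition v_op :: "'k::field set \<Rightarrow> 'k set \<Rightarrow> 'k set" where
  "v_op D A = inv_ideal D (inv_ideal D A)"

definition t_op :: "'k::field set \<Rightarrow> 'k set \<Rightarrow> 'k set" where
  "t_op D A = \<Union>{v_op D I | I. I \<subseteq> A \<and> I \<noteq> {0} \<and> fin_gen_fractional_ideal D I}"

definition t_ideal :: "'k::field set \<Rightarrow> 'k set \<Rightarrow> bool" where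
  "t_ideal D A \<longleftrightarrow> ideal A (ring_on D) \<and> A \<noteq> {0} \<and> t_op D A = A"

definition prime_t_ideal :: "'k::field set \<Rightarrow> 'k set \<Rightarrow> bool" where
  "prime_t_ideal D Q \<longleftrightarrow> primeideal Q (ring_on D) \<and> t_ideal D Q"

definition maximal_t_ideal :: "'k::field set \<Rightarrow> 'k set \<Rightarrow> bool" where
  "maximal_t_ideal D Q \<longleftrightarrow>
     t_ideal D Q \<and> Q \<noteq> D \<and> (\<forall>J. t_ideal D J \<and> J \<noteq> D \<and> Q \<subseteq> J \<longrightarrow> J = Q)"


text \<open>
  \<open>c\<close> is a decomposition of \<open>f\<close> into a finite sum of elements of the \<open>G i\<close>, for \<open>i\<close> in \<open>I\<close>.
\<close>

definition decomposition :: "('i \<Rightarrow> 'k::field set) \<Rightarrow> 'i set \<Rightarrow> 'k \<Rightarrow> ('i \<Rightarrow> 'k) \<Rightarrow> bool" where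
  "decomposition G I f c \<longleftrightarrow>
     (\<forall>i\<in>I. c i \<in> G i) \<and> (\<forall>i. i \<notin> I \<longrightarrow> c i = 0) \<and>
     finite {i. c i \<noteq> 0} \<and> f = (\<Sum>i | c i \<noteq> 0. c i)"

text \<open>
  The monoid \<open>\<Gamma>\<close> is the type \<open>'g\<close>; \<open>\<Sum>i<n. \<alpha>\<close> is the multiple \<open>n\<alpha>\<close>.
\<close>

locale graded_domain =
  fixes R :: "'k::field set"
    and gr :: "'g::cancel_comm_monoid_add \<Rightarrow> 'k set"
  assumes nonzero_monoid: "\<exists>\<alpha>::'g. \<alpha> \<noteq> 0"
    and torsionless: "\<And>(n::nat) (\<alpha>::'g) \<beta>. n \<ge> 1 \<Longrightarrow> (\<Sum>i<n. \<alpha>) = (\<Sum>i<n. \<beta>) \<Longrightarrow> \<alpha> = \<beta>"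
    and domain: "domain_with_quotient_field R"
    and gr_subgroup: "\<And>\<alpha>. additive_subgroup (gr \<alpha>) (ring_on R)"
    and gr_nonzero: "\<And>\<alpha>. gr \<alpha> \<noteq> {0}"
    and gr_mult: "\<And>\<alpha> \<beta> x y. x \<in> gr \<alpha> \<Longrightarrow> y \<in> gr \<beta> \<Longrightarrow> x * y \<in> gr (\<alpha> + \<beta>)"
    and direct_sum: "\<And>f. f \<in> R \<Longrightarrow> \<exists>!c. decomposition gr UNIV f c"

definition homogeneous :: "('g \<Rightarrow> 'k::field set) \<Rightarrow> 'k set" where
  "homogeneous gr = (\<Union>\<alpha>. gr \<alpha> - {0})"

text \<open>
  The quotient group of \<open>\<Gamma>\<close> consists of the classes of pairs \<open>(\<alpha>, \<beta>)\<close>, standing for the formal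
  differences \<open>\<alpha> - \<beta>\<close>. Only its elements are needed, as degrees in \<open>R\<^sub>H\<close>.
\<close>

definition diff_rel :: "(('g \<times> 'g) \<times> ('g \<times> 'g::cancel_comm_monoid_add)) set" where
  "diff_rel = {((\<alpha>, \<beta>), (\<alpha>', \<beta>')). \<alpha> + \<beta>' = \<alpha>' + \<beta>}"

definition quotient_group :: "('g \<times> 'g::cancel_comm_monoid_add) set set" where
  "quotient_group = UNIV // diff_rel"

text \<open>The grading of \<open>R\<^sub>H\<close>: \<open>a / s\<close> has degree \<open>deg a - deg s\<close>.\<close>

definition frac_gr :: "('g::cancel_comm_monoid_add \<Rightarrow> 'k::field set) \<Rightarrow> ('g \<times> 'g) set \<Rightarrow> 'k set" where
  "frac_gr gr \<gamma> = {a / s | a s \<alpha> \<beta>. (\<alpha>, \<beta>) \<in> \<gamma> \<and> a \<in> gr \<alpha> \<and> s \<in> gr \<beta> - {0}}"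

text \<open>
  For \<open>f \<in> R\<^sub>H\<close> the decomposition \<open>c\<close> is unique.
\<close>

definition homogeneous_components ::
    "('g::cancel_comm_monoid_add \<Rightarrow> 'k::field set) \<Rightarrow> 'k \<Rightarrow> 'k set" where
  "homogeneous_components gr f =
     {c \<gamma> | c \<gamma>. \<gamma> \<in> quotient_group \<and> decomposition (frac_gr gr) quotient_group f c}"

definition content ::
    "'k::field set \<Rightarrow> ('g::cancel_comm_monoid_add \<Rightarrow> 'k set) \<Rightarrow> 'k \<Rightarrow> 'k set" where
  "content R gr f = is_submodule R hull homogeneous_components gr f"

definition content_ideal ::
    "'k::field set \<Rightarrow> ('g::cancel_comm_monoid_add \<Rightarrow> 'k set) \<Rightarrow> 'k set \<Rightarrow> 'k set" where
  "content_ideal R gr A = is_submodule R hull (\<Union>f\<in>A. content R gr f)"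

end

theory Submission
  imports Defs
begin

text \<open>
  Since \<open>\<Gamma>\<close> is torsionless, it carries a compatible total order, and comparing leading terms as in the
  Dedekind--Mertens lemma gives: if \<open>T \<subseteq> Q\<close> is finite and the components of the elements of \<open>T\<close>
  generate an ideal with \<open>v\<close>-closure \<open>R\<close>, then every \<open>x \<in> R\<^sub>H\<close> with \<open>xT \<subseteq> R\<close> lies in \<open>R\<close>. Such a \<open>T\<close>
  exists when \<open>C(Q)\<^sub>t = R\<close>; in particular \<open>Q \<inter> H = \<emptyset>\<close>.

  The ring \<open>R\<^sub>H\<close> has greatest common divisors: it is the directed union of the subrings of elements
  supported on finitely generated groups of degrees. These groups are free, so the subrings are
  iterated Laurent polynomial rings over the field of elements of degree \<open>0\<close>; and divisibility
  questions in \<open>R\<^sub>H\<close> can be answered coset by coset in such a subring. Hence every \<open>x \<noteq> 0\<close> is a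
  quotient \<open>a / b\<close> of elements of \<open>R\<close> that are \<open>v\<close>-coprime in \<open>R\<^sub>H\<close>. If both were in \<open>Q\<close>, then
  \<open>T \<union> {a, b} \<subseteq> Q\<close> would have \<open>v\<close>-closure \<open>R\<close>, contradicting that \<open>Q\<close> is a \<open>t\<close>-ideal; so \<open>x\<close> or
  its inverse lies in \<open>R\<^sub>Q\<close>. A prime whose localization is a valuation domain is a \<open>t\<close>-ideal, which
  gives the second part, and \<open>t\<close>-ideals of \<open>R\<^sub>H\<close> contract to \<open>t\<close>-ideals of \<open>R\<close>.
\<close>

section \<open>Subrings of a field and \<open>t\<close>-ideals\<close>


text \<open>Coprimality of \<open>a, b\<close> in \<open>R\<^sub>H\<close> says only that a
  multiplier \<open>y\<close> with \<open>ya, yb\<close> in \<open>R\<close> lies in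
  \<open>R\<^sub>H\<close>; the set \<open>T\<close> then forces \<open>y\<close> into
  \<open>R\<close>. The two tests together put \<open>1\<close> into the \<open>t\<close>-closure of
  \<open>Q\<close>.

  The obstacle is that the group of degrees need not be finitely generated, so
  \<open>R\<^sub>H\<close> itself need not be an iterated Laurent ring. Greatest common divisors are
  therefore expressed without factorizations: the conductor of a pair is principal. This condition
  can be carried through Laurent extensions and transferred to \<open>R\<^sub>H\<close>.

  No group of degrees is built for this purpose. A degree is replaced by the coset of a homogeneous
  unit modulo the units of degree 0, and a group of degrees by a subgroup of units. A Laurent
  variable is then an element of the ambient field, and it is transcendental because its powers lie
  in different cosets. The intermediate rings may have smaller quotient fields than the ambient one,
  hence a notion of subring without a condition on the quotient field.\<close>

locale field_subring =
  fixes D :: "'k::field set"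
  assumes one_mem: "1 \<in> D"
    and diff_mem: "x \<in> D \<Longrightarrow> y \<in> D \<Longrightarrow> x - y \<in> D"
    and mult_mem: "x \<in> D \<Longrightarrow> y \<in> D \<Longrightarrow> x * y \<in> D"
begin

lemma zero_mem: "0 \<in> D"
  using diff_mem[OF one_mem one_mem] by simp

lemma uminus_mem: "x \<in> D \<Longrightarrow> - x \<in> D"
  using diff_mem[OF zero_mem, of x] by simp

lemma add_mem: "x \<in> D \<Longrightarrow> y \<in> D \<Longrightarrow> x + y \<in> D"
  using diff_mem[of x "- y"] uminus_mem by simp

lemma sum_mem: "(\<And>i. i \<in> S \<Longrightarrow> f i \<in> D) \<Longrightarrow> sum f S \<in> D"
  by (induction S rule: infinite_finite_induct) (auto simp: zero_mem add_mem)

lemma is_submodule_self: "is_submodule D D"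
  by (simp add: is_submodule_def zero_mem add_mem mult_mem)

end

lemma subring_iff_field_subring:
  "subring D (ring_of_type_algebra :: 'k::field ring) \<longleftrightarrow> field_subring D"
proof
  interpret cring "ring_of_type_algebra :: 'k ring" by auto
  have minus: "\<ominus>\<^bsub>ring_of_type_algebra\<^esub> (x::'k) = - x" for x
    by (rule minus_equality) (auto simp: ring_of_type_algebra_def)
  show "field_subring D" if "subring D (ring_of_type_algebra :: 'k ring)"
    using subringE[OF that] unfolding minus
    by (unfold_locales) (auto simp: ring_of_type_algebra_def, metis diff_conv_add_uminus)
  show "subring D (ring_of_type_algebra :: 'k ring)" if "field_subring D"
  proof -
    interpret D: field_subring D by fact
    show ?thesis
      by (rule subringI) (auto simp: minus D.uminus_mem,
          auto simp: ring_of_type_algebra_def D.one_mem D.add_mem D.mult_mem)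
  qed
qed

lemma ring_on_simps [simp]:
  "carrier (ring_on D) = D" "monoid.mult (ring_on D) = (*)" "one (ring_on D) = 1"
  "ring.zero (ring_on D) = 0" "add (ring_on D) = (+)"
  by (auto simp: ring_on_def ring_of_type_algebra_def)

context field_subring
begin

lemma cring_ring_on: "cring (ring_on D)"
proof -
  have "\<exists>y\<in>D. x + y = 0" if "x \<in> D" for x
    using that by (intro bexI[of _ "- x"]) (auto simp: uminus_mem)
  then show ?thesis
    by unfold_locales
      (auto simp: Units_def algebra_simps zero_mem one_mem add_mem mult_mem)
qed

lemma uminus_mem_submodule: "is_submodule D A \<Longrightarrow> x \<in> A \<Longrightarrow> - x \<in> A"
  unfolding is_submodule_def using uminus_mem[OF one_mem] by (metis mult_minus1)

lemma ideal_iff: "ideal A (ring_on D) \<longleftrightarrow> A \<subseteq> D \<and> is_submodule D A"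
proof
  assume "ideal A (ring_on D)"
  then interpret ideal A "ring_on D" .
  show "A \<subseteq> D \<and> is_submodule D A"
    using a_subset I_l_closed additive_subgroup.a_closed[OF is_additive_subgroup]
      additive_subgroup.zero_closed[OF is_additive_subgroup]
    by (auto simp: is_submodule_def)
next
  interpret cring "ring_on D" by (rule cring_ring_on)
  assume A: "A \<subseteq> D \<and> is_submodule D A"
  show "ideal A (ring_on D)"
  proof (rule idealI)
    show "ring (ring_on D)" by (rule ring_axioms)
    have "inv\<^bsub>add_monoid (ring_on D)\<^esub> x = - x" if "x \<in> A" for x
    proof (rule group.inv_equality[OF a_group])
      show "- x \<in> carrier (add_monoid (ring_on D))" "x \<in> carrier (add_monoid (ring_on D))"
        using A that uminus_mem by auto
    qed simp
    then show "subgroup A (add_monoid (ring_on D))"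
      using A uminus_mem_submodule[of A]
      by (intro subgroup.intro) (auto simp: is_submodule_def)
    show "x \<otimes>\<^bsub>ring_on D\<^esub> a \<in> A" "a \<otimes>\<^bsub>ring_on D\<^esub> x \<in> A" if "a \<in> A" "x \<in> carrier (ring_on D)" for a x
      using A that by (auto simp: is_submodule_def mult.commute)
  qed
qed

lemma primeideal_iff:
  "primeideal Q (ring_on D) \<longleftrightarrow>
     Q \<subseteq> D \<and> is_submodule D Q \<and> 1 \<notin> Q \<and> (\<forall>a\<in>D. \<forall>b\<in>D. a * b \<in> Q \<longrightarrow> a \<in> Q \<or> b \<in> Q)"
proof -
  have one: "1 \<in> Q \<longleftrightarrow> Q = D" if "Q \<subseteq> D" "is_submodule D Q"
    using that one_mem unfolding is_submodule_def by (metis mult.right_neutral subsetI subset_antisym)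
  show ?thesis
  proof
    assume "primeideal Q (ring_on D)"
    then interpret primeideal Q "ring_on D" .
    show "Q \<subseteq> D \<and> is_submodule D Q \<and> 1 \<notin> Q \<and> (\<forall>a\<in>D. \<forall>b\<in>D. a * b \<in> Q \<longrightarrow> a \<in> Q \<or> b \<in> Q)"
      using ideal_axioms I_notcarr I_prime one unfolding ideal_iff by auto
  next
    assume "Q \<subseteq> D \<and> is_submodule D Q \<and> 1 \<notin> Q \<and> (\<forall>a\<in>D. \<forall>b\<in>D. a * b \<in> Q \<longrightarrow> a \<in> Q \<or> b \<in> Q)"
    then show "primeideal Q (ring_on D)"
      using one by (intro primeidealI cring_ring_on) (auto simp: ideal_iff)
  qed
qed

section \<open>The \<open>t\<close>-operation in terms of finite sets of generators\<close>

lemma is_submodule_hull: "is_submodule D (is_submodule D hull S)"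
  by (rule hull_in) (auto simp: is_submodule_def)

lemma is_submodule_conductor: "is_submodule D {x. y * x \<in> D}"
  by (auto simp: is_submodule_def zero_mem add_mem distrib_left mult_mem mult.left_commute)

text \<open>For fixed \<open>y\<close> the elements that \<open>y\<close> multiplies into
  \<open>D\<close> form a submodule, so testing generators suffices.\<close>

lemma inv_ideal_hull: "inv_ideal D (is_submodule D hull F) = {y. \<forall>f\<in>F. y * f \<in> D}"
proof -
  have "y * a \<in> D" if "a \<in> is_submodule D hull F" "\<forall>f\<in>F. y * f \<in> D" for y a
    using hull_minimal[of F "{x. y * x \<in> D}" "is_submodule D"] is_submodule_conductor[of y] that
    by auto
  then show ?thesis
    by (auto simp: inv_ideal_def hull_inc)
qed

text \<open>The inner inverse in the \<open>v\<close>-closure can be tested on generators, and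
  inside \<open>D\<close> every submodule is fractional with denominator 1. Later arguments thus
  deal with finite sets instead of finitely generated fractional ideals.\<close>

lemma mem_t_op_iff:
  assumes A: "is_submodule D A" "A \<subseteq> D"
  shows "x \<in> t_op D A \<longleftrightarrow>
    (\<exists>F. finite F \<and> F \<subseteq> A \<and> \<not> F \<subseteq> {0} \<and> (\<forall>y. (\<forall>f\<in>F. y * f \<in> D) \<longrightarrow> x * y \<in> D))"
    (is "_ \<longleftrightarrow> (\<exists>F. ?P F)")
proof
  assume "x \<in> t_op D A"
  then obtain F where F: "is_submodule D hull F \<subseteq> A" "is_submodule D hull F \<noteq> {0}" "finite F"
    "x \<in> v_op D (is_submodule D hull F)"
    unfolding t_op_def fin_gen_fractional_ideal_def by auto
  have "\<not> F \<subseteq> {0}"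
  proof
    assume "F \<subseteq> {0}"
    moreover have "is_submodule D {0}" by (simp add: is_submodule_def)
    ultimately have "is_submodule D hull F \<subseteq> {0}" by (rule hull_minimal)
    with F(2) is_submodule_hull[of F] show False by (auto simp: is_submodule_def)
  qed
  moreover have "F \<subseteq> A" using F(1) hull_subset by fast
  ultimately show "\<exists>F. ?P F"
    using F(3,4) unfolding v_op_def inv_ideal_hull by (auto simp: inv_ideal_def)
next
  assume "\<exists>F. ?P F"
  then obtain F where F: "?P F" by blast
  let ?I = "is_submodule D hull F"
  have sub: "?I \<subseteq> A" by (rule hull_minimal) (use A F in auto)
  have "fractional_ideal D ?I"
    unfolding fractional_ideal_def
    by (intro conjI is_submodule_hull bexI[of _ 1]) (use sub A one_mem in auto)
  moreover have "?I \<noteq> {0}" using F hull_subset[of F "is_submodule D"] by auto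
  moreover have "x \<in> v_op D ?I"
    using F unfolding v_op_def inv_ideal_hull by (auto simp: inv_ideal_def)
  ultimately show "x \<in> t_op D A"
    using F sub unfolding t_op_def fin_gen_fractional_ideal_def by blast
qed

lemma t_op_subset: "is_submodule D A \<Longrightarrow> A \<subseteq> D \<Longrightarrow> t_op D A \<subseteq> D"
  unfolding subset_iff[of "t_op D A"] mem_t_op_iff by (metis mult.left_neutral mult.right_neutral subset_iff)

lemma subset_t_op:
  assumes "is_submodule D A" "A \<subseteq> D" "A \<noteq> {0}"
  shows "A \<subseteq> t_op D A"
proof
  fix x assume x: "x \<in> A"
  \<comment> \<open>The finite set is \<open>{x, a}\<close>; the nonzero \<open>a\<close> keeps it
    admissible when \<open>x = 0\<close>.\<close>
  obtain a where "a \<in> A" "a \<noteq> 0" using assms by (auto simp: is_submodule_def)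
  with x show "x \<in> t_op D A"
    unfolding mem_t_op_iff[OF assms(1,2)] by (intro exI[of _ "{x, a}"]) (auto simp: mult.commute)
qed

lemma is_submodule_t_op:
  assumes A: "is_submodule D A" "A \<subseteq> D" "A \<noteq> {0}"
  shows "is_submodule D (t_op D A)"
proof -
  have "x + z \<in> t_op D A" if xz: "x \<in> t_op D A" "z \<in> t_op D A" for x z
  proof -
    obtain F G where F: "finite F" "F \<subseteq> A" "\<not> F \<subseteq> {0}" "\<And>y. (\<forall>f\<in>F. y * f \<in> D) \<Longrightarrow> x * y \<in> D"
      and G: "finite G" "G \<subseteq> A" "\<And>y. (\<forall>f\<in>G. y * f \<in> D) \<Longrightarrow> z * y \<in> D"
      using xz unfolding mem_t_op_iff[OF A(1,2)] by metis
    show ?thesis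
      unfolding mem_t_op_iff[OF A(1,2)]
      by (intro exI[of _ "F \<union> G"]) (use F G in \<open>auto simp: distrib_right add_mem\<close>)
  qed
  moreover have "d * x \<in> t_op D A" if "d \<in> D" "x \<in> t_op D A" for d x
    using that unfolding mem_t_op_iff[OF A(1,2)] by (metis mult.assoc mult_mem)
  moreover have "0 \<in> t_op D A"
    using subset_t_op[OF A] A(1) by (auto simp: is_submodule_def)
  ultimately show ?thesis by (auto simp: is_submodule_def)
qed

text \<open>Each element of the finite set witnessing membership in the outer closure has its own
  finite witness in \<open>A\<close>; the union of these is a witness for the whole.\<close>

lemma t_op_idem:
  assumes A: "is_submodule D A" "A \<subseteq> D" "A \<noteq> {0}"
  shows "t_op D (t_op D A) = t_op D A"
proof
  note T = is_submodule_t_op[OF A] t_op_subset[OF A(1,2)]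
  have ne: "t_op D A \<noteq> {0}" using subset_t_op[OF A] A by (auto simp: is_submodule_def)
  show "t_op D A \<subseteq> t_op D (t_op D A)" by (rule subset_t_op[OF T ne])
  show "t_op D (t_op D A) \<subseteq> t_op D A"
  proof
    fix x assume "x \<in> t_op D (t_op D A)"
    then obtain F where F: "finite F" "F \<subseteq> t_op D A" "\<not> F \<subseteq> {0}"
      "\<And>y. (\<forall>f\<in>F. y * f \<in> D) \<Longrightarrow> x * y \<in> D"
      unfolding mem_t_op_iff[OF T] by metis
    from F(2) have "\<forall>f\<in>F. \<exists>G. finite G \<and> G \<subseteq> A \<and> \<not> G \<subseteq> {0} \<and> (\<forall>y. (\<forall>g\<in>G. y * g \<in> D) \<longrightarrow> f * y \<in> D)"
      using mem_t_op_iff[OF A(1,2)] by blast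
    then obtain G where G: "\<And>f. f \<in> F \<Longrightarrow> finite (G f) \<and> G f \<subseteq> A \<and> \<not> G f \<subseteq> {0} \<and>
      (\<forall>y. (\<forall>g\<in>G f. y * g \<in> D) \<longrightarrow> f * y \<in> D)" by metis
    show "x \<in> t_op D A"
      unfolding mem_t_op_iff[OF A(1,2)]
    proof (intro exI[of _ "\<Union>f\<in>F. G f"] conjI allI impI)
      show "x * y \<in> D" if "\<forall>f\<in>\<Union>f\<in>F. G f. y * f \<in> D" for y
      proof (rule F(4), rule)
        fix f assume "f \<in> F"
        then have "\<forall>g\<in>G f. y * g \<in> D" using that by auto
        then show "y * f \<in> D" using G[OF \<open>f \<in> F\<close>] by (metis mult.commute)
      qed
      show "\<not> (\<Union>f\<in>F. G f) \<subseteq> {0}"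
      proof -
        obtain f where "f \<in> F" using F(3) by auto
        then show ?thesis using G[of f] by (meson UN_upper subset_trans)
      qed
      show "(\<Union>f\<in>F. G f) \<subseteq> A" using G by blast
    qed (use F G in auto)
  qed
qed

lemma t_ideal_iff:
  "t_ideal D A \<longleftrightarrow> is_submodule D A \<and> A \<subseteq> D \<and> A \<noteq> {0} \<and> t_op D A = A"
  unfolding t_ideal_def ideal_iff by auto

lemma t_idealD:
  assumes "t_ideal D A" "finite F" "F \<subseteq> A" "\<not> F \<subseteq> {0}"
    and "\<And>y. (\<And>f. f \<in> F \<Longrightarrow> y * f \<in> D) \<Longrightarrow> x * y \<in> D"
  shows "x \<in> A"
  using mem_t_op_iff[of A x] assms unfolding t_ideal_iff by metis

text \<open>The closure stays in \<open>D\<close>, so the test may be restricted to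
  \<open>x \<in> D\<close>; this allows primality to be applied to \<open>x\<close>.\<close>

lemma t_idealI:
  assumes "is_submodule D A" "A \<subseteq> D" "A \<noteq> {0}"
    and "\<And>F x. finite F \<Longrightarrow> F \<subseteq> A \<Longrightarrow> \<not> F \<subseteq> {0} \<Longrightarrow> x \<in> D \<Longrightarrow>
      (\<And>y. (\<And>f. f \<in> F \<Longrightarrow> y * f \<in> D) \<Longrightarrow> x * y \<in> D) \<Longrightarrow> x \<in> A"
  shows "t_ideal D A"
proof -
  have "t_op D A \<subseteq> A"
  proof
    fix x assume x: "x \<in> t_op D A"
    then have "x \<in> D" using t_op_subset[OF assms(1,2)] by auto
    then show "x \<in> A" using x assms(4) unfolding mem_t_op_iff[OF assms(1,2)] by metis
  qed
  then show ?thesis using subset_t_op[OF assms(1-3)] assms unfolding t_ideal_iff by auto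
qed

text \<open>By idempotence the closure of \<open>A\<close> is itself a \<open>t\<close>-ideal. It
  lies strictly above \<open>Q\<close>, so maximality leaves only \<open>D\<close>.\<close>

lemma t_op_eq_of_maximal_t_ideal:
  assumes Q: "maximal_t_ideal D Q" and A: "is_submodule D A" "A \<subseteq> D" "Q \<subset> A"
  shows "t_op D A = D"
proof (rule ccontr)
  assume ne: "t_op D A \<noteq> D"
  have "0 \<in> Q" using Q unfolding maximal_t_ideal_def t_ideal_iff is_submodule_def by simp
  then have A0: "A \<noteq> {0}" using A(3) by auto
  have "t_op D A \<noteq> {0}" using subset_t_op[OF A(1,2) A0] A0 A(1) by (auto simp: is_submodule_def)
  then have "t_ideal D (t_op D A)"
    unfolding t_ideal_iff
    using t_op_idem[OF A(1,2) A0] is_submodule_t_op[OF A(1,2) A0] t_op_subset[OF A(1,2)] by blast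
  then have "t_op D A = Q"
    using Q ne A(3) subset_t_op[OF A(1,2) A0] unfolding maximal_t_ideal_def by blast
  then show False using A(3) subset_t_op[OF A(1,2) A0] by blast
qed

text \<open>If \<open>a * b \<in> Q\<close> and \<open>a \<notin> Q\<close>, then
  \<open>Q + aD\<close> has \<open>t\<close>-closure \<open>D\<close>. Multiplying a finite witness
  of this by \<open>b\<close> moves it into \<open>Q\<close>, which puts \<open>b\<close> into the
  \<open>t\<close>-closure of \<open>Q\<close>.\<close>

lemma primeideal_of_maximal_t_ideal:
  assumes Q: "maximal_t_ideal D Q"
  shows "primeideal Q (ring_on D)"
proof -
  have tQ: "t_ideal D Q" and Q': "is_submodule D Q" "Q \<subseteq> D" "Q \<noteq> {0}" "Q \<noteq> D"
    using Q unfolding maximal_t_ideal_def t_ideal_iff by auto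
  have "1 \<notin> Q" using Q' one_mem unfolding is_submodule_def by (metis mult.right_neutral subsetI subset_antisym)
  moreover have "b \<in> Q" if ab: "a \<in> D" "b \<in> D" "a * b \<in> Q" "a \<notin> Q" for a b
  proof (cases "b = 0")
    case True
    then show ?thesis using Q' by (simp add: is_submodule_def)
  next
    case False
    define A where "A = {q + r * a | q r. q \<in> Q \<and> r \<in> D}"
    have A: "is_submodule D A"
      unfolding is_submodule_def
    proof (intro conjI ballI)
      show "0 \<in> A" unfolding A_def using Q'(1) zero_mem
        by (auto simp: is_submodule_def intro!: exI[of _ 0])
      show "x + y \<in> A" if "x \<in> A" "y \<in> A" for x y
      proof -
        from that obtain q r q' r' where
          "x = q + r * a" "y = q' + r' * a" "q \<in> Q" "q' \<in> Q" "r \<in> D" "r' \<in> D"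
          unfolding A_def by blast
        then show ?thesis using Q'(1) add_mem unfolding A_def is_submodule_def
          by (intro CollectI exI[of _ "q + q'"] exI[of _ "r + r'"]) (auto simp: algebra_simps)
      qed
      show "d * x \<in> A" if "d \<in> D" "x \<in> A" for d x
      proof -
        from that(2) obtain q r where "x = q + r * a" "q \<in> Q" "r \<in> D"
          unfolding A_def by blast
        then show ?thesis using Q'(1) that mult_mem unfolding A_def is_submodule_def
          by (intro CollectI exI[of _ "d * q"] exI[of _ "d * r"]) (auto simp: algebra_simps)
      qed
    qed
    have AD: "A \<subseteq> D" using Q'(2) ab(1) add_mem mult_mem by (auto simp: A_def)
    have "q \<in> A" if "q \<in> Q" for q
      using that zero_mem unfolding A_def by (intro CollectI exI[of _ q] exI[of _ 0]) auto
    moreover have "a \<in> A"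
      using Q'(1) one_mem unfolding A_def is_submodule_def
      by (intro CollectI exI[of _ 0] exI[of _ 1]) auto
    ultimately have "Q \<subset> A" using ab(4) by blast
    from t_op_eq_of_maximal_t_ideal[OF Q A AD this] have "1 \<in> t_op D A" using one_mem by simp
    then obtain F where F: "finite F" "F \<subseteq> A" "\<not> F \<subseteq> {0}" "\<And>y. (\<forall>f\<in>F. y * f \<in> D) \<Longrightarrow> 1 * y \<in> D"
      unfolding mem_t_op_iff[OF A AD] by blast
    from F(2) have "\<forall>f\<in>F. \<exists>q r. f = q + r * a \<and> q \<in> Q \<and> r \<in> D" unfolding A_def by blast
    then obtain q r where qr: "\<And>f. f \<in> F \<Longrightarrow> f = q f + r f * a \<and> q f \<in> Q \<and> r f \<in> D" by metis
    \<comment> \<open>Multiplied by \<open>b\<close>, each \<open>f = q f + r f * a\<close> is a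
      combination of \<open>b * q f\<close> and \<open>a * b\<close>, both in \<open>Q\<close>. As
      \<open>a\<close> and \<open>b\<close> are nonzero, \<open>a * b\<close> makes \<open>G\<close>
      admissible.\<close>
    define G where "G = insert (a * b) ((\<lambda>f. b * q f) ` F)"
    show "b \<in> Q"
    proof (rule t_idealD[OF tQ, of G])
      show "finite G" using F(1) by (simp add: G_def)
      show "G \<subseteq> Q" using ab qr Q'(1) by (auto simp: G_def is_submodule_def)
      show "\<not> G \<subseteq> {0}" using ab(4) False Q'(1) by (auto simp: G_def is_submodule_def)
      fix y assume y: "\<And>g. g \<in> G \<Longrightarrow> y * g \<in> D"
      have "b * y * f \<in> D" if "f \<in> F" for f
      proof -
        have "y * (b * q f) \<in> D" "y * (a * b) \<in> D" using y that by (auto simp: G_def)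
        then have "y * (b * q f) + r f * (y * (a * b)) \<in> D" using qr[OF that] add_mem mult_mem by blast
        moreover have "y * (b * q f) + r f * (y * (a * b)) = b * y * (q f + r f * a)"
          by (simp add: algebra_simps)
        ultimately show ?thesis using qr[OF that] by simp
      qed
      then show "b * y \<in> D" using F(4)[of "b * y"] by simp
    qed
  qed
  ultimately show ?thesis unfolding primeideal_iff using Q' by blast
qed

end


section \<open>Ordering torsionless monoids\<close>

text \<open>The same sum as in the hypothesis \<open>torsionless\<close>, which therefore transfers
  by unfolding.\<close>

definition multiple :: "nat \<Rightarrow> 'g::cancel_comm_monoid_add \<Rightarrow> 'g" where
  "multiple n a = (\<Sum>i<n. a)"

lemma multiple_0 [simp]: "multiple 0 a = 0"
  and multiple_Suc [simp]: "multiple (Suc n) a = a + multiple n a"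
  by (simp_all add: multiple_def add.commute)

lemma multiple_1 [simp]: "multiple 1 a = a"
  by (simp add: multiple_def)

lemma multiple_add: "multiple n (a + b) = multiple n a + multiple n b"
  by (simp add: multiple_def sum.distrib)

lemma multiple_plus: "multiple (m + n) a = multiple m a + multiple n a"
  by (induction m) (auto simp: add.assoc)

lemma multiple_mult: "multiple (m * n) a = multiple m (multiple n a)"
  by (induction m) (auto simp: multiple_plus)

text \<open>Root closure is the induction invariant: it is what keeps the relation antisymmetric
  when a new comparison is forced.\<close>

definition root_closed_order :: "('g::cancel_comm_monoid_add \<times> 'g) set \<Rightarrow> bool" where
  "root_closed_order P \<longleftrightarrow> refl P \<and> antisym P \<and> trans P \<and>
     (\<forall>a b c. (a, b) \<in> P \<longleftrightarrow> (a + c, b + c) \<in> P) \<and>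
     (\<forall>n a b. n \<ge> 1 \<longrightarrow> (multiple n a, multiple n b) \<in> P \<longrightarrow> (a, b) \<in> P)"

lemma root_closed_orderD:
  assumes "root_closed_order P"
  shows "(a, a) \<in> P"
    and "(a, b) \<in> P \<Longrightarrow> (b, a) \<in> P \<Longrightarrow> a = b"
    and "(a, b) \<in> P \<Longrightarrow> (b, c) \<in> P \<Longrightarrow> (a, c) \<in> P"
    and "(a, b) \<in> P \<Longrightarrow> (a + c, b + c) \<in> P"
    and "(a + c, b + c) \<in> P \<Longrightarrow> (a, b) \<in> P"
    and "n \<ge> 1 \<Longrightarrow> (multiple n a, multiple n b) \<in> P \<Longrightarrow> (a, b) \<in> P"
  using assms unfolding root_closed_order_def refl_on_def antisym_def trans_def by blast+

lemma root_closed_order_add: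
  assumes "root_closed_order P" "(a, b) \<in> P" "(c, d) \<in> P"
  shows "(a + c, b + d) \<in> P"
  using root_closed_orderD(4)[OF assms(1,2), of c] root_closed_orderD(4)[OF assms(1,3), of b]
    root_closed_orderD(3)[OF assms(1)] by (metis add.commute)

lemma root_closed_order_multiple:
  assumes "root_closed_order P" "(a, b) \<in> P"
  shows "(multiple n a, multiple n b) \<in> P"
  by (induction n) (auto intro: root_closed_orderD(1)[OF assms(1)] root_closed_order_add[OF assms])

text \<open>\<open>extend_order P a b\<close> is the cone generated by \<open>P\<close> and \<open>b - a\<close>, closed under roots.\<close>

definition extend_order ::
    "('g::cancel_comm_monoid_add \<times> 'g) set \<Rightarrow> 'g \<Rightarrow> 'g \<Rightarrow> ('g \<times> 'g) set" where
  "extend_order P a b =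
     {(x, y). \<exists>n m. n \<ge> 1 \<and> (multiple n x + multiple m b, multiple n y + multiple m a) \<in> P}"

text \<open>For antisymmetry, suitable multiples of the two given inequalities add up to
  \<open>m b \<le> m a\<close> after cancellation. Root closure of \<open>P\<close> would give
  \<open>b \<le> a\<close> unless \<open>m = 0\<close>, and then both inequalities already hold in
  \<open>P\<close>.\<close>

lemma root_closed_order_extend:
  assumes P: "root_closed_order P" and ba: "(b, a) \<notin> P"
  shows "root_closed_order (extend_order P a b)"
proof -
  note D = root_closed_orderD[OF P]
  \<comment> \<open>Scaling the first inequality by \<open>n'\<close> and the second by
    \<open>n\<close> gives \<open>y\<close> the same coefficient in both, so that it can be
    cancelled.\<close>
  have combine: "\<exists>m. (multiple (n * n') x + multiple m b + multiple (n * n') y,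
      multiple (n * n') y + multiple m a + multiple (n * n') z) \<in> P \<and> (n * k' + n' * k = m)"
    if "(multiple n x + multiple k b, multiple n y + multiple k a) \<in> P"
      "(multiple n' y + multiple k' b, multiple n' z + multiple k' a) \<in> P" for n n' k k' x y z
    using root_closed_order_add[OF P root_closed_order_multiple[OF P that(1), of n']
        root_closed_order_multiple[OF P that(2), of n]]
    by (simp add: multiple_add multiple_plus multiple_mult[symmetric] ac_simps)
  have anti: "x = y" if "(x, y) \<in> extend_order P a b" "(y, x) \<in> extend_order P a b" for x y
  proof -
    obtain n k n' k' where n: "n \<ge> 1" "n' \<ge> 1"
      and nk: "(multiple n x + multiple k b, multiple n y + multiple k a) \<in> P"
        "(multiple n' y + multiple k' b, multiple n' x + multiple k' a) \<in> P"
      using \<open>(x, y) \<in> _\<close> \<open>(y, x) \<in> _\<close> unfolding extend_order_def by blast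
    define m where "m = n * k' + n' * k"
    have "(multiple m b + (multiple (n * n') x + multiple (n * n') y),
        multiple m a + (multiple (n * n') x + multiple (n * n') y)) \<in> P"
      using combine[OF nk] unfolding m_def by (simp add: ac_simps)
    then have "(multiple m b, multiple m a) \<in> P" by (rule D(5))
    with ba D(6)[of m b a] have "m = 0" by fastforce
    with n have "k = 0" "k' = 0" by (auto simp: m_def)
    with nk D(6)[OF n(1), of x y] D(6)[OF n(2), of y x] show "x = y"
      by (simp add: D(2))
  qed
  have tr: "(x, z) \<in> extend_order P a b"
    if "(x, y) \<in> extend_order P a b" "(y, z) \<in> extend_order P a b" for x y z
  proof -
    obtain n k n' k' where n: "n \<ge> 1" "n' \<ge> 1"
      and nk: "(multiple n x + multiple k b, multiple n y + multiple k a) \<in> P"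
        "(multiple n' y + multiple k' b, multiple n' z + multiple k' a) \<in> P"
      using \<open>(x, y) \<in> _\<close> \<open>(y, z) \<in> _\<close> unfolding extend_order_def by blast
    define m where "m = n * k' + n' * k"
    have "((multiple (n * n') x + multiple m b) + multiple (n * n') y,
        (multiple (n * n') z + multiple m a) + multiple (n * n') y) \<in> P"
      using combine[OF nk] unfolding m_def by (simp add: ac_simps)
    then have "(multiple (n * n') x + multiple m b, multiple (n * n') z + multiple m a) \<in> P"
      by (rule D(5))
    moreover have "n * n' \<ge> 1" using n by simp
    ultimately show ?thesis unfolding extend_order_def by blast
  qed
  have shift: "(x, y) \<in> extend_order P a b \<longleftrightarrow> (x + c, y + c) \<in> extend_order P a b" for x y c
  proof -
    have "(multiple n x + multiple m b, multiple n y + multiple m a) \<in> P \<longleftrightarrow>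
      (multiple n (x + c) + multiple m b, multiple n (y + c) + multiple m a) \<in> P" for n m
      using D(4)[of "multiple n x + multiple m b" "multiple n y + multiple m a" "multiple n c"]
        D(5)[of "multiple n x + multiple m b" "multiple n c" "multiple n y + multiple m a"]
      by (auto simp: multiple_add ac_simps)
    then show ?thesis unfolding extend_order_def by simp
  qed
  have root: "(x, y) \<in> extend_order P a b"
    if r: "r \<ge> 1" "(multiple r x, multiple r y) \<in> extend_order P a b" for r x y
  proof -
    obtain n m where "n \<ge> 1" "(multiple (n * r) x + multiple m b, multiple (n * r) y + multiple m a) \<in> P"
      using r(2) unfolding extend_order_def multiple_mult by blast
    moreover from this r(1) have "n * r \<ge> 1" by simp
    ultimately show ?thesis unfolding extend_order_def by blast
  qed
  have refl: "(x, x) \<in> extend_order P a b" for x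
    unfolding extend_order_def mem_Collect_eq case_prod_conv
    by (rule exI[of _ 1], rule exI[of _ 0]) (simp add: D(1))
  show ?thesis
    unfolding root_closed_order_def
  proof (intro conjI allI impI)
    show "refl (extend_order P a b)" using refl by (auto simp: refl_on_def)
    show "antisym (extend_order P a b)" using anti by (auto intro: antisymI)
    show "trans (extend_order P a b)" using tr by (auto intro: transI)
  qed (use shift root in blast)+
qed

text \<open>Torsionlessness makes equality a root-closed order, so Zorn's lemma has a starting
  point. In a maximal order no pair is incomparable, since \<open>extend_order\<close> would enlarge
  it.\<close>

theorem torsionless_total_order:
  assumes torsionless: "\<And>n (a::'g::cancel_comm_monoid_add) b. n \<ge> 1 \<Longrightarrow> multiple n a = multiple n b \<Longrightarrow> a = b"
  obtains P :: "('g::cancel_comm_monoid_add \<times> 'g) set" where "root_closed_order P" "total P"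
proof -
  have "\<exists>M\<in>Collect root_closed_order :: ('g \<times> 'g) set set.
      \<forall>N\<in>Collect root_closed_order. M \<subseteq> N \<longrightarrow> N = M"
  proof (rule subset_Zorn_nonempty)
    have "root_closed_order (Id :: ('g \<times> 'g) set)"
      using torsionless by (auto simp: root_closed_order_def refl_on_def antisym_def trans_def)
    then show "(Collect root_closed_order :: ('g \<times> 'g) set set) \<noteq> {}" by blast
    fix C :: "('g \<times> 'g) set set"
    assume ne: "C \<noteq> {}" and ch: "subset.chain (Collect root_closed_order) C"
    have C: "root_closed_order N" if "N \<in> C" for N
      using ch that by (auto simp: subset.chain_def)
    have two: "\<exists>Z\<in>C. N \<subseteq> Z \<and> L \<subseteq> Z" if "N \<in> C" "L \<in> C" for N L
      using ch that unfolding subset_chain_def by (metis order_refl)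
    have "(x, x) \<in> \<Union>C" for x using ne C root_closed_orderD(1) by blast
    moreover have "x = y" if "(x, y) \<in> \<Union>C" "(y, x) \<in> \<Union>C" for x y
    proof -
      from that obtain N L where "N \<in> C" "L \<in> C" "(x, y) \<in> N" "(y, x) \<in> L" by blast
      with two[of N L] C root_closed_orderD(2) show ?thesis by (metis subsetD)
    qed
    moreover have "(x, z) \<in> \<Union>C" if "(x, y) \<in> \<Union>C" "(y, z) \<in> \<Union>C" for x y z
    proof -
      from that obtain N L where "N \<in> C" "L \<in> C" "(x, y) \<in> N" "(y, z) \<in> L" by blast
      moreover obtain Z where "Z \<in> C" "N \<subseteq> Z" "L \<subseteq> Z" using two calculation by blast
      ultimately have "(x, z) \<in> Z" using root_closed_orderD(3)[OF C] by blast
      with \<open>Z \<in> C\<close> show ?thesis by blast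
    qed
    moreover have "(a, b) \<in> \<Union>C \<longleftrightarrow> (a + c, b + c) \<in> \<Union>C" for a b c
      using root_closed_orderD(4,5)[OF C] by blast
    moreover have "(a, b) \<in> \<Union>C" if "n \<ge> 1" "(multiple n a, multiple n b) \<in> \<Union>C" for n a b
      using root_closed_orderD(6)[OF C] that by blast
    ultimately show "\<Union>C \<in> (Collect root_closed_order)"
      unfolding root_closed_order_def refl_on_def antisym_def trans_def by blast
  qed
  then obtain M :: "('g \<times> 'g) set" where M: "root_closed_order M"
    and max: "\<And>N. root_closed_order N \<Longrightarrow> M \<subseteq> N \<Longrightarrow> N = M" by blast
  have "total M"
    unfolding total_on_def
  proof (intro ballI impI)
    fix a b
    show "(a, b) \<in> M \<or> (b, a) \<in> M"
    proof (rule disjCI)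
      assume ba: "(b, a) \<notin> M"
      have "M \<subseteq> extend_order M a b"
      proof clarify
        fix x y assume "(x, y) \<in> M"
        show "(x, y) \<in> extend_order M a b"
          unfolding extend_order_def mem_Collect_eq case_prod_conv
          by (rule exI[of _ 1], rule exI[of _ 0]) (simp add: \<open>(x, y) \<in> M\<close>)
      qed
      then have "extend_order M a b = M" by (intro max root_closed_order_extend M ba)
      moreover have "(a, b) \<in> extend_order M a b"
        unfolding extend_order_def mem_Collect_eq case_prod_conv
        by (rule exI[of _ 1], rule exI[of _ 1]) (simp add: add.commute root_closed_orderD(1)[OF M])
      ultimately show "(a, b) \<in> M" by simp
    qed
  qed
  with M that show thesis by blast
qed

text \<open>
  A variant of the Dedekind--Mertens lemma: \<open>f\<close> and \<open>w\<close> are families of coefficients of elements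
  of a monoid algebra, and the assumption says that the coefficients of the products \<open>f k * w\<close>
  lie in \<open>I\<close>.
\<close>

lemma coefficients_mem_of_product:
  fixes f :: "'a \<Rightarrow> 'g::cancel_comm_monoid_add \<Rightarrow> 'k::field" and P :: "('g \<times> 'g) set"
  assumes P: "root_closed_order P" "total P"
    and I: "0 \<in> I" "\<And>x y. x \<in> I \<Longrightarrow> y \<in> I \<Longrightarrow> x - y \<in> I"
    and fI: "\<And>k i x. i \<in> S k \<Longrightarrow> x \<in> I \<Longrightarrow> f k i * x \<in> I"
    and sat: "\<And>x. (\<And>k i. i \<in> S k \<Longrightarrow> f k i * x \<in> I) \<Longrightarrow> x \<in> I"
    and fin: "\<And>k. finite (S k)" "finite T"
    and prod: "\<And>k n. (\<Sum>i\<in>S k. \<Sum>j\<in>T. if i + j = n then f k i * w j else 0) \<in> I"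
    and "j \<in> T"
  shows "w j \<in> I"
  using fin(2) prod \<open>j \<in> T\<close>
proof (induction "card T" arbitrary: T w j rule: less_induct)
  case less
  note D = root_closed_orderD[OF P(1)]
  define lt where "lt a b \<longleftrightarrow> (a, b) \<in> P \<and> a \<noteq> b" for a b :: 'g
  have total: "lt a b \<or> a = b \<or> lt b a" for a b
    using P(2) unfolding total_on_def lt_def by auto
  have lt_irrefl: "\<not> lt a a" for a by (simp add: lt_def)
  have lt_trans: "lt a c" if "lt a b" "lt b c" for a b c
    using that D(2,3) unfolding lt_def by metis
  have lt_add: "a + c \<noteq> b + d" if "lt a b" "lt c d \<or> c = d" for a b c d
  proof
    assume eq: "a + c = b + d"
    have "(a + c, b + c) \<in> P" "(b + c, b + d) \<in> P"
      using that D(4)[of a b c] D(4)[of c d b] D(1) by (auto simp: lt_def add.commute)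
    with eq D(2) have "a + c = b + c" by metis
    with that show False by (simp add: lt_def)
  qed
  have max_ex: "\<exists>m\<in>A. \<forall>a\<in>A. lt a m \<or> a = m" if "finite A" "A \<noteq> {}" for A :: "'g set"
    using that
  proof (induction rule: finite_ne_induct)
    case (insert x F)
    then obtain m where m: "m \<in> F" "\<forall>a\<in>F. lt a m \<or> a = m" by blast
    then show ?case using total[of x m] lt_trans by blast
  qed auto
  have add: "x + y \<in> I" if "x \<in> I" "y \<in> I" for x y
    using I(2)[OF that(1) I(2)[OF I(1) that(2)]] by simp
  have sum: "sum g A \<in> I" if "\<And>a. a \<in> A \<Longrightarrow> g a \<in> I" for g :: "'g \<Rightarrow> 'k" and A
    using that by (induction A rule: infinite_finite_induct) (auto simp: I(1) add)
  obtain t where t: "t \<in> T" "\<And>j. j \<in> T \<Longrightarrow> lt j t \<or> j = t"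
    using max_ex[OF less.prems(1)] less.prems(3) by blast
  have all: "\<forall>j\<in>T. f k i * w j \<in> I" if i: "i \<in> S k" for k i
  proof (rule ccontr)
    assume not_all: "\<not> (\<forall>j\<in>T. f k i * w j \<in> I)"
    define B where "B = {i\<in>S k. \<not> (\<forall>j\<in>T. f k i * w j \<in> I)}"
    have "B \<noteq> {}" using not_all i by (auto simp: B_def)
    moreover have "finite B" using fin(1)[of k] by (simp add: B_def)
    ultimately obtain m where mB: "m \<in> B" "\<forall>i\<in>B. lt i m \<or> i = m" using max_ex[of B] by blast
    have m: "m \<in> S k" "\<not> (\<forall>j\<in>T. f k m * w j \<in> I)" using mB(1) by (auto simp: B_def)
    have above: "f k i * w j \<in> I" if "i \<in> S k" "j \<in> T" "lt m i" for i j
    proof -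
      have "i \<notin> B" using mB(2) \<open>lt m i\<close> lt_trans lt_irrefl by blast
      with that show ?thesis by (auto simp: B_def)
    qed
    define s where "s i = (\<Sum>j\<in>T. if i + j = m + t then f k i * w j else 0)" for i
    have rest: "s i \<in> I" if "i \<in> S k - {m}" for i
      unfolding s_def
    proof (rule sum)
      fix j assume j: "j \<in> T"
      have "i \<noteq> m" using that by simp
      then consider "lt m i" | "lt i m" using total[of m i] by blast
      then show "(if i + j = m + t then f k i * w j else 0) \<in> I"
        using above[of i j] lt_add[of i m j t] t(2)[OF j] that j I(1) by cases auto
    qed
    have "s m = f k m * w t"
      using t(1) less.prems(1) by (simp add: s_def sum.delta)
    then have "f k m * w t = sum s (S k) - sum s (S k - {m})"
      using sum.remove[OF fin(1) m(1), of s] by simp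
    moreover have "sum s (S k) \<in> I" unfolding s_def by (rule less.prems(2))
    ultimately have top: "f k m * w t \<in> I"
      using sum[of "S k - {m}" s, OF rest] I(2) by simp
    \<comment> \<open>The induction is applied to the rescaled family \<open>f k m * w\<close>
      without its top term. Its product coefficients stay in \<open>I\<close> because the terms
      removed are multiples of \<open>f k m * w t\<close>.\<close>
    have "f k m * w j \<in> I" if "j \<in> T - {t}" for j
    proof (rule less.hyps[OF _ _ _ that])
      show "card (T - {t}) < card T" using less.prems(1) t(1) by (rule card_Diff1_less)
      show "finite (T - {t})" using less.prems(1) by simp
      fix k' n
      have "(\<Sum>j\<in>T - {t}. if i + j = n then f k' i * (f k m * w j) else 0) =
          f k m * (\<Sum>j\<in>T. if i + j = n then f k' i * w j else 0)
          - (if i + t = n then f k' i * (f k m * w t) else 0)" for i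
      proof -
        have "(if i + j = n then f k' i * (f k m * w j) else 0) =
            f k m * (if i + j = n then f k' i * w j else 0)" for j
          by (simp add: mult.left_commute)
        then show ?thesis
          unfolding sum.remove[OF less.prems(1) t(1)] distrib_left sum_distrib_left by simp
      qed
      then have "(\<Sum>i\<in>S k'. \<Sum>j\<in>T - {t}. if i + j = n then f k' i * (f k m * w j) else 0) =
          f k m * (\<Sum>i\<in>S k'. \<Sum>j\<in>T. if i + j = n then f k' i * w j else 0)
          - (\<Sum>i\<in>S k'. if i + t = n then f k' i * (f k m * w t) else 0)"
        by (simp add: sum_subtractf sum_distrib_left)
      also have "\<dots> \<in> I"
        by (intro I(2) fI m(1) less.prems(2) sum) (auto intro: fI top I(1))
      finally show "(\<Sum>i\<in>S k'. \<Sum>j\<in>T - {t}. if i + j = n then f k' i * (f k m * w j) else 0) \<in> I" .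
    qed
    with top m(2) show False by blast
  qed
  show ?case by (rule sat) (use all less.prems(3) in blast)
qed


section \<open>Greatest common divisors in Laurent polynomial rings\<close>

text \<open>A zero denominator is harmless here: division by 0 yields 0, which is a fraction
  anyway.\<close>

definition fractions :: "'k::field set \<Rightarrow> 'k set" where
  "fractions D = {a / b | a b. a \<in> D \<and> b \<in> D}"

context field_subring
begin

lemma fractionsE:
  assumes "x \<in> fractions D"
  obtains a b where "a \<in> D" "b \<in> D" "b \<noteq> 0" "x = a / b"
proof -
  obtain a b where "a \<in> D" "b \<in> D" "x = a / b" using assms unfolding fractions_def by blast
  then show thesis using that[of a b] that[of 0 1] zero_mem one_mem by (cases "b = 0") auto
qed

lemma fractionsI: "a \<in> D \<Longrightarrow> b \<in> D \<Longrightarrow> a / b \<in> fractions D"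
  unfolding fractions_def by blast

lemma subset_fractions: "x \<in> D \<Longrightarrow> x \<in> fractions D"
  using fractionsI[of x 1] one_mem by simp

lemma field_subring_fractions: "field_subring (fractions D)"
proof
  show "1 \<in> fractions D" by (rule subset_fractions[OF one_mem])
  fix x y assume "x \<in> fractions D" "y \<in> fractions D"
  then obtain a b c d where xy: "a \<in> D" "b \<in> D" "b \<noteq> 0" "x = a / b" "c \<in> D" "d \<in> D" "d \<noteq> 0" "y = c / d"
    by (elim fractionsE) blast
  then have "x - y = (a * d - c * b) / (b * d)" "x * y = (a * c) / (b * d)"
    by (simp_all add: field_simps)
  then show "x - y \<in> fractions D" "x * y \<in> fractions D"
    using xy fractionsI diff_mem mult_mem by metis+
qed

lemma divide_fractions: "x \<in> fractions D \<Longrightarrow> y \<in> fractions D \<Longrightarrow> x / y \<in> fractions D"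
  by (elim fractionsE) (auto intro!: fractionsI mult_mem)

lemma common_denominator:
  assumes "finite S" "S \<subseteq> fractions D"
  shows "\<exists>d\<in>D - {0}. \<forall>x\<in>S. d * x \<in> D"
  using assms
proof (induction rule: finite_induct)
  case empty
  then show ?case using one_mem by (intro bexI[of _ 1]) auto
next
  case (insert x S)
  then obtain d where d: "d \<in> D" "d \<noteq> 0" "\<forall>x\<in>S. d * x \<in> D" by auto
  obtain a b where ab: "a \<in> D" "b \<in> D" "b \<noteq> 0" "x = a / b"
    using insert.prems by (blast elim: fractionsE)
  have "d * b * y \<in> D" if "y \<in> S" for y
    using mult_mem[OF ab(2), of "d * y"] d that by (simp add: ac_simps)
  with ab d show ?case by (intro bexI[of _ "d * b"]) (auto simp: mult_mem)
qed

end

text \<open>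
  The condition says that \<open>(aD + bD)\<^sub>v\<close> is generated by \<open>inverse e\<close>, a greatest common divisor.
\<close>

locale gcd_subring = field_subring +
  assumes gcd_ex: "a \<in> D \<Longrightarrow> b \<in> D \<Longrightarrow> a \<noteq> 0 \<Longrightarrow>
    \<exists>e. e \<noteq> 0 \<and> (\<forall>x. x * a \<in> D \<and> x * b \<in> D \<longleftrightarrow> x / e \<in> D)"
begin

text \<open>Let \<open>e\<close> settle \<open>S\<close> and write \<open>e * t = a / b\<close>.
  Then \<open>x / (e * b)\<close> times \<open>b\<close> is \<open>x / e\<close>, and times
  \<open>a\<close> it is \<open>x * t\<close>. So the conditions for \<open>S\<close> and
  \<open>t\<close> become the conditions for the pair \<open>b, a\<close>, which has a gcd.\<close>

lemma gcd_ex_finite: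
  assumes "finite S" "S \<subseteq> fractions D" "s \<in> S" "s \<noteq> 0"
  shows "\<exists>e. e \<noteq> 0 \<and> e \<in> fractions D \<and> (\<forall>x. (\<forall>s\<in>S. x * s \<in> D) \<longleftrightarrow> x / e \<in> D)"
  using assms
proof (induction arbitrary: s rule: finite_induct)
  case (insert t S)
  show ?case
  proof (cases "S \<subseteq> {0}")
    case True
    with insert.prems have "t \<noteq> 0" by auto
    moreover have "1 / t \<in> fractions D"
      using divide_fractions subset_fractions[OF one_mem] insert.prems(1) by auto
    moreover have "x * s \<in> D" if "s \<in> S" for x s using True that zero_mem by auto
    ultimately show ?thesis by (intro exI[of _ "1 / t"]) auto
  next
    case False
    then obtain s where "s \<in> S" "s \<noteq> 0" by auto
    with insert obtain e where e: "e \<noteq> 0" "e \<in> fractions D"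
      "\<And>x. (\<forall>s\<in>S. x * s \<in> D) \<longleftrightarrow> x / e \<in> D" by blast
    have "e * t \<in> fractions D"
      using field_subring.mult_mem[OF field_subring_fractions e(2)] insert.prems(1) by blast
    then obtain a b where ab: "a \<in> D" "b \<in> D" "b \<noteq> 0" "e * t = a / b" by (rule fractionsE)
    obtain e' where e': "e' \<noteq> 0" "\<And>x. x * b \<in> D \<and> x * a \<in> D \<longleftrightarrow> x / e' \<in> D"
      using gcd_ex[OF ab(2,1,3)] by blast
    have "e' * b \<in> D" using e'(2)[of e'] e'(1) one_mem by simp
    then have "e' \<in> fractions D" using fractionsI[of "e' * b" b] ab by simp
    then have "e * b * e' \<in> fractions D"
      using e(2) subset_fractions[OF ab(2)] field_subring.mult_mem[OF field_subring_fractions] by blast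
    moreover have "(\<forall>s\<in>insert t S. x * s \<in> D) \<longleftrightarrow> x / (e * b * e') \<in> D" for x
    proof -
      have "x / (e * b) * b = x / e" using ab by simp
      moreover have "x / (e * b) * a = x * t"
      proof -
        have "x / (e * b) * a = x / e * (e * t)" unfolding ab(4) by simp
        then show ?thesis using e(1) by simp
      qed
      ultimately show ?thesis using e(3)[of x] e'(2)[of "x / (e * b)"] by simp blast
    qed
    ultimately show ?thesis using e e' ab by (intro exI[of _ "e * b * e'"]) auto
  qed
qed simp

end

section \<open>Polynomials with coefficients in a subring\<close>

definition poly_over :: "'k::field set \<Rightarrow> 'k poly \<Rightarrow> bool" where
  "poly_over D p \<longleftrightarrow> (\<forall>i. coeff p i \<in> D)"

context field_subring
begin

lemma poly_over_0: "poly_over D 0"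
  by (simp add: poly_over_def zero_mem)

lemma poly_over_add: "poly_over D p \<Longrightarrow> poly_over D q \<Longrightarrow> poly_over D (p + q)"
  by (simp add: poly_over_def add_mem)

lemma poly_over_diff: "poly_over D p \<Longrightarrow> poly_over D q \<Longrightarrow> poly_over D (p - q)"
  by (simp add: poly_over_def diff_mem)

lemma poly_over_mult: "poly_over D p \<Longrightarrow> poly_over D q \<Longrightarrow> poly_over D (p * q)"
  unfolding poly_over_def coeff_mult by (intro allI sum_mem mult_mem) auto

lemma poly_over_monom: "c \<in> D \<Longrightarrow> poly_over D (monom c n)"
  by (simp add: poly_over_def zero_mem)

lemma poly_over_fractions_denominator:
  assumes "poly_over (fractions D) p"
  shows "\<exists>d\<in>D - {0}. poly_over D (smult d p)"
proof -
  have "coeff p ` {..degree p} \<subseteq> fractions D" using assms by (auto simp: poly_over_def)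
  from common_denominator[OF _ this] obtain d
    where d: "d \<in> D - {0}" "\<And>i. i \<le> degree p \<Longrightarrow> d * coeff p i \<in> D" by auto
  have "d * coeff p i \<in> D" for i
    using d(2)[of i] zero_mem by (cases "i \<le> degree p") (auto simp: coeff_eq_0)
  with d(1) show ?thesis unfolding poly_over_def by (intro bexI[of _ d]) auto
qed

text \<open>The hypothesis \<open>div\<close> makes \<open>D\<close> a field, so the Euclidean
  argument applies: a nonzero element of least degree cancels leading terms of the others.\<close>

lemma poly_ideal_principal:
  assumes div: "\<And>x y. x \<in> D \<Longrightarrow> y \<in> D \<Longrightarrow> x / y \<in> D"
    and J: "\<And>p. p \<in> J \<Longrightarrow> poly_over D p" "0 \<in> J" "\<And>p q. p \<in> J \<Longrightarrow> q \<in> J \<Longrightarrow> p - q \<in> J"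
      "\<And>s p. poly_over D s \<Longrightarrow> p \<in> J \<Longrightarrow> s * p \<in> J"
  shows "\<exists>m\<in>J. \<forall>p\<in>J. \<exists>s. poly_over D s \<and> p = s * m"
proof (cases "J = {0}")
  case True
  then show ?thesis using poly_over_0 by auto
next
  case False
  with J(2) obtain p0 where "p0 \<in> J \<and> p0 \<noteq> 0" by blast
  from ex_has_least_nat[where P = "\<lambda>p. p \<in> J \<and> p \<noteq> 0" and m = degree, OF this]
  obtain m where m: "m \<in> J" "m \<noteq> 0" "\<And>p. p \<in> J \<Longrightarrow> p \<noteq> 0 \<Longrightarrow> degree m \<le> degree p" by blast
  have "\<exists>s. poly_over D s \<and> p = s * m" if "p \<in> J" for p
    using that
  proof (induction "degree p" arbitrary: p rule: less_induct)
    case less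
    show ?case
    proof (cases "p = 0")
      case True
      then show ?thesis using poly_over_0 by (intro exI[of _ 0]) simp
    next
      case False
      define t where "t = monom (lead_coeff p / lead_coeff m) (degree p - degree m)"
      have t: "poly_over D t"
        unfolding t_def using J(1)[OF m(1)] J(1)[OF less.prems]
        by (intro poly_over_monom div) (auto simp: poly_over_def)
      have le: "degree m \<le> degree p" by (rule m(3)[OF less.prems False])
      define q where "q = p - t * m"
      have q: "q \<in> J" unfolding q_def by (intro J(3,4) less.prems m t)
      have "degree (t * m) \<le> degree p"
        using degree_mult_le[of t m] degree_monom_le[of _ "degree p - degree m"] le
        unfolding t_def by (meson add_le_mono1 le_add_diff_inverse2 order_trans order_refl le_diff_conv2)
      then have "degree q \<le> degree p" unfolding q_def by (rule degree_diff_le[OF order_refl])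
      moreover have "coeff q (degree p) = 0"
        using le m(2) by (simp add: q_def t_def coeff_monom_mult)
      ultimately have "q = 0 \<or> degree q < degree p" by (rule eq_zero_or_degree_less)
      then obtain s where "poly_over D s" "q = s * m"
        using less.hyps[OF _ q] poly_over_0 by (metis mult_zero_left)
      then show ?thesis
        using t poly_over_add by (intro exI[of _ "s + t"]) (auto simp: q_def algebra_simps)
    qed
  qed
  with m(1) show ?thesis by blast
qed

end

text \<open>Brings coefficients of a product into the form used by
  \<open>coefficients_mem_of_product\<close>.\<close>

lemma coeff_mult_double_sum:
  fixes p q :: "'k::field poly"
  shows "(\<Sum>i\<le>degree p. \<Sum>j\<le>degree q. if i + j = n then coeff p i * coeff q j else 0) = coeff (p * q) n"
proof -
  have "(\<Sum>j\<le>degree q. if i + j = n then coeff p i * coeff q j else 0) =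
      (if i \<le> n then coeff p i * coeff q (n - i) else 0)" for i
  proof (cases "i \<le> n")
    case True
    then have "(\<Sum>j\<le>degree q. if i + j = n then coeff p i * coeff q j else 0) =
        (\<Sum>j\<le>degree q. if n - i = j then coeff p i * coeff q j else 0)"
      by (intro sum.cong) auto
    also have "\<dots> = (if i \<le> n then coeff p i * coeff q (n - i) else 0)"
      using True by (simp add: sum.delta' coeff_eq_0)
    finally show ?thesis .
  next
    case False
    then show ?thesis by (intro trans[OF sum.neutral]) auto
  qed
  then have "(\<Sum>i\<le>degree p. \<Sum>j\<le>degree q. if i + j = n then coeff p i * coeff q j else 0) =
      (\<Sum>i\<le>degree p. if i \<le> n then coeff p i * coeff q (n - i) else 0)" by simp
  also have "\<dots> = (\<Sum>i\<in>{..degree p} \<inter> {..n}. coeff p i * coeff q (n - i))"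
    by (subst sum.inter_restrict) (auto intro!: sum.cong)
  also have "\<dots> = (\<Sum>i\<le>n. coeff p i * coeff q (n - i))"
    by (rule sum.mono_neutral_left) (auto simp: coeff_eq_0)
  finally show ?thesis by (simp add: coeff_mult)
qed

lemma multiple_nat: "multiple n (a::nat) = n * a"
  by (induction n) auto

lemma root_closed_order_nat: "root_closed_order {(a, b). a \<le> (b::nat)}" "total {(a, b). a \<le> (b::nat)}"
  by (auto simp: root_closed_order_def refl_on_def antisym_def trans_def total_on_def multiple_nat)

text \<open>The variable is an element \<open>v\<close> of the ambient field; that it is
  transcendental over \<open>D\<close> enters as a separate hypothesis where it matters.\<close>

definition adjoin :: "'k::field set \<Rightarrow> 'k \<Rightarrow> 'k set" where
  "adjoin D v = {poly p v | p. poly_over D p}"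

definition laurent :: "'k::field set \<Rightarrow> 'k \<Rightarrow> 'k set" where
  "laurent D v = {poly p v / v ^ n | p n. poly_over D p}"

text \<open>
  Over the field of fractions, \<open>m\<close> generates the ideal of all \<open>p\<close> such that \<open>p / f\<close> multiplies \<open>f\<close>
  and \<open>g\<close> into the polynomial ring, which reduces \<open>f, g\<close> to the coprime pair \<open>m, q0\<close>. Dividing that
  pair by its content makes the Dedekind--Mertens variant applicable over \<open>D\<close> itself.
\<close>

lemma (in gcd_subring) gcd_ex_adjoin:
  assumes trans: "\<And>p. poly_over D p \<Longrightarrow> poly p v = 0 \<Longrightarrow> p = 0"
    and fg: "poly_over D f" "poly_over D g" "f \<noteq> 0"
  shows "\<exists>e. e \<noteq> 0 \<and> (\<forall>x. x * poly f v \<in> adjoin D v \<and> x * poly g v \<in> adjoin D v \<longleftrightarrow> x / e \<in> adjoin D v)"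
proof -
  let ?F = "fractions D"
  interpret F: field_subring ?F by (rule field_subring_fractions)
  have DF: "poly_over ?F p" if "poly_over D p" for p
    using that subset_fractions by (auto simp: poly_over_def)
  have transF: "p = 0" if "poly_over ?F p" "poly p v = 0" for p
  proof -
    from poly_over_fractions_denominator[OF that(1)]
    obtain d where "d \<in> D - {0}" "poly_over D (smult d p)" by blast
    then show ?thesis using trans[of "smult d p"] that(2) by auto
  qed
  have eqF: "p = q" if "poly_over ?F p" "poly_over ?F q" "poly p v = poly q v" for p q
    using transF[OF F.poly_over_diff[OF that(1,2)]] that(3) by simp
  define J where "J = {p. poly_over ?F p \<and> (\<exists>q. poly_over ?F q \<and> p * g = q * f)}"
  have "\<exists>m\<in>J. \<forall>p\<in>J. \<exists>s. poly_over ?F s \<and> p = s * m"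
  proof (rule F.poly_ideal_principal)
    show "x / y \<in> ?F" if "x \<in> ?F" "y \<in> ?F" for x y using that by (rule divide_fractions)
    show "poly_over ?F p" if "p \<in> J" for p using that by (simp add: J_def)
    show "0 \<in> J" using F.poly_over_0 by (auto simp: J_def intro!: exI[of _ 0])
    show "p - q \<in> J" if "p \<in> J" "q \<in> J" for p q
      using that F.poly_over_diff unfolding J_def mem_Collect_eq by (metis left_diff_distrib)
    show "s * p \<in> J" if "poly_over ?F s" "p \<in> J" for s p
      using that F.poly_over_mult unfolding J_def mem_Collect_eq by (metis mult.assoc)
  qed
  then obtain m where mJ: "m \<in> J" and gen: "\<And>p. p \<in> J \<Longrightarrow> \<exists>s. poly_over ?F s \<and> p = s * m" by blast
  from mJ obtain q0 where m: "poly_over ?F m" and q0: "poly_over ?F q0" "m * g = q0 * f"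
    by (auto simp: J_def)
  have "f \<in> J" unfolding J_def using DF fg by (auto intro!: exI[of _ g])
  with gen fg(3) have m0: "m \<noteq> 0" by fastforce
  have fv: "poly f v \<noteq> 0" and mv: "poly m v \<noteq> 0"
    using transF[OF DF[OF fg(1)]] transF[OF m] fg(3) m0 by auto
  define e1 where "e1 = poly m v / poly f v"
  have e1: "e1 \<noteq> 0" "e1 * poly f v = poly m v" using fv mv by (auto simp: e1_def)
  have "poly m v * poly g v = poly q0 v * poly f v" using q0(2) by (metis poly_mult)
  then have e1g: "e1 * poly g v = poly q0 v" using fv by (simp add: e1_def field_simps)
  define S where "S = coeff m ` {..degree m} \<union> coeff q0 ` {..degree q0}"
  have "finite S" "S \<subseteq> ?F" "lead_coeff m \<in> S" "lead_coeff m \<noteq> 0"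
    using m q0(1) m0 by (auto simp: S_def poly_over_def)
  \<comment> \<open>\<open>inverse e2\<close> is the content of the pair \<open>m, q0\<close>:
    multiplied by \<open>e2\<close>, all coefficients lie in \<open>D\<close> and generate an ideal
    with \<open>v\<close>-closure \<open>D\<close>.\<close>
  from gcd_ex_finite[OF this] obtain e2 where e2: "e2 \<noteq> 0" "e2 \<in> ?F"
    and e2S: "\<And>x. (\<forall>s\<in>S. x * s \<in> D) \<longleftrightarrow> x / e2 \<in> D" by blast
  have Se2: "e2 * s \<in> D" if "s \<in> S" for s
    using e2S[of e2] e2(1) one_mem that by simp
  have zS: "coeff m i \<in> insert 0 S" "coeff q0 i \<in> insert 0 S" for i
    by (cases "i \<le> degree m"; auto simp: S_def coeff_eq_0)
       (cases "i \<le> degree q0"; auto simp: S_def coeff_eq_0)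
  define f' where "f' k = smult e2 (if k then m else q0)" for k :: bool
  have f': "poly_over D (f' k)" for k
    unfolding poly_over_def f'_def using zS Se2 zero_mem by (cases k) (force simp: coeff_smult)+
  have sat: "x \<in> D" if x: "\<And>k i. i \<in> {..degree (f' k)} \<Longrightarrow> coeff (f' k) i * x \<in> D" for x
  proof -
    have "(x * e2) * s \<in> D" if "s \<in> S" for s
    proof -
      have "\<exists>k. \<exists>i\<le>degree (f' k). coeff (f' k) i = e2 * s"
      proof (cases "s \<in> coeff m ` {..degree m}")
        case True
        then show ?thesis using e2(1) by (intro exI[of _ True]) (auto simp: f'_def)
      next
        case False
        with \<open>s \<in> S\<close> show ?thesis using e2(1) by (intro exI[of _ False]) (auto simp: f'_def S_def)
      qed
      then obtain k i where ki: "i \<le> degree (f' k)" "coeff (f' k) i = e2 * s" by blast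
      then have "e2 * s * x \<in> D" using x[of i k] by simp
      then show ?thesis by (simp add: ac_simps)
    qed
    with e2S[of "x * e2"] e2(1) show ?thesis by simp
  qed
  \<comment> \<open>Gauss's lemma in conductor form. The saturation \<open>sat\<close> says that the
    coefficients of both \<open>f' k\<close> together have \<open>v\<close>-closure
    \<open>D\<close>, so a \<open>z\<close> multiplied by both into polynomials over
    \<open>D\<close> is itself over \<open>D\<close>.\<close>
  have key: "poly_over D z" if z: "\<And>k. poly_over D (f' k * z)" for z
  proof -
    have "coeff z j \<in> D" if "j \<in> {..degree z}" for j
    proof (rule coefficients_mem_of_product[OF root_closed_order_nat, where I = D
          and S = "\<lambda>k. {..degree (f' k)}" and f = "\<lambda>k. coeff (f' k)" and T = "{..degree z}"])
      show "(\<Sum>i\<le>degree (f' k). \<Sum>j\<le>degree z. if i + j = n then coeff (f' k) i * coeff z j else 0) \<in> D"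
        for k n using z[of k] unfolding coeff_mult_double_sum poly_over_def by blast
      show "coeff (f' k) i * x \<in> D" if "x \<in> D" for k i x
        using f'[of k] that by (simp add: poly_over_def mult_mem)
      show "x \<in> D" if "\<And>k i. i \<in> {..degree (f' k)} \<Longrightarrow> coeff (f' k) i * x \<in> D" for x
        using that by (rule sat)
    qed (use that in \<open>simp_all add: zero_mem diff_mem\<close>)
    then show ?thesis
      unfolding poly_over_def using zero_mem by (metis atMost_iff coeff_eq_0 not_le)
  qed
  have "x * poly f v \<in> adjoin D v \<and> x * poly g v \<in> adjoin D v \<longleftrightarrow> x / (e1 * e2) \<in> adjoin D v" for x
  proof
    assume "x * poly f v \<in> adjoin D v \<and> x * poly g v \<in> adjoin D v"
    then obtain p q where pq: "poly_over D p" "poly_over D q"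
      "x * poly f v = poly p v" "x * poly g v = poly q v" unfolding adjoin_def by blast
    have "poly (p * g) v = poly (q * f) v" using pq(3,4)[symmetric] by simp
    then have pgqf: "p * g = q * f" by (intro eqF DF poly_over_mult pq fg)
    then have "p \<in> J" unfolding J_def using DF pq by blast
    then obtain s where s: "poly_over ?F s" "p = s * m" using gen by blast
    have "q * f = s * (m * g)" using pgqf s(2) by (simp add: mult.assoc)
    then have "q * f = (s * q0) * f" unfolding q0(2) by (simp add: mult.assoc)
    then have q: "q = s * q0" using fg(3) by (metis mult_right_cancel)
    \<comment> \<open>The cofactor \<open>s\<close> is only known over the field of fractions; with
      the content shifted from \<open>m, q0\<close> to it, it turns out to lie over
      \<open>D\<close>.\<close>
    define z where "z = smult (inverse e2) s"
    have "f' k * z = (if k then p else q)" for k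
      unfolding f'_def z_def s(2) q by (simp add: e2(1) mult.commute[of s])
    then have "poly_over D z" using pq(1,2) key[of z] by simp
    moreover have "x / (e1 * e2) = poly z v"
    proof -
      have "x * poly f v = poly s v * (e1 * poly f v)" using pq(3) s(2) e1(2) by simp
      then have "x = poly s v * e1" using fv by simp
      then show ?thesis using e1(1) by (simp add: z_def field_simps)
    qed
    ultimately show "x / (e1 * e2) \<in> adjoin D v" unfolding adjoin_def by blast
  next
    assume "x / (e1 * e2) \<in> adjoin D v"
    then obtain z where z: "poly_over D z" "x / (e1 * e2) = poly z v" unfolding adjoin_def by blast
    then have x: "x = e2 * poly z v * e1" using e1(1) e2(1) by (simp add: field_simps)
    have "x * poly f v = poly (f' True * z) v" "x * poly g v = poly (f' False * z) v"
      using e1(2) e1g by (simp_all add: x f'_def mult.assoc mult.left_commute mult.commute)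
    then show "x * poly f v \<in> adjoin D v \<and> x * poly g v \<in> adjoin D v"
      using poly_over_mult[OF f' z(1)] unfolding adjoin_def by blast
  qed
  with e1(1) e2(1) show ?thesis by (intro exI[of _ "e1 * e2"]) auto
qed

text \<open>Powers of \<open>v\<close> are units of the Laurent ring. A pair can be multiplied into
  \<open>adjoin D v\<close> by one of them, and the \<open>e\<close> found there also serves in the
  larger ring.\<close>

lemma (in gcd_subring) gcd_subring_laurent:
  assumes trans: "\<And>p. poly_over D p \<Longrightarrow> poly p v = 0 \<Longrightarrow> p = 0"
  shows "gcd_subring (laurent D v)"
proof -
  have v: "v \<noteq> 0"
    using trans[of "monom 1 1"] poly_over_monom[OF one_mem] by (auto simp: poly_monom)
  have memL: "x \<in> laurent D v \<longleftrightarrow> (\<exists>n. x * v ^ n \<in> adjoin D v)" for x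
    using v by (auto simp: laurent_def adjoin_def field_simps)
  have step: "x * v ^ n \<in> adjoin D v" if "x \<in> adjoin D v" for x n
  proof -
    from that obtain p where "poly_over D p" "x = poly p v" by (auto simp: adjoin_def)
    then have "poly_over D (p * monom 1 n)" "x * v ^ n = poly (p * monom 1 n) v"
      using poly_over_mult poly_over_monom one_mem by (auto simp: poly_monom)
    then show ?thesis unfolding adjoin_def by blast
  qed
  have mono: "x * v ^ m \<in> adjoin D v" if "x * v ^ n \<in> adjoin D v" "n \<le> m" for x n m
    using step[OF that(1), of "m - n"] that(2) by (simp add: mult.assoc power_add[symmetric])
  have shift: "x * v ^ n \<in> laurent D v \<longleftrightarrow> x \<in> laurent D v" for x n
  proof
    assume "x \<in> laurent D v"
    then obtain m where "x * v ^ m \<in> adjoin D v" using memL by blast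
    then have "x * v ^ (n + m) \<in> adjoin D v" by (rule mono) simp
    then have "x * v ^ n * v ^ m \<in> adjoin D v" by (simp add: power_add mult.assoc)
    then show "x * v ^ n \<in> laurent D v" unfolding memL by blast
  qed (auto simp: memL mult.assoc power_add[symmetric])
  have common: "\<exists>n. x * v ^ n \<in> adjoin D v \<and> y * v ^ n \<in> adjoin D v"
    if xy: "x \<in> laurent D v" "y \<in> laurent D v" for x y
  proof -
    obtain n m where "x * v ^ n \<in> adjoin D v" "y * v ^ m \<in> adjoin D v" using xy memL by blast
    then show ?thesis using mono by (metis max.cobounded1 max.cobounded2)
  qed
  show ?thesis
  proof
    have "1 * v ^ 0 \<in> adjoin D v"
      unfolding adjoin_def using poly_over_monom[OF one_mem, of 0]
      by (auto intro!: exI[of _ "monom 1 0"] simp: poly_monom)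
    then show "1 \<in> laurent D v" unfolding memL by blast
    fix x y assume xy: "x \<in> laurent D v" "y \<in> laurent D v"
    from common[OF xy] obtain n p q where pq: "poly_over D p" "poly_over D q"
      "x * v ^ n = poly p v" "y * v ^ n = poly q v" by (auto simp: adjoin_def)
    have "(x - y) * v ^ n = poly (p - q) v" using pq by (simp add: left_diff_distrib)
    then show "x - y \<in> laurent D v"
      using poly_over_diff[OF pq(1,2)] unfolding memL adjoin_def by blast
    have "(x * y) * v ^ (n + n) = (x * v ^ n) * (y * v ^ n)" by (simp add: power_add ac_simps)
    then have "(x * y) * v ^ (n + n) = poly (p * q) v" unfolding pq by simp
    then show "x * y \<in> laurent D v"
      using poly_over_mult[OF pq(1,2)] unfolding memL adjoin_def by blast
  next
    fix a b assume ab: "a \<in> laurent D v" "b \<in> laurent D v" "a \<noteq> 0"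
    from common[OF ab(1,2)] obtain n f g where fg: "poly_over D f" "poly_over D g"
      "a * v ^ n = poly f v" "b * v ^ n = poly g v" by (auto simp: adjoin_def)
    have "f \<noteq> 0" using fg(3) ab(3) v by auto
    then obtain e where e: "e \<noteq> 0"
      "\<And>x. x * poly f v \<in> adjoin D v \<and> x * poly g v \<in> adjoin D v \<longleftrightarrow> x / e \<in> adjoin D v"
      using gcd_ex_adjoin[OF trans fg(1,2)] by blast
    have "x * a \<in> laurent D v \<and> x * b \<in> laurent D v \<longleftrightarrow> x / e \<in> laurent D v" for x
    proof -
      have "x * a \<in> laurent D v \<and> x * b \<in> laurent D v \<longleftrightarrow>
          x * poly f v \<in> laurent D v \<and> x * poly g v \<in> laurent D v"
        using shift[of "x * a" n] shift[of "x * b" n] by (simp add: fg(3,4)[symmetric] mult.assoc)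
      also have "\<dots> \<longleftrightarrow> (\<exists>n. x * poly f v * v ^ n \<in> adjoin D v \<and> x * poly g v * v ^ n \<in> adjoin D v)"
        using common[of "x * poly f v" "x * poly g v"] memL by blast
      \<comment> \<open>The multiplier \<open>x\<close> ranges over the whole field, so the
        equivalence for \<open>adjoin D v\<close> may be used at \<open>x * v ^ n\<close>.\<close>
      also have "\<dots> \<longleftrightarrow> (\<exists>n. x / e * v ^ n \<in> adjoin D v)"
        using e(2)[of "x * v ^ _"] by (simp add: ac_simps)
      also have "\<dots> \<longleftrightarrow> x / e \<in> laurent D v" by (simp add: memL)
      finally show ?thesis .
    qed
    with e(1) show "\<exists>e. e \<noteq> 0 \<and> (\<forall>x. x * a \<in> laurent D v \<and> x * b \<in> laurent D v \<longleftrightarrow> x / e \<in> laurent D v)"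
      by blast
  qed
qed


section \<open>Free generators modulo a root-closed subgroup\<close>

text \<open>Root closure says that the group \<open>U\<close> modulo \<open>W0\<close> is
  torsion-free, so its finitely generated subgroups are free. Working with subgroups of
  \<open>U\<close> above \<open>W0\<close> avoids forming the quotient.\<close>

locale units_with_root_closed_subgroup =
  fixes U W0 :: "'k::field set"
  assumes U_nonzero: "0 \<notin> U"
    and U_mult: "x \<in> U \<Longrightarrow> y \<in> U \<Longrightarrow> x * y \<in> U"
    and U_inverse: "x \<in> U \<Longrightarrow> inverse x \<in> U"
    and W0_subset: "W0 \<subseteq> U"
    and W0_one: "1 \<in> W0"
    and W0_mult: "x \<in> W0 \<Longrightarrow> y \<in> W0 \<Longrightarrow> x * y \<in> W0"
    and W0_inverse: "x \<in> W0 \<Longrightarrow> inverse x \<in> W0"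
    and W0_root: "x \<in> U \<Longrightarrow> n \<ge> 1 \<Longrightarrow> x ^ n \<in> W0 \<Longrightarrow> x \<in> W0"
begin

lemma U_one: "1 \<in> U"
  using W0_subset W0_one by auto

lemma U_power_int: "x \<in> U \<Longrightarrow> x powi k \<in> U"
proof -
  assume x: "x \<in> U"
  have "y ^ n \<in> U" if "y \<in> U" for y n using that by (induction n) (auto simp: U_one U_mult)
  then show ?thesis using U_inverse x by (simp add: power_int_def)
qed

fun gen_subgroup :: "'k list \<Rightarrow> 'k set" where
  "gen_subgroup [] = W0"
| "gen_subgroup (v # vs) = {v powi k * w | k w. w \<in> gen_subgroup vs}"

text \<open>For generators in \<open>U\<close>, this says that their classes modulo
  \<open>W0\<close> form a basis of a free group. Positive powers suffice as
  \<open>gen_subgroup\<close> is then closed under inverses. The recursion adds one Laurent variable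
  at a time.\<close>

fun independent :: "'k list \<Rightarrow> bool" where
  "independent [] \<longleftrightarrow> True"
| "independent (v # vs) \<longleftrightarrow> (\<forall>k\<ge>1. v ^ k \<notin> gen_subgroup vs) \<and> independent vs"

lemma gen_subgroup_tail: "w \<in> gen_subgroup vs \<Longrightarrow> w \<in> gen_subgroup (v # vs)"
  by (auto intro!: exI[of _ "0::int"] exI[of _ w])

lemma W0_subset_gen_subgroup: "W0 \<subseteq> gen_subgroup vs"
proof (induction vs)
  case (Cons v vs)
  then show ?case using gen_subgroup_tail by blast
qed simp

lemma gen_subgroup_one: "1 \<in> gen_subgroup vs"
  using W0_subset_gen_subgroup W0_one by blast

lemma gen_subgroup_subset: "set vs \<subseteq> U \<Longrightarrow> gen_subgroup vs \<subseteq> U"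
  using W0_subset by (induction vs) (auto simp: U_mult U_power_int)

lemma gen_subgroup_mult:
  "set vs \<subseteq> U \<Longrightarrow> x \<in> gen_subgroup vs \<Longrightarrow> y \<in> gen_subgroup vs \<Longrightarrow> x * y \<in> gen_subgroup vs"
proof (induction vs arbitrary: x y)
  case (Cons v vs)
  then have v: "v \<noteq> 0" using U_nonzero by auto
  from Cons.prems obtain k w l z where "x = v powi k * w" "w \<in> gen_subgroup vs"
    "y = v powi l * z" "z \<in> gen_subgroup vs" by auto
  then have "x * y = v powi (k + l) * (w * z)" "w * z \<in> gen_subgroup vs"
    using Cons v by (auto simp: power_int_add)
  then show ?case by auto
qed (simp add: W0_mult)

lemma gen_subgroup_inverse:
  "set vs \<subseteq> U \<Longrightarrow> x \<in> gen_subgroup vs \<Longrightarrow> inverse x \<in> gen_subgroup vs"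
proof (induction vs arbitrary: x)
  case (Cons v vs)
  from Cons.prems obtain k w where "x = v powi k * w" "w \<in> gen_subgroup vs" by auto
  then have "inverse x = v powi (-k) * inverse w" "inverse w \<in> gen_subgroup vs"
    using Cons by (auto simp: power_int_minus)
  then show ?case by auto
qed (simp add: W0_inverse)

lemma set_subset_gen_subgroup: "set vs \<subseteq> gen_subgroup vs"
proof (induction vs)
  case (Cons v vs)
  have "v \<in> gen_subgroup (v # vs)"
    using gen_subgroup_one[of vs] by (auto intro!: exI[of _ "1::int"] exI[of _ 1])
  with Cons show ?case using gen_subgroup_tail by auto
qed simp

text \<open>
  If \<open>v ^ k = w powi m * u\<close> and \<open>g = gcd k m\<close>, a unimodular change of generators replaces \<open>v, w\<close> by
  \<open>y, z\<close> such that \<open>y ^ g = u\<close> involves one generator fewer.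
\<close>

lemma absorb_dependent:
  assumes "v \<in> U" "set vs \<subseteq> U" "k \<ge> 1" "v ^ k \<in> gen_subgroup vs"
  shows "\<exists>vs'. set vs' \<subseteq> U \<and> length vs' = length vs \<and> gen_subgroup (v # vs) \<subseteq> gen_subgroup vs'"
  using assms
proof (induction vs arbitrary: v k)
  case Nil
  \<comment> \<open>The only place where root closure is used: a torsion class modulo
    \<open>W0\<close> is trivial.\<close>
  then have "v \<in> W0" using W0_root by simp
  then have "v powi i \<in> W0" for i
  proof -
    have "y ^ n \<in> W0" if "y \<in> W0" for y n using that by (induction n) (auto simp: W0_one W0_mult)
    then show ?thesis using W0_inverse \<open>v \<in> W0\<close> by (simp add: power_int_def)
  qed
  then show ?case using W0_mult by auto
next
  case (Cons w vs)
  from Cons.prems obtain m u where mu: "v ^ k = w powi m * u" "u \<in> gen_subgroup vs" by auto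
  have nz: "v \<noteq> 0" "w \<noteq> 0" and wU: "w \<in> U" using Cons.prems U_nonzero by auto
  define g where "g = gcd (int k) m"
  have g: "g \<noteq> 0" "g > 0" using Cons.prems(3) by (auto simp: g_def)
  obtain k' m' where k': "int k = g * k'" and m': "m = g * m'"
    unfolding g_def by (meson dvdE gcd_dvd1 gcd_dvd2)
  obtain s t where "s * int k + t * m = g" unfolding g_def using bezout_int by blast
  then have "g * (s * k' + t * m') = g * 1" unfolding k' m' by (simp add: algebra_simps)
  then have st: "s * k' + t * m' = 1" using g by simp
  \<comment> \<open>The exponent matrix of \<open>y, z\<close> in terms of \<open>v, w\<close> has
    determinant \<open>s * k' + t * m' = 1\<close>. Hence \<open>v = y powi s * z powi m'\<close>
    and \<open>w = y powi (- t) * z powi k'\<close>.\<close>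
  define y where "y = v powi k' * w powi (- m')"
  define z where "z = v powi t * w powi s"
  have yz: "y \<in> U" "z \<in> U" unfolding y_def z_def by (intro U_mult U_power_int Cons.prems wU)+
  have "y powi g = v powi (int k) * w powi (- m)"
    unfolding y_def k' m' power_int_mult_distrib power_int_mult[symmetric] by (simp add: mult.commute)
  also have "\<dots> = u" using mu(1) nz by (simp add: power_int_minus)
  finally have "y ^ nat g \<in> gen_subgroup vs" using mu(2) g by (simp add: power_int_def)
  moreover have "nat g \<ge> 1" using g by simp
  ultimately obtain vs' where vs': "set vs' \<subseteq> U" "length vs' = length vs"
    "gen_subgroup (y # vs) \<subseteq> gen_subgroup vs'"
    using Cons.IH[of y "nat g"] yz Cons.prems(2) by auto
  have "gen_subgroup (v # w # vs) \<subseteq> gen_subgroup (z # vs')"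
  proof
    fix x assume "x \<in> gen_subgroup (v # w # vs)"
    then obtain a b c where x: "x = v powi a * (w powi b * c)" "c \<in> gen_subgroup vs" by auto
    have e1: "k' * (a * s - b * t) + t * (a * m' + b * k') = a"
    proof -
      have "k' * (a * s - b * t) + t * (a * m' + b * k') = a * (s * k' + t * m')"
        by (simp add: algebra_simps)
      then show ?thesis using st by simp
    qed
    have e2: "- m' * (a * s - b * t) + s * (a * m' + b * k') = b"
    proof -
      have "- m' * (a * s - b * t) + s * (a * m' + b * k') = b * (s * k' + t * m')"
        by (simp add: algebra_simps)
      then show ?thesis using st by simp
    qed
    \<comment> \<open>The exponents come from substituting the inverse change of generators into
      \<open>v powi a * w powi b\<close>.\<close>
    have "z powi (a * m' + b * k') * y powi (a * s - b * t) =
        v powi (k' * (a * s - b * t) + t * (a * m' + b * k')) *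
        w powi (- m' * (a * s - b * t) + s * (a * m' + b * k'))"
      unfolding y_def z_def power_int_mult_distrib power_int_mult[symmetric]
        power_int_add[OF disjI1[OF nz(1)]] power_int_add[OF disjI1[OF nz(2)]]
      by (simp only: ac_simps)
    then have "x = z powi (a * m' + b * k') * (y powi (a * s - b * t) * c)"
      unfolding e1 e2 x by (simp add: mult.assoc)
    moreover have "y powi (a * s - b * t) * c \<in> gen_subgroup vs'" using vs'(3) x(2) by auto
    ultimately show "x \<in> gen_subgroup (z # vs')" by auto
  qed
  with vs' yz show ?case by (intro exI[of _ "z # vs'"]) auto
qed

lemma shorten_dependent:
  assumes "set vs \<subseteq> U" "\<not> independent vs"
  shows "\<exists>vs'. set vs' \<subseteq> U \<and> length vs' < length vs \<and> gen_subgroup vs \<subseteq> gen_subgroup vs'"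
  using assms
proof (induction vs)
  case (Cons v vs)
  show ?case
  proof (cases "independent vs")
    case True
    with Cons.prems obtain k where "k \<ge> 1" "v ^ k \<in> gen_subgroup vs" by auto
    from absorb_dependent[OF _ _ this] Cons.prems(1) show ?thesis by (metis insert_subset
        length_Cons lessI list.simps(15))
  next
    case False
    with Cons obtain vs' where "set vs' \<subseteq> U" "length vs' < length vs" "gen_subgroup vs \<subseteq> gen_subgroup vs'"
      by auto
    with Cons.prems(1) show ?thesis by (intro exI[of _ "v # vs'"]) auto
  qed
qed simp

text \<open>A shortest list whose subgroup contains \<open>S\<close> is independent, as a dependent
  one could be shortened. Only containment is preserved; the subgroup may grow on the way.\<close>

lemma independent_generators:
  assumes "finite S" "S \<subseteq> U"
  shows "\<exists>vs. set vs \<subseteq> U \<and> independent vs \<and> S \<subseteq> gen_subgroup vs"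
proof -
  obtain vs0 where "set vs0 = S" using finite_list[OF assms(1)] by blast
  then have "set vs0 \<subseteq> U \<and> S \<subseteq> gen_subgroup vs0" using set_subset_gen_subgroup assms(2) by auto
  from ex_has_least_nat[where P = "\<lambda>vs. set vs \<subseteq> U \<and> S \<subseteq> gen_subgroup vs" and m = length, OF this]
  obtain vs where vs: "set vs \<subseteq> U" "S \<subseteq> gen_subgroup vs"
    "\<And>vs'. set vs' \<subseteq> U \<Longrightarrow> S \<subseteq> gen_subgroup vs' \<Longrightarrow> length vs \<le> length vs'" by blast
  have "independent vs"
  proof (rule ccontr)
    assume "\<not> independent vs"
    from shorten_dependent[OF vs(1) this] obtain vs' where "set vs' \<subseteq> U" "length vs' < length vs"
      "gen_subgroup vs \<subseteq> gen_subgroup vs'" by blast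
    with vs(2) vs(3)[of vs'] show False by (meson leD subset_trans)
  qed
  with vs show ?thesis by blast
qed

end

section \<open>Homogeneous components\<close>

lemma (in field_subring) additive_subgroupD:
  assumes "additive_subgroup B (ring_on D)"
  shows "B \<subseteq> D" "0 \<in> B" "x \<in> B \<Longrightarrow> y \<in> B \<Longrightarrow> x + y \<in> B" "x \<in> B \<Longrightarrow> - x \<in> B"
proof -
  interpret cring "ring_on D" by (rule cring_ring_on)
  interpret B: additive_subgroup B "ring_on D" by fact
  show "B \<subseteq> D" "0 \<in> B" "x \<in> B \<Longrightarrow> y \<in> B \<Longrightarrow> x + y \<in> B"
    using B.a_subset B.zero_closed B.a_closed by auto
  then have "inv\<^bsub>add_monoid (ring_on D)\<^esub> x = - x" if "x \<in> B"
    using that uminus_mem by (intro group.inv_equality[OF a_group]) auto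
  then show "x \<in> B \<Longrightarrow> - x \<in> B"
    using subgroup.m_inv_closed[OF B.a_subgroup] by metis
qed

context graded_domain
begin

sublocale field_subring R
  using domain by (simp add: domain_with_quotient_field_def subring_iff_field_subring)

lemma gr_subset: "gr \<alpha> \<subseteq> R"
  and gr_zero: "0 \<in> gr \<alpha>"
  and gr_add: "x \<in> gr \<alpha> \<Longrightarrow> y \<in> gr \<alpha> \<Longrightarrow> x + y \<in> gr \<alpha>"
  and gr_uminus: "x \<in> gr \<alpha> \<Longrightarrow> - x \<in> gr \<alpha>"
  using additive_subgroupD[OF gr_subgroup[of \<alpha>]] by auto

lemma gr_sum: "(\<And>i. i \<in> S \<Longrightarrow> f i \<in> gr \<alpha>) \<Longrightarrow> sum f S \<in> gr \<alpha>"
  by (induction S rule: infinite_finite_induct) (auto simp: gr_zero gr_add)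

text \<open>Components are taken in \<open>R\<close>, with degrees in the monoid. An element of
  \<open>R\<^sub>H\<close> is handled as \<open>r / h\<close> with \<open>h\<close> homogeneous,
  through the components of \<open>r\<close>.\<close>

definition component :: "'k \<Rightarrow> 'g \<Rightarrow> 'k" where
  "component f = (THE c. decomposition gr UNIV f c)"

lemma component_unique:
  assumes "\<And>\<gamma>. c \<gamma> \<in> gr \<gamma>" "finite S" "\<And>\<gamma>. \<gamma> \<notin> S \<Longrightarrow> c \<gamma> = 0" "f = sum c S"
  shows "component f = c"
proof -
  have "f \<in> R" unfolding assms(4) using assms(1) gr_subset by (intro sum_mem) auto
  moreover have "{\<gamma>. c \<gamma> \<noteq> 0} \<subseteq> S" using assms(3) by blast
  then have "decomposition gr UNIV f c"
    unfolding decomposition_def assms(4)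
    using assms(1,2) by (auto intro: finite_subset sum.mono_neutral_right)
  ultimately show ?thesis
    unfolding component_def using direct_sum by (intro the1_equality) auto
qed

lemma
  assumes "f \<in> R"
  shows component_mem: "component f \<gamma> \<in> gr \<gamma>"
    and finite_component: "finite {\<gamma>. component f \<gamma> \<noteq> 0}"
    and sum_component: "(\<Sum>\<gamma> | component f \<gamma> \<noteq> 0. component f \<gamma>) = f"
proof -
  have "decomposition gr UNIV f (component f)"
    unfolding component_def by (rule theI'[OF direct_sum[OF assms]])
  then show "component f \<gamma> \<in> gr \<gamma>" "finite {\<gamma>. component f \<gamma> \<noteq> 0}"
      "(\<Sum>\<gamma> | component f \<gamma> \<noteq> 0. component f \<gamma>) = f"
    by (auto simp: decomposition_def)
qed

lemma sum_component_superset: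
  assumes "f \<in> R" "finite S" "{\<gamma>. component f \<gamma> \<noteq> 0} \<subseteq> S"
  shows "(\<Sum>\<gamma>\<in>S. component f \<gamma>) = f"
  using sum_component[OF assms(1)] sum.mono_neutral_right[OF assms(2,3), of "component f"] by auto

lemma component_zero_imp: "f \<in> R \<Longrightarrow> (\<And>\<gamma>. component f \<gamma> = 0) \<Longrightarrow> f = 0"
  using sum_component[of f] by simp

lemma component_homogeneous: "h \<in> gr \<delta> \<Longrightarrow> component h = (\<lambda>\<gamma>. if \<gamma> = \<delta> then h else 0)"
  by (rule component_unique[of _ "{\<delta>}"]) (auto simp: gr_zero)

lemma degree_unique: "h \<in> gr \<alpha> \<Longrightarrow> h \<in> gr \<beta> \<Longrightarrow> h \<noteq> 0 \<Longrightarrow> \<alpha> = \<beta>"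
  using component_homogeneous by metis

lemma component_add:
  assumes "x \<in> R" "y \<in> R"
  shows "component (x + y) \<gamma> = component x \<gamma> + component y \<gamma>"
proof -
  let ?S = "{\<gamma>. component x \<gamma> \<noteq> 0} \<union> {\<gamma>. component y \<gamma> \<noteq> 0}"
  have "component (x + y) = (\<lambda>\<gamma>. component x \<gamma> + component y \<gamma>)"
    by (rule component_unique[of _ ?S])
      (use assms in \<open>auto simp: gr_add component_mem finite_component sum.distrib sum_component_superset\<close>)
  then show ?thesis by simp
qed

lemma component_mult:
  assumes xy: "x \<in> R" "y \<in> R"
    and S: "finite S" "{\<gamma>. component x \<gamma> \<noteq> 0} \<subseteq> S" and T: "finite T" "{\<gamma>. component y \<gamma> \<noteq> 0} \<subseteq> T"
  shows "component (x * y) \<gamma> = (\<Sum>i\<in>S. \<Sum>j\<in>T. if i + j = \<gamma> then component x i * component y j else 0)"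
proof -
  define c where "c \<gamma> = (\<Sum>i\<in>S. \<Sum>j\<in>T. if i + j = \<gamma> then component x i * component y j else 0)" for \<gamma>
  define N where "N = (\<lambda>(i, j). i + j) ` (S \<times> T)"
  have "component (x * y) = c"
  proof (rule component_unique[of _ N])
    show "c \<gamma> \<in> gr \<gamma>" for \<gamma>
      unfolding c_def using gr_mult[OF component_mem[OF xy(1)] component_mem[OF xy(2)]]
      by (intro gr_sum) (auto simp: gr_zero)
    show "finite N" using S T by (simp add: N_def)
    show "c \<gamma> = 0" if "\<gamma> \<notin> N" for \<gamma>
      unfolding c_def by (intro sum.neutral ballI) (use that in \<open>auto simp: N_def\<close>)
    have "sum c N = (\<Sum>i\<in>S. \<Sum>j\<in>T. \<Sum>\<gamma>\<in>N. if i + j = \<gamma> then component x i * component y j else 0)"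
      unfolding c_def
      by (rule trans[OF sum.swap], rule sum.cong[OF refl], rule sum.swap)
    also have "\<dots> = (\<Sum>i\<in>S. \<Sum>j\<in>T. component x i * component y j)"
      using \<open>finite N\<close> by (intro sum.cong refl) (auto simp: N_def)
    also have "\<dots> = x * y"
      using sum_component_superset[OF xy(1) S] sum_component_superset[OF xy(2) T]
      by (simp add: sum_product[symmetric])
    finally show "x * y = sum c N" by simp
  qed
  then show ?thesis by (simp add: c_def)
qed

text \<open>The monoid has no subtraction, so the shift of degrees by \<open>\<delta>\<close> takes
  two claims: the values on shifted degrees, and vanishing on all others.\<close>

lemma component_homogeneous_mult:
  assumes h: "h \<in> gr \<delta>" and y: "y \<in> R"
  shows "component (h * y) (\<delta> + \<gamma>) = h * component y \<gamma>"
    and "component (h * y) \<gamma>' \<noteq> 0 \<Longrightarrow> \<exists>\<gamma>. \<gamma>' = \<delta> + \<gamma>"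
proof -
  have *: "component (h * y) \<gamma>' = (\<Sum>j | component y j \<noteq> 0. if \<delta> + j = \<gamma>' then h * component y j else 0)" for \<gamma>'
  proof -
    have "{\<gamma>. component h \<gamma> \<noteq> 0} \<subseteq> {\<delta>}" "component h \<delta> = h"
      by (auto simp: component_homogeneous[OF h])
    moreover have "h \<in> R" using h gr_subset by blast
    ultimately show ?thesis
      using component_mult[of h y "{\<delta>}" "{j. component y j \<noteq> 0}" \<gamma>'] finite_component[OF y] y
      by (simp cong: if_cong)
  qed
  show "component (h * y) (\<delta> + \<gamma>) = h * component y \<gamma>"
    unfolding * using finite_component[OF y] by (auto simp: sum.delta)
  show "\<exists>\<gamma>. \<gamma>' = \<delta> + \<gamma>" if "component (h * y) \<gamma>' \<noteq> 0"
  proof (rule ccontr)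
    assume "\<nexists>\<gamma>. \<gamma>' = \<delta> + \<gamma>"
    then have "component (h * y) \<gamma>' = 0" unfolding * by (intro sum.neutral) auto
    with that show False by simp
  qed
qed

section \<open>Homogeneous units and the subgroup of degree 0\<close>

abbreviation H :: "'k set" where
  "H \<equiv> homogeneous gr"

lemma H_iff: "h \<in> H \<longleftrightarrow> h \<noteq> 0 \<and> (\<exists>\<delta>. h \<in> gr \<delta>)"
  by (auto simp: homogeneous_def)

lemma H_subset: "H \<subseteq> R"
  using gr_subset by (fastforce simp: H_iff)

lemma H_mult: "x \<in> H \<Longrightarrow> y \<in> H \<Longrightarrow> x * y \<in> H"
  unfolding H_iff using gr_mult by (metis mult_eq_0_iff)

lemma component_mem_H: "x \<in> R \<Longrightarrow> component x \<gamma> \<noteq> 0 \<Longrightarrow> component x \<gamma> \<in> H"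
  using component_mem by (auto simp: H_iff)

text \<open>For a nonzero homogeneous \<open>h\<close> the components of \<open>h * 1\<close> are
  those of \<open>1\<close> times \<open>h\<close>, in shifted degrees. As \<open>h\<close> has only
  one, cancellation leaves degree 0 for \<open>1\<close>.\<close>

lemma one_mem_gr: "1 \<in> gr 0"
proof -
  obtain \<alpha> h where h: "h \<in> gr \<alpha>" "h \<noteq> 0" using gr_nonzero gr_zero by blast
  have "component 1 \<gamma> = 0" if "\<gamma> \<noteq> 0" for \<gamma>
  proof -
    have "h * component 1 \<gamma> = component h (\<alpha> + \<gamma>)"
      using component_homogeneous_mult(1)[OF h(1) one_mem, of \<gamma>] by simp
    then show ?thesis using h that by (simp add: component_homogeneous)
  qed
  then have "{\<gamma>. component 1 \<gamma> \<noteq> 0} \<subseteq> {0}" by auto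
  then have "component 1 0 = 1" using sum_component_superset[OF one_mem, of "{0}"] by simp
  then show ?thesis using component_mem[OF one_mem, of 0] by simp
qed

lemma one_mem_H: "1 \<in> H"
  using one_mem_gr by (auto simp: H_iff)

text \<open>These are the homogeneous units of \<open>R\<^sub>H\<close>. Since no
  \<open>gr \<alpha>\<close> is zero, \<open>U\<close> modulo \<open>W0\<close> is the quotient
  group of the monoid.\<close>

definition U :: "'k set" where
  "U = {a / s | a s. a \<in> H \<and> s \<in> H}"

definition W0 :: "'k set" where
  "W0 = {a / s | a s \<gamma>. a \<in> gr \<gamma> - {0} \<and> s \<in> gr \<gamma> - {0}}"

lemma W0I: "a \<in> gr \<gamma> \<Longrightarrow> s \<in> gr \<gamma> \<Longrightarrow> a \<noteq> 0 \<Longrightarrow> s \<noteq> 0 \<Longrightarrow> a / s \<in> W0"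
  unfolding W0_def by blast

lemma UI: "a \<in> H \<Longrightarrow> s \<in> H \<Longrightarrow> a / s \<in> U"
  unfolding U_def by blast

lemma power_mem_gr: "x \<in> gr \<alpha> \<Longrightarrow> x ^ n \<in> gr (multiple n \<alpha>)"
  by (induction n) (auto simp: one_mem_gr gr_mult)

sublocale units: units_with_root_closed_subgroup U W0
proof
  show "0 \<notin> U" by (auto simp: U_def H_iff)
  show "x * y \<in> U" if "x \<in> U" "y \<in> U" for x y
  proof -
    from that obtain a s b t where "x = a / s" "y = b / t" "a \<in> H" "s \<in> H" "b \<in> H" "t \<in> H"
      unfolding U_def by blast
    then show ?thesis using UI[of "a * b" "s * t"] H_mult by simp
  qed
  show "inverse x \<in> U" if "x \<in> U" for x
    using that unfolding U_def by force
  show "W0 \<subseteq> U" unfolding W0_def U_def H_iff by blast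
  show "1 \<in> W0" using W0I[OF one_mem_gr one_mem_gr] by simp
  show "x * y \<in> W0" if "x \<in> W0" "y \<in> W0" for x y
  proof -
    from that obtain a s \<gamma> b t \<delta> where "x = a / s" "y = b / t" "a \<in> gr \<gamma> - {0}" "s \<in> gr \<gamma> - {0}"
      "b \<in> gr \<delta> - {0}" "t \<in> gr \<delta> - {0}" unfolding W0_def by blast
    then show ?thesis using W0I[of "a * b" "\<gamma> + \<delta>" "s * t"] gr_mult by simp
  qed
  show "inverse x \<in> W0" if "x \<in> W0" for x
    using that unfolding W0_def by force
  \<comment> \<open>This is torsionlessness: comparing degrees in
    \<open>a ^ n * t = s ^ n * b\<close> gives equal \<open>n\<close>-fold multiples of the degrees
    of \<open>a\<close> and \<open>s\<close>.\<close>
  show "x \<in> W0" if "x \<in> U" "n \<ge> 1" "x ^ n \<in> W0" for x n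
  proof -
    from that(1) obtain a s where as: "a \<in> H" "s \<in> H" "x = a / s" unfolding U_def by blast
    then obtain \<alpha> \<beta> where ab: "a \<in> gr \<alpha>" "s \<in> gr \<beta>" "a \<noteq> 0" "s \<noteq> 0" by (auto simp: H_iff)
    from that(3) obtain b t \<gamma> where bt: "b \<in> gr \<gamma>" "b \<noteq> 0" "t \<in> gr \<gamma>" "t \<noteq> 0" "x ^ n = b / t"
      unfolding W0_def by blast
    have eq: "a ^ n * t = s ^ n * b"
      using bt(4,5) ab(4) by (simp add: as(3) power_divide field_simps)
    have "a ^ n * t \<in> gr (multiple n \<alpha> + \<gamma>)" "s ^ n * b \<in> gr (multiple n \<beta> + \<gamma>)"
      using gr_mult power_mem_gr ab bt by auto
    moreover have "a ^ n * t \<noteq> 0" using ab bt by simp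
    ultimately have "multiple n \<alpha> + \<gamma> = multiple n \<beta> + \<gamma>" using eq degree_unique by metis
    then have "\<alpha> = \<beta>" using torsionless[OF that(2), of \<alpha> \<beta>] by (simp add: multiple_def)
    with ab show ?thesis unfolding as(3) by (auto intro: W0I)
  qed
qed

end


section \<open>Greatest common divisors in \<open>R\<^sub>H\<close>\<close>

context graded_domain
begin

text \<open>A subset of \<open>U\<close> with this property is a union of cosets of
  \<open>W0\<close>, in other words a set of degrees.\<close>

definition W0_invariant :: "'k set \<Rightarrow> bool" where
  "W0_invariant S \<longleftrightarrow> (\<forall>u\<in>S. \<forall>w\<in>W0. u * w \<in> S)"

text \<open>
  \<open>part S\<close> consists of the elements of \<open>R\<^sub>H\<close> all of whose homogeneous components lie in \<open>S\<close>.
\<close>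

definition part :: "'k set \<Rightarrow> 'k set" where
  "part S = {r / h | r h. r \<in> R \<and> h \<in> H \<and> (\<forall>\<gamma>. component r \<gamma> \<noteq> 0 \<longrightarrow> component r \<gamma> / h \<in> S)}"

lemma partI:
  "r \<in> R \<Longrightarrow> h \<in> H \<Longrightarrow> (\<And>\<gamma>. component r \<gamma> \<noteq> 0 \<Longrightarrow> component r \<gamma> / h \<in> S) \<Longrightarrow> r / h \<in> part S"
  unfolding part_def by blast

lemma partE:
  assumes "x \<in> part S"
  obtains r h where "r \<in> R" "h \<in> H" "x = r / h" "\<And>\<gamma>. component r \<gamma> \<noteq> 0 \<Longrightarrow> component r \<gamma> / h \<in> S"
  using assms unfolding part_def by blast

lemma part_mono: "S \<subseteq> T \<Longrightarrow> part S \<subseteq> part T"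
  unfolding part_def by blast

lemma part_UNIV: "part UNIV = localization R H"
  by (simp add: part_def localization_def)

lemma component_zero: "component 0 \<gamma> = 0"
  using component_homogeneous[OF gr_zero[of \<gamma>]] by simp

lemma zero_mem_part: "0 \<in> part S"
  using partI[OF zero_mem one_mem_H, of S] by (simp add: component_zero)

lemma homogeneous_mem_part: "a \<in> H \<Longrightarrow> s \<in> H \<Longrightarrow> a / s \<in> S \<Longrightarrow> a / s \<in> part S"
  by (intro partI subsetD[OF H_subset]) (auto simp: H_iff component_homogeneous split: if_splits)

lemma subset_part: "S \<subseteq> U \<Longrightarrow> S \<subseteq> part S"
  using homogeneous_mem_part unfolding U_def by blast

lemma mem_part_singleton:
  assumes "u \<in> U"
  shows "u \<in> part {u}"
proof -
  from assms obtain a s where "u = a / s" "a \<in> H" "s \<in> H" unfolding U_def by blast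
  then show ?thesis using homogeneous_mem_part[of a s "{u}"] by simp
qed

text \<open>The quotient \<open>(x + y) / x\<close> has degree 0, so \<open>(x + y) / h\<close> lies
  in the same coset of \<open>W0\<close> as \<open>x / h\<close>.\<close>

lemma gr_add_invariant:
  assumes S: "W0_invariant S" and xy: "x \<in> gr \<gamma>" "y \<in> gr \<gamma>" "x \<noteq> 0 \<Longrightarrow> x / h \<in> S" "y \<noteq> 0 \<Longrightarrow> y / h \<in> S"
    and nz: "x + y \<noteq> 0"
  shows "(x + y) / h \<in> S"
proof (cases "x = 0")
  case False
  have "x / h * ((x + y) / x) \<in> S"
    using S xy False nz W0I[OF gr_add[OF xy(1,2)] xy(1)] unfolding W0_invariant_def by blast
  then show ?thesis using False by simp
qed (use xy nz in auto)

lemma gr_sum_invariant: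
  assumes S: "W0_invariant S"
    and f: "\<And>i. i \<in> T \<Longrightarrow> f i \<in> gr \<gamma>" "\<And>i. i \<in> T \<Longrightarrow> f i \<noteq> 0 \<Longrightarrow> f i / h \<in> S"
    and nz: "sum f T \<noteq> 0"
  shows "sum f T / h \<in> S"
  using f nz
proof (induction T rule: infinite_finite_induct)
  case (insert i T)
  show ?case unfolding sum.insert[OF insert.hyps]
    by (rule gr_add_invariant[OF S, of _ \<gamma>]) (use insert in \<open>auto intro: gr_sum\<close>)
qed auto

text \<open>Expanding the fraction \<open>r / h\<close> by \<open>k\<close> shifts degrees but
  leaves the quotients of components unchanged. This lets two fractions be brought to a common
  denominator.\<close>

lemma component_divide_invariant:
  assumes x: "r \<in> R" "h \<in> H" "\<And>\<gamma>. component r \<gamma> \<noteq> 0 \<Longrightarrow> component r \<gamma> / h \<in> S"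
    and k: "k \<in> H" and nz: "component (k * r) \<gamma> \<noteq> 0"
  shows "component (k * r) \<gamma> / (k * h) \<in> S"
proof -
  obtain \<delta> where k': "k \<in> gr \<delta>" "k \<noteq> 0" using k by (auto simp: H_iff)
  obtain \<gamma>' where "\<gamma> = \<delta> + \<gamma>'" using component_homogeneous_mult(2)[OF k'(1) x(1) nz] by blast
  with nz x(3)[of \<gamma>'] component_homogeneous_mult(1)[OF k'(1) x(1), of \<gamma>'] k'(2)
  show ?thesis by simp
qed

lemma part_add:
  assumes S: "W0_invariant S" and xy: "x \<in> part S" "y \<in> part S"
  shows "x + y \<in> part S"
proof -
  obtain r h where x: "r \<in> R" "h \<in> H" "x = r / h" "\<And>\<gamma>. component r \<gamma> \<noteq> 0 \<Longrightarrow> component r \<gamma> / h \<in> S"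
    using xy(1) by (rule partE) blast
  obtain s k where y: "s \<in> R" "k \<in> H" "y = s / k" "\<And>\<gamma>. component s \<gamma> \<noteq> 0 \<Longrightarrow> component s \<gamma> / k \<in> S"
    using xy(2) by (rule partE) blast
  have nz: "h \<noteq> 0" "k \<noteq> 0" using x(2) y(2) by (auto simp: H_iff)
  have R: "k * r \<in> R" "h * s \<in> R" using x y H_subset mult_mem by auto
  have "(k * r + h * s) / (h * k) \<in> part S"
  proof (rule partI)
    show "k * r + h * s \<in> R" "h * k \<in> H" using R x(2) y(2) by (auto simp: add_mem H_mult)
    fix \<gamma> assume "component (k * r + h * s) \<gamma> \<noteq> 0"
    then show "component (k * r + h * s) \<gamma> / (h * k) \<in> S"
      unfolding component_add[OF R]
      using component_divide_invariant[OF x(1,2,4) y(2), of \<gamma>]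
        component_divide_invariant[OF y(1,2,4) x(2), of \<gamma>]
      by (intro gr_add_invariant[OF S component_mem[OF R(1)] component_mem[OF R(2)]])
        (auto simp: mult.commute)
  qed
  moreover have "(k * r + h * s) / (h * k) = x + y" unfolding x(3) y(3) using nz by (simp add: field_simps)
  ultimately show ?thesis by simp
qed

lemma minus_one_mem_W0: "- 1 \<in> W0"
  using W0I[OF gr_uminus[OF one_mem_gr] one_mem_gr] by simp

lemma part_mult:
  assumes T: "W0_invariant T" and ST: "\<And>u v. u \<in> S \<Longrightarrow> v \<in> S' \<Longrightarrow> u * v \<in> T"
    and xy: "x \<in> part S" "y \<in> part S'"
  shows "x * y \<in> part T"
proof -
  obtain r h where x: "r \<in> R" "h \<in> H" "x = r / h" "\<And>\<gamma>. component r \<gamma> \<noteq> 0 \<Longrightarrow> component r \<gamma> / h \<in> S"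
    using xy(1) by (rule partE) blast
  obtain s k where y: "s \<in> R" "k \<in> H" "y = s / k" "\<And>\<gamma>. component s \<gamma> \<noteq> 0 \<Longrightarrow> component s \<gamma> / k \<in> S'"
    using xy(2) by (rule partE) blast
  have c: "component (r * s) \<gamma> = (\<Sum>i | component r i \<noteq> 0. \<Sum>j | component s j \<noteq> 0.
      if i + j = \<gamma> then component r i * component s j else 0)" for \<gamma>
    by (rule component_mult) (use x y finite_component in auto)
  have "r * s / (h * k) \<in> part T"
  proof (rule partI)
    show "r * s \<in> R" "h * k \<in> H" using x y by (auto simp: mult_mem H_mult)
    fix \<gamma> assume nz: "component (r * s) \<gamma> \<noteq> 0"
    have prod_mem: "component r i * component s j \<in> gr (i + j)" for i j
      by (intro gr_mult component_mem x y)
    have prod_div: "component r i * component s j / (h * k) \<in> T"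
      if "component r i \<noteq> 0" "component s j \<noteq> 0" for i j
      using ST[OF x(4)[OF that(1)] y(4)[OF that(2)]] by simp
    show "component (r * s) \<gamma> / (h * k) \<in> T"
      using nz unfolding c
    proof (rule gr_sum_invariant[OF T, rotated 2])
      fix i assume i: "i \<in> {i. component r i \<noteq> 0}"
      show "(\<Sum>j | component s j \<noteq> 0. if i + j = \<gamma> then component r i * component s j else 0) \<in> gr \<gamma>"
        using prod_mem gr_zero by (intro gr_sum) auto
      assume "(\<Sum>j | component s j \<noteq> 0. if i + j = \<gamma> then component r i * component s j else 0) \<noteq> 0"
      then show "(\<Sum>j | component s j \<noteq> 0. if i + j = \<gamma> then component r i * component s j else 0) / (h * k) \<in> T"
        by (rule gr_sum_invariant[OF T, where \<gamma> = \<gamma>, rotated 2])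
          (use prod_mem prod_div gr_zero i in \<open>auto split: if_splits\<close>)
    qed
  qed
  then show ?thesis using x(3) y(3) by simp
qed

lemma part_uminus:
  assumes "W0_invariant S" "x \<in> part S"
  shows "- x \<in> part S"
proof -
  have "- 1 \<in> part W0"
    using homogeneous_mem_part[of "- 1" 1 W0] one_mem_H minus_one_mem_W0 gr_uminus[OF one_mem_gr]
    by (auto simp: H_iff)
  from part_mult[OF assms(1) _ assms(2) this] assms(1) show ?thesis by (simp add: W0_invariant_def)
qed

lemma part_diff: "W0_invariant S \<Longrightarrow> x \<in> part S \<Longrightarrow> y \<in> part S \<Longrightarrow> x - y \<in> part S"
  using part_add[of S x "- y"] part_uminus[of S y] by simp

lemma part_sum:
  "W0_invariant S \<Longrightarrow> (\<And>i. i \<in> T \<Longrightarrow> f i \<in> part S) \<Longrightarrow> sum f T \<in> part S"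
  by (induction T rule: infinite_finite_induct) (auto simp: zero_mem_part part_add)

text \<open>This is directness of the grading of \<open>R\<^sub>H\<close>: over a common
  denominator, a nonzero component of \<open>x\<close> would lie in both sets.\<close>

lemma part_disjoint:
  assumes "S \<inter> T = {}" "x \<in> part S" "x \<in> part T"
  shows "x = 0"
proof (rule ccontr)
  assume "x \<noteq> 0"
  obtain r h where x: "r \<in> R" "h \<in> H" "x = r / h" "\<And>\<gamma>. component r \<gamma> \<noteq> 0 \<Longrightarrow> component r \<gamma> / h \<in> S"
    using assms(2) by (rule partE) blast
  obtain s k where y: "s \<in> R" "k \<in> H" "x = s / k" "\<And>\<gamma>. component s \<gamma> \<noteq> 0 \<Longrightarrow> component s \<gamma> / k \<in> T"
    using assms(3) by (rule partE) blast
  have nz: "h \<noteq> 0" "k \<noteq> 0" using x(2) y(2) by (auto simp: H_iff)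
  have eq: "k * r = h * s" using x(3) y(3) nz by (simp add: field_simps)
  have "k * r \<in> R" "k * r \<noteq> 0" using x y H_subset mult_mem nz \<open>x \<noteq> 0\<close> by auto
  then obtain \<gamma> where \<gamma>: "component (k * r) \<gamma> \<noteq> 0" using component_zero_imp by blast
  have "component (k * r) \<gamma> / (k * h) \<in> S"
    by (rule component_divide_invariant[OF x(1,2,4) y(2) \<gamma>])
  moreover have "component (h * s) \<gamma> / (h * k) \<in> T"
    by (rule component_divide_invariant[OF y(1,2,4) x(2)]) (use \<gamma> eq in auto)
  ultimately show False using assms(1) eq by (auto simp: mult.commute)
qed

text \<open>An element is the sum of its components, so inclusions of \<open>part S\<close> into
  additively closed sets can be checked on \<open>S\<close>.\<close>

lemma part_singleton_induct:
  assumes "x \<in> part S" "0 \<in> B" "\<And>x y. x \<in> B \<Longrightarrow> y \<in> B \<Longrightarrow> x + y \<in> B" "S \<subseteq> B"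
  shows "x \<in> B"
proof -
  obtain r h where x: "r \<in> R" "h \<in> H" "x = r / h" "\<And>\<gamma>. component r \<gamma> \<noteq> 0 \<Longrightarrow> component r \<gamma> / h \<in> S"
    using assms(1) by (rule partE) blast
  have "(\<Sum>\<gamma>\<in>T. component r \<gamma> / h) \<in> B" if "T \<subseteq> {\<gamma>. component r \<gamma> \<noteq> 0}" for T
    using that
    by (induction T rule: infinite_finite_induct) (use assms(2-4) x(4) in auto)
  then have "(\<Sum>\<gamma> | component r \<gamma> \<noteq> 0. component r \<gamma>) / h \<in> B" by (simp add: sum_divide_distrib)
  then show ?thesis using sum_component[OF x(1)] x(3) by simp
qed

lemma W0_invariant_gen_subgroup: "set vs \<subseteq> U \<Longrightarrow> W0_invariant (units.gen_subgroup vs)"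
  unfolding W0_invariant_def
  using units.gen_subgroup_mult[of vs] units.W0_subset_gen_subgroup[of vs] by blast

lemma W0_invariant_UNIV: "W0_invariant UNIV"
  by (simp add: W0_invariant_def)

lemma W0_invariant_W0: "W0_invariant W0"
  using units.W0_mult by (simp add: W0_invariant_def)

lemma W0_invariant_Compl:
  assumes "W0_invariant S"
  shows "W0_invariant (- S)"
  unfolding W0_invariant_def
proof (intro ballI)
  fix u w assume u: "u \<in> - S" and w: "w \<in> W0"
  have "w \<noteq> 0" using w units.W0_subset units.U_nonzero by auto
  then have "u * w * inverse w = u" by simp
  then show "u * w \<in> - S" using u assms units.W0_inverse[OF w] unfolding W0_invariant_def by (metis ComplD ComplI)
qed

lemma W0_invariant_coset: "W0_invariant S \<Longrightarrow> W0_invariant ((*) u ` S)"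
  by (auto simp: W0_invariant_def mult.assoc)

section \<open>Subrings of \<open>R\<^sub>H\<close> supported on subgroups of degrees\<close>

lemma field_subring_part:
  assumes "W0_invariant S" "1 \<in> S" "\<And>x y. x \<in> S \<Longrightarrow> y \<in> S \<Longrightarrow> x * y \<in> S"
  shows "field_subring (part S)"
proof
  show "1 \<in> part S" using homogeneous_mem_part[of 1 1 S] one_mem_H assms(2) by simp
  show "x - y \<in> part S" "x * y \<in> part S" if "x \<in> part S" "y \<in> part S" for x y
    using part_diff[OF assms(1) that] part_mult[OF assms(1) assms(3) that] by auto
qed

text \<open>Over the denominator \<open>s * t\<close> the numerators of two fractions of degree 0
  share a degree, so sums stay of degree 0. Hence nonzero elements of \<open>part W0\<close> are
  invertible.\<close>

lemma part_W0_subset: "part W0 \<subseteq> insert 0 W0"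
proof
  fix x assume "x \<in> part W0"
  then show "x \<in> insert 0 W0"
  proof (rule part_singleton_induct)
    fix x y assume "x \<in> insert 0 W0" "y \<in> insert 0 W0"
    show "x + y \<in> insert 0 W0"
    proof (cases "x = 0 \<or> y = 0 \<or> x + y = 0")
      case True
      then show ?thesis using \<open>x \<in> _\<close> \<open>y \<in> _\<close> by auto
    next
      case False
      with \<open>x \<in> _\<close> \<open>y \<in> _\<close> obtain a s \<alpha> b t \<beta> where x: "x = a / s" "a \<in> gr \<alpha>" "s \<in> gr \<alpha>" "s \<noteq> 0"
        and y: "y = b / t" "b \<in> gr \<beta>" "t \<in> gr \<beta>" "t \<noteq> 0"
        unfolding W0_def by blast
      have "x + y = (a * t + b * s) / (s * t)" using x y by (simp add: field_simps)
      moreover have "b * s \<in> gr (\<alpha> + \<beta>)" using gr_mult[OF y(2) x(3)] by (simp add: add.commute)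
      then have "a * t + b * s \<in> gr (\<alpha> + \<beta>)" "s * t \<in> gr (\<alpha> + \<beta>)"
        using gr_mult gr_add x y by auto
      moreover have "a * t + b * s \<noteq> 0" using False calculation(1) by auto
      ultimately show ?thesis using W0I[of "a * t + b * s" "\<alpha> + \<beta>" "s * t"] x(4) y(4) by auto
    qed
  qed auto
qed

lemma gcd_subring_part_W0: "gcd_subring (part W0)"
proof -
  interpret B: field_subring "part W0"
    by (rule field_subring_part) (auto simp: W0_invariant_W0 units.W0_one units.W0_mult)
  have inv: "1 / x \<in> part W0" if "x \<in> part W0" "x \<noteq> 0" for x
  proof -
    have "x \<in> W0" using that part_W0_subset by auto
    then have "inverse x \<in> W0" by (rule units.W0_inverse)
    then show ?thesis using subset_part[OF units.W0_subset] by (auto simp: inverse_eq_divide)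
  qed
  show ?thesis
  proof
    fix a b assume ab: "a \<in> part W0" "b \<in> part W0" "a \<noteq> 0"
    \<comment> \<open>In a field the nonzero \<open>a\<close> divides \<open>b\<close>, so the
      condition on \<open>x * a\<close> implies the one on \<open>x * b\<close>.\<close>
    have "x * a \<in> part W0 \<and> x * b \<in> part W0 \<longleftrightarrow> x / (1 / a) \<in> part W0" for x
      using B.mult_mem[OF _ B.mult_mem[OF inv[OF ab(1,3)] ab(2)], of "x * a"] ab(3) by auto
    then show "\<exists>e. e \<noteq> 0 \<and> (\<forall>x. x * a \<in> part W0 \<and> x * b \<in> part W0 \<longleftrightarrow> x / e \<in> part W0)"
      using ab(3) by (intro exI[of _ "1 / a"]) simp
  qed
qed

text \<open>Adding an independent generator \<open>v\<close> turns the ring of the smaller subgroup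
  into its Laurent ring in \<open>v\<close>, so greatest common divisors propagate upwards from the
  field of degree 0.\<close>

lemma gcd_subring_part_gen_subgroup:
  assumes "set vs \<subseteq> U" "units.independent vs"
  shows "gcd_subring (part (units.gen_subgroup vs))"
  using assms
proof (induction vs)
  case Nil
  then show ?case using gcd_subring_part_W0 by simp
next
  case (Cons v vs)
  let ?W = "units.gen_subgroup vs" and ?V = "units.gen_subgroup (v # vs)"
  have vs: "set vs \<subseteq> U" "set (v # vs) \<subseteq> U" and v: "v \<in> U" "v \<noteq> 0"
    using Cons.prems units.U_nonzero by auto
  interpret gcd_subring "part ?W" using Cons by simp
  interpret V: field_subring "part ?V"
    using field_subring_part[OF W0_invariant_gen_subgroup[OF vs(2)]]
      units.gen_subgroup_one units.gen_subgroup_mult[OF vs(2)] by blast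
  note invW = W0_invariant_gen_subgroup[OF vs(1)]
  define S where "S i = (*) (v ^ i) ` ?W" for i :: nat
  \<comment> \<open>Independence means that different powers of \<open>v\<close> lie in different
    cosets of \<open>?W\<close>.\<close>
  have inj: "i = j" if "v ^ i * w = v ^ j * z" "w \<in> ?W" "z \<in> ?W" for i j w z
  proof -
    have wz: "w \<noteq> 0" "z \<noteq> 0" using that units.gen_subgroup_subset[OF vs(1)] units.U_nonzero by auto
    have False if "i < j" "v ^ i * w = v ^ j * z" "w \<in> ?W" "z \<in> ?W" for i j w z
    proof -
      have z: "z \<noteq> 0" using that units.gen_subgroup_subset[OF vs(1)] units.U_nonzero by auto
      have "v ^ i * w = v ^ i * (v ^ (j - i) * z)"
        using that(1,2) by (simp add: power_add[symmetric] mult.assoc[symmetric])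
      then have "w = v ^ (j - i) * z" using v by simp
      then have "v ^ (j - i) = w * inverse z" using z by simp
      also have "\<dots> \<in> ?W"
        using units.gen_subgroup_mult[OF vs(1)] units.gen_subgroup_inverse[OF vs(1)] that by blast
      finally show False using Cons.prems(2) that(1) by auto
    qed
    from this[of i j w z] this[of j i z w] that show ?thesis by (metis linorder_neqE_nat)
  qed
  have trans: "p = 0" if p: "poly_over (part ?W) p" "poly p v = 0" for p
  proof (rule poly_eqI)
    fix j
    have summand: "coeff p i * v ^ i \<in> part (S i)" for i
    proof (rule part_mult)
      show "W0_invariant (S i)" unfolding S_def by (rule W0_invariant_coset[OF invW])
      show "coeff p i \<in> part ?W" using p by (simp add: poly_over_def)
      have "v ^ i \<in> U" using units.U_power_int[OF v(1), of "int i"] by simp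
      then show "v ^ i \<in> part {v ^ i}" by (rule mem_part_singleton)
      show "x * y \<in> S i" if "x \<in> ?W" "y \<in> {v ^ i}" for x y
        using that by (auto simp: S_def mult.commute[of x])
    qed
    \<comment> \<open>In a relation \<open>poly p v = 0\<close> the term of index \<open>j\<close>
      equals minus the sum of the others, which is supported on the remaining cosets
      \<open>T\<close>; being supported on \<open>S j\<close> as well, it vanishes.\<close>
    define T where "T = (\<Union>i\<in>{..degree p} - {j}. S i)"
    have "W0_invariant (S i)" for i unfolding S_def by (rule W0_invariant_coset[OF invW])
    then have "W0_invariant T" unfolding T_def W0_invariant_def by blast
    moreover have "coeff p i * v ^ i \<in> part T" if "i \<in> {..degree p} - {j}" for i
      using summand[of i] part_mono[of "S i" T] that unfolding T_def by blast
    ultimately have sumT: "(\<Sum>i\<in>{..degree p} - {j}. coeff p i * v ^ i) \<in> part T"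
      by (rule part_sum)
    have "S j \<inter> T = {}" unfolding T_def S_def using inj by blast
    show "coeff p j = coeff 0 j"
    proof (cases "j \<le> degree p")
      case True
      have "coeff p j * v ^ j + (\<Sum>i\<in>{..degree p} - {j}. coeff p i * v ^ i) = 0"
        using p(2) True unfolding poly_altdef by (subst sum.remove[symmetric]) auto
      then have "coeff p j * v ^ j = - (\<Sum>i\<in>{..degree p} - {j}. coeff p i * v ^ i)"
        by (rule eq_neg_iff_add_eq_0[THEN iffD2])
      then have "coeff p j * v ^ j \<in> part T"
        using part_uminus[OF \<open>W0_invariant T\<close> sumT] by simp
      then have "coeff p j * v ^ j = 0" using part_disjoint[OF \<open>S j \<inter> T = {}\<close> summand] by blast
      then show ?thesis using v by simp
    qed (simp add: coeff_eq_0)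
  qed
  have "gcd_subring (laurent (part ?W) v)" by (rule gcd_subring_laurent[OF trans])
  moreover have "laurent (part ?W) v = part ?V"
  proof
    interpret L: gcd_subring "laurent (part ?W) v" by fact
    have WV: "part ?W \<subseteq> part ?V" by (rule part_mono) (use units.gen_subgroup_tail in blast)
    have vV: "v powi k \<in> part ?V" for k
    proof -
      have "v powi k * 1 \<in> ?V" using units.gen_subgroup_one unfolding units.gen_subgroup.simps by blast
      then have "v powi k \<in> ?V" by (simp only: mult_1_right)
      then show ?thesis using subset_part[OF units.gen_subgroup_subset[OF vs(2)]] by blast
    qed
    show "laurent (part ?W) v \<subseteq> part ?V"
    proof
      fix x assume "x \<in> laurent (part ?W) v"
      then obtain p n where p: "poly_over (part ?W) p" "x = poly p v / v ^ n" by (auto simp: laurent_def)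
      have "coeff p i * v ^ i \<in> part ?V" for i
        using V.mult_mem[OF _ vV[of "int i"]] p(1) WV by (auto simp: poly_over_def)
      then have "poly p v \<in> part ?V" unfolding poly_altdef by (rule V.sum_mem)
      moreover have "v powi (- int n) \<in> part ?V" by (rule vV)
      ultimately have "poly p v * v powi (- int n) \<in> part ?V" by (rule V.mult_mem)
      then show "x \<in> part ?V" by (simp add: p(2) power_int_minus field_simps)
    qed
    have "?V \<subseteq> laurent (part ?W) v"
    proof
      fix x assume "x \<in> ?V"
      then obtain k w where x: "x = v powi k * w" "w \<in> ?W" by auto
      then have w: "w \<in> part ?W" using subset_part[OF units.gen_subgroup_subset[OF vs(1)]] by blast
      show "x \<in> laurent (part ?W) v"
      proof (cases "k \<ge> 0")
        case True
        then have "x = poly (monom w (nat k)) v / v ^ 0" by (simp add: x(1) poly_monom power_int_def)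
        then show ?thesis using poly_over_monom[OF w] unfolding laurent_def by blast
      next
        case False
        then have "x = poly (monom w 0) v / v ^ nat (- k)"
          by (simp add: x(1) poly_monom power_int_def field_simps)
        then show ?thesis using poly_over_monom[OF w] unfolding laurent_def by blast
      qed
    qed
    then show "part ?V \<subseteq> laurent (part ?W) v"
      using part_singleton_induct[of _ ?V "laurent (part ?W) v"] L.zero_mem L.add_mem by blast
  qed
  ultimately show ?case by simp
qed

text \<open>
  With \<open>W\<close> the subgroup generated by \<open>vs\<close>, a relation \<open>p * g = q * f\<close> with \<open>f, g \<in> part W\<close> holds
  separately for the parts of \<open>p\<close> and \<open>q\<close> in each coset of \<open>W\<close>. Splitting off one coset at a time
  is an induction on the number of components of \<open>p = r / h\<close>.
\<close>

lemma gcd_persists: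
  assumes vs: "set vs \<subseteq> U"
    and fg: "f \<in> part (units.gen_subgroup vs)" "g \<in> part (units.gen_subgroup vs)" "f \<noteq> 0"
    and e: "\<And>x. x * f \<in> part (units.gen_subgroup vs) \<Longrightarrow> x * g \<in> part (units.gen_subgroup vs) \<Longrightarrow>
      x / e \<in> part (units.gen_subgroup vs)"
    and pq: "r \<in> R" "h \<in> H" "q \<in> part UNIV" "r / h * g = q * f"
  shows "r / h / f / e \<in> part UNIV"
  using pq(1,3,4)
proof (induction "card {\<gamma>. component r \<gamma> \<noteq> 0}" arbitrary: r q rule: less_induct)
  case less
  let ?W = "units.gen_subgroup vs"
  interpret A: field_subring "part UNIV" by (rule field_subring_part) (auto simp: W0_invariant_UNIV)
  note invW = W0_invariant_gen_subgroup[OF vs]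
  have h: "h \<noteq> 0" using pq(2) by (simp add: H_iff)
  show ?case
  proof (cases "r = 0")
    case True
    then show ?thesis using zero_mem_part by simp
  next
    case False
    then obtain \<gamma>0 where \<gamma>0: "component r \<gamma>0 \<noteq> 0" using component_zero_imp[OF less.prems(1)] by blast
    \<comment> \<open>Any component of \<open>r / h\<close> selects the coset to split off; it also
      serves as a unit representing that coset.\<close>
    define u where "u = component r \<gamma>0 / h"
    have u: "u \<in> U" "u \<noteq> 0"
      using UI[OF component_mem_H[OF less.prems(1) \<gamma>0] pq(2)] \<gamma>0 h by (auto simp: u_def)
    define S where "S = (*) u ` ?W"
    have S: "W0_invariant S" "W0_invariant (- S)"
      unfolding S_def by (intro W0_invariant_Compl W0_invariant_coset invW)+
    have split: "\<exists>a b. a \<in> R \<and> b \<in> R \<and> x = a + b \<and>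
        (\<forall>\<gamma>. component a \<gamma> = (if component x \<gamma> / k \<in> S then component x \<gamma> else 0)) \<and>
        (\<forall>\<gamma>. component b \<gamma> = (if component x \<gamma> / k \<in> S then 0 else component x \<gamma>))" if x: "x \<in> R" for x k
    proof -
      let ?N = "{\<gamma>. component x \<gamma> \<noteq> 0}"
      define a where "a = (\<lambda>\<gamma>. if component x \<gamma> / k \<in> S then component x \<gamma> else 0)"
      define b where "b = (\<lambda>\<gamma>. if component x \<gamma> / k \<in> S then 0 else component x \<gamma>)"
      have fin: "finite ?N" by (rule finite_component[OF x])
      have "component (sum a ?N) = a" "component (sum b ?N) = b"
        by (rule component_unique[of _ ?N]; use fin component_mem[OF x] gr_zero in \<open>auto simp: a_def b_def\<close>)+
      moreover have "sum a ?N + sum b ?N = (\<Sum>\<gamma>\<in>?N. component x \<gamma>)"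
        unfolding sum.distrib[symmetric] by (rule sum.cong) (auto simp: a_def b_def)
      then have "sum a ?N + sum b ?N = x" using sum_component[OF x] by simp
      moreover have "sum a ?N \<in> R" "sum b ?N \<in> R"
        using subsetD[OF gr_subset component_mem[OF x]] zero_mem
        by (auto intro!: sum_mem simp: a_def b_def)
      ultimately show ?thesis
        by (intro exI[of _ "sum a ?N"] exI[of _ "sum b ?N"]) (auto simp: a_def b_def)
    qed
    obtain a b where ab: "a \<in> R" "b \<in> R" "r = a + b"
      "\<And>\<gamma>. component a \<gamma> = (if component r \<gamma> / h \<in> S then component r \<gamma> else 0)"
      "\<And>\<gamma>. component b \<gamma> = (if component r \<gamma> / h \<in> S then 0 else component r \<gamma>)"
      using split[OF less.prems(1), of h] by blast
    obtain s k where sk: "s \<in> R" "k \<in> H" "q = s / k" using less.prems(2) by (auto elim: partE)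
    obtain c d where cd: "c \<in> R" "d \<in> R" "s = c + d"
      "\<And>\<gamma>. component c \<gamma> = (if component s \<gamma> / k \<in> S then component s \<gamma> else 0)"
      "\<And>\<gamma>. component d \<gamma> = (if component s \<gamma> / k \<in> S then 0 else component s \<gamma>)"
      using split[OF sk(1), of k] by blast
    have parts: "a / h \<in> part S" "b / h \<in> part (- S)" "c / k \<in> part S" "d / k \<in> part (- S)"
      by (intro partI ab cd sk pq; simp add: ab(4,5) cd(4,5) split: if_splits)+
    have SW: "x * w \<in> S" if "x \<in> S" "w \<in> ?W" for x w
      using that units.gen_subgroup_mult[OF vs] by (auto simp: S_def mult.assoc)
    have CW: "x * w \<in> - S" if "x \<in> - S" "w \<in> ?W" for x w
    proof
      assume "x * w \<in> S"
      then have "x * w * inverse w \<in> S" using SW units.gen_subgroup_inverse[OF vs that(2)] by blast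
      moreover have "w \<noteq> 0" using that units.gen_subgroup_subset[OF vs] units.U_nonzero by auto
      ultimately show False using that by (simp add: mult.assoc)
    qed
    \<comment> \<open>Multiplication by \<open>f\<close> or \<open>g\<close> preserves both
      \<open>S\<close> and its complement. The left side is supported on \<open>S\<close>, the right
      side outside it, so both vanish.\<close>
    have eq: "a / h * g - c / k * f = d / k * f - b / h * g"
      using less.prems(3) unfolding ab(3) sk(3) cd(3) by (simp add: add_divide_distrib algebra_simps)
    have "a / h * g - c / k * f \<in> part S"
      by (rule part_diff[OF S(1) part_mult[OF S(1) SW parts(1) fg(2)] part_mult[OF S(1) SW parts(3) fg(1)]])
    moreover have "a / h * g - c / k * f \<in> part (- S)"
      unfolding eq
      by (rule part_diff[OF S(2) part_mult[OF S(2) CW parts(4) fg(1)] part_mult[OF S(2) CW parts(2) fg(2)]])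
    ultimately have "a / h * g - c / k * f = 0" using part_disjoint[of S "- S"] by blast
    then have eq1: "a / h * g = c / k * f" and eq2: "b / h * g = d / k * f" using eq by auto
    \<comment> \<open>Division by \<open>u\<close> moves the coset \<open>S\<close> onto
      \<open>?W\<close> itself, where the hypothesis on \<open>e\<close> applies.\<close>
    have unit: "inverse u * y \<in> part ?W" if "y \<in> part S" for y
    proof (rule part_mult[OF invW _ _ that])
      show "inverse u \<in> part {inverse u}"
        by (rule mem_part_singleton[OF units.U_inverse[OF u(1)]])
      show "x * z \<in> ?W" if "x \<in> {inverse u}" "z \<in> S" for x z
        using that u(2) by (auto simp: S_def mult.assoc[symmetric])
    qed
    have "inverse u * (a / h) / f * f \<in> part ?W"
      using unit[OF parts(1)] fg(3) by simp
    moreover have "inverse u * (a / h) / f * g \<in> part ?W"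
    proof -
      have "inverse u * (a / h) / f * g = inverse u * (a / h * g) / f" by simp
      also have "\<dots> = inverse u * (c / k)" unfolding eq1 using fg(3) by simp
      finally show ?thesis using unit[OF parts(3)] by simp
    qed
    ultimately have "inverse u * (a / h) / f / e \<in> part ?W" by (rule e)
    then have "inverse u * (a / h) / f / e \<in> part UNIV" using part_mono[of ?W UNIV] by blast
    moreover have "u \<in> part UNIV" using subset_part[of U] part_mono[of U UNIV] u(1) by blast
    ultimately have "u * (inverse u * (a / h) / f / e) \<in> part UNIV" by (intro A.mult_mem)
    moreover have "u * (inverse u * (a / h) / f / e) = a / h / f / e"
      using u(2) by (simp add: mult.assoc[symmetric])
    ultimately have 1: "a / h / f / e \<in> part UNIV" by metis
    \<comment> \<open>The component in degree \<open>\<gamma>0\<close> went to \<open>a\<close>, so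
      the remainder \<open>b\<close> has fewer components.\<close>
    have "card {\<gamma>. component b \<gamma> \<noteq> 0} < card {\<gamma>. component r \<gamma> \<noteq> 0}"
    proof (rule psubset_card_mono[OF finite_component[OF less.prems(1)]])
      have "component r \<gamma>0 / h \<in> S"
        unfolding S_def u_def[symmetric] using units.gen_subgroup_one by force
      then show "{\<gamma>. component b \<gamma> \<noteq> 0} \<subset> {\<gamma>. component r \<gamma> \<noteq> 0}" using \<gamma>0 by (auto simp: ab(5))
    qed
    moreover have "d / k \<in> part UNIV" using parts(4) part_mono by blast
    ultimately have "b / h / f / e \<in> part UNIV" using less.hyps[OF _ ab(2) _ eq2] by blast
    with 1 have "a / h / f / e + b / h / f / e \<in> part UNIV" by (rule A.add_mem)
    then show ?thesis by (simp add: ab(3) add_divide_distrib)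
  qed
qed

text \<open>Two elements have finitely many components, so both lie in the ring of one independent
  list of units. The \<open>e\<close> found there still works for multipliers of arbitrary
  degrees.\<close>

theorem gcd_subring_localization: "gcd_subring (localization R H)"
proof -
  interpret A: field_subring "part UNIV" by (rule field_subring_part) (auto simp: W0_invariant_UNIV)
  have "gcd_subring (part UNIV)"
  proof
    fix f g assume fg: "f \<in> part UNIV" "g \<in> part UNIV" "f \<noteq> 0"
    obtain r h where r: "r \<in> R" "h \<in> H" "f = r / h" using fg(1) by (rule partE) blast
    obtain s k where s: "s \<in> R" "k \<in> H" "g = s / k" using fg(2) by (rule partE) blast
    define N where "N = (\<lambda>\<gamma>. component r \<gamma> / h) ` {\<gamma>. component r \<gamma> \<noteq> 0} \<union>
      (\<lambda>\<gamma>. component s \<gamma> / k) ` {\<gamma>. component s \<gamma> \<noteq> 0}"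
    have "finite N" "N \<subseteq> U"
      using finite_component r s component_mem_H by (auto simp: N_def intro: UI)
    from units.independent_generators[OF this] obtain vs where vs: "set vs \<subseteq> U" "units.independent vs"
      "N \<subseteq> units.gen_subgroup vs" by blast
    let ?W = "units.gen_subgroup vs"
    have fgW: "f \<in> part ?W" "g \<in> part ?W"
      unfolding r(3) s(3) using vs(3) r s by (auto simp: N_def intro!: partI)
    interpret W: gcd_subring "part ?W" by (rule gcd_subring_part_gen_subgroup[OF vs(1,2)])
    obtain e where e: "e \<noteq> 0" "\<And>x. x * f \<in> part ?W \<and> x * g \<in> part ?W \<longleftrightarrow> x / e \<in> part ?W"
      using W.gcd_ex[OF fgW fg(3)] by blast
    have "x * f \<in> part UNIV \<and> x * g \<in> part UNIV \<longleftrightarrow> x / e \<in> part UNIV" for x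
    proof
      assume x: "x * f \<in> part UNIV \<and> x * g \<in> part UNIV"
      then obtain a b where ab: "a \<in> R" "b \<in> H" "x * f = a / b" by (auto elim: partE)
      have "a / b / f / e \<in> part UNIV"
        by (rule gcd_persists[OF vs(1) fgW fg(3) _ ab(1,2), of _ "x * g"])
          (use e(2) x ab(3)[symmetric] in auto)
      then show "x / e \<in> part UNIV" using fg(3) by (simp add: ab(3)[symmetric])
    next
      assume x: "x / e \<in> part UNIV"
      have "e * f \<in> part ?W" "e * g \<in> part ?W" using e(2)[of e] e(1) W.one_mem by auto
      then have "e * f \<in> part UNIV" "e * g \<in> part UNIV" using part_mono[of ?W UNIV] by auto
      then have "x / e * (e * f) \<in> part UNIV" "x / e * (e * g) \<in> part UNIV"
        using A.mult_mem[OF x] by blast+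
      moreover have "x / e * (e * f) = x * f" "x / e * (e * g) = x * g" using e(1) by auto
      ultimately show "x * f \<in> part UNIV \<and> x * g \<in> part UNIV" by metis
    qed
    with e(1) show "\<exists>e. e \<noteq> 0 \<and> (\<forall>x. x * f \<in> part UNIV \<and> x * g \<in> part UNIV \<longleftrightarrow> x / e \<in> part UNIV)"
      by blast
  qed
  then show ?thesis by (simp add: part_UNIV)
qed

end


section \<open>Content ideals\<close>

lemma equiv_diff_rel: "equiv UNIV (diff_rel :: (('g \<times> 'g) \<times> ('g \<times> 'g::cancel_comm_monoid_add)) set)"
proof (rule equivI)
  show "refl (diff_rel :: (('g \<times> 'g) \<times> _) set)" by (auto simp: refl_on_def diff_rel_def)
  show "sym (diff_rel :: (('g \<times> 'g) \<times> _) set)" by (auto simp: sym_def diff_rel_def)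
  have "a + f = e + b" if "a + d = c + b" "c + f = e + d" for a b c d e f :: 'g
  proof -
    have "(a + f) + (c + d) = (e + b) + (c + d)"
      using arg_cong2[OF that, of "(+)"] by (simp add: ac_simps)
    then show ?thesis by simp
  qed
  then show "trans (diff_rel :: (('g \<times> 'g) \<times> _) set)"
    unfolding trans_def diff_rel_def by blast
qed auto

lemma (in field_subring) field_subring_localization:
  assumes "S \<subseteq> D" "1 \<in> S" "0 \<notin> S" "\<And>x y. x \<in> S \<Longrightarrow> y \<in> S \<Longrightarrow> x * y \<in> S"
  shows "field_subring (localization D S)"
proof
  show "1 \<in> localization D S"
    unfolding localization_def using assms(2) one_mem by (intro CollectI exI[of _ 1]) auto
  fix x y assume "x \<in> localization D S" "y \<in> localization D S"
  then obtain a s b t where xy: "x = a / s" "y = b / t" "a \<in> D" "b \<in> D" "s \<in> S" "t \<in> S"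
    unfolding localization_def by blast
  then have nz: "s \<noteq> 0" "t \<noteq> 0" using assms(3) by auto
  have "x - y = (a * t - b * s) / (s * t)" "x * y = a * b / (s * t)"
    using nz by (simp_all add: xy field_simps)
  moreover have "a * t - b * s \<in> D" "a * b \<in> D" "s * t \<in> S"
    using xy assms by (auto intro!: diff_mem mult_mem)
  ultimately show "x - y \<in> localization D S" "x * y \<in> localization D S"
    unfolding localization_def by blast+
qed

lemma (in field_subring) subset_localization: "1 \<in> S \<Longrightarrow> D \<subseteq> localization D S"
  unfolding localization_def by (force intro: exI[of _ 1])

context graded_domain
begin

lemma homogeneous_common_denominator:
  assumes "finite N" "\<And>x. x \<in> N \<Longrightarrow> \<exists>a s. x = a / s \<and> s \<in> H \<and> a \<in> insert 0 H"
  shows "\<exists>h\<in>H. \<forall>x\<in>N. h * x \<in> insert 0 H"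
  using assms
proof (induction rule: finite_induct)
  case empty
  then show ?case using one_mem_H by auto
next
  case (insert x N)
  then obtain h where h: "h \<in> H" "\<forall>x\<in>N. h * x \<in> insert 0 H" by auto
  obtain a s where as: "x = a / s" "s \<in> H" "a \<in> insert 0 H" using insert.prems[of x] by blast
  have "s \<noteq> 0" using as(2) by (simp add: H_iff)
  have "s * h * y \<in> insert 0 H" if "y \<in> N" for y
    using h(2) that as(2) H_mult[of s "h * y"] by (auto simp: mult.assoc)
  moreover have "s * h * x \<in> insert 0 H"
    using as h(1) \<open>s \<noteq> 0\<close> H_mult[of h a] by auto
  ultimately show ?case using H_mult[OF as(2) h(1)] by (intro bexI[of _ "s * h"]) auto
qed

text \<open>Contents are defined by decompositions over the quotient group, while uniqueness is
  given in \<open>R\<close>. A homogeneous denominator \<open>h\<close> carries such a decomposition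
  to the one of \<open>h * f\<close> in \<open>R\<close>.\<close>

lemma homogeneous_components_subset:
  assumes f: "f \<in> R" and x: "x \<in> homogeneous_components gr f"
  shows "x = 0 \<or> (\<exists>\<gamma>. x = component f \<gamma>)"
proof (rule disjCI)
  assume "\<nexists>\<gamma>. x = component f \<gamma>"
  from x obtain c Z0 where x0: "x = c Z0" "Z0 \<in> quotient_group" and dec: "decomposition (frac_gr gr) quotient_group f c"
    unfolding homogeneous_components_def by blast
  define N where "N = {Z. c Z \<noteq> 0}"
  have N: "finite N" "N \<subseteq> quotient_group" "f = sum c N" "\<And>Z. Z \<in> N \<Longrightarrow> c Z \<in> frac_gr gr Z"
    using dec unfolding N_def decomposition_def by auto
  have "\<exists>h\<in>H. \<forall>x\<in>c ` N. h * x \<in> insert 0 H"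
  proof (rule homogeneous_common_denominator)
    fix y assume "y \<in> c ` N"
    then obtain Z where "Z \<in> N" "y = c Z" by blast
    with N(4)[of Z] obtain a s \<alpha> \<beta> where "y = a / s" "a \<in> gr \<alpha>" "s \<in> gr \<beta> - {0}"
      unfolding frac_gr_def by blast
    then show "\<exists>a s. y = a / s \<and> s \<in> H \<and> a \<in> insert 0 H" unfolding H_iff insert_iff by blast
  qed (use N in simp)
  then obtain h where h: "h \<in> H" "\<And>Z. Z \<in> N \<Longrightarrow> h * c Z \<in> insert 0 H" by blast
  obtain \<delta> where \<delta>: "h \<in> gr \<delta>" "h \<noteq> 0" using h(1) by (auto simp: H_iff)
  have "\<exists>d. h * c Z \<in> gr d" if "Z \<in> N" for Z using h(2)[OF that] gr_zero by (auto simp: H_iff)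
  then obtain d where d: "\<And>Z. Z \<in> N \<Longrightarrow> h * c Z \<in> gr (d Z)" by metis
  \<comment> \<open>The equation comes from the two degrees of \<open>h * a = s * (h * c Z)\<close>.
    It determines the class \<open>Z\<close> from \<open>d Z\<close>, whence \<open>d\<close> is
    injective.\<close>
  have degree: "\<exists>\<alpha> \<beta>. (\<alpha>, \<beta>) \<in> Z \<and> \<delta> + \<alpha> = \<beta> + d Z" if Z: "Z \<in> N" for Z
  proof -
    obtain a s \<alpha> \<beta> where as: "c Z = a / s" "(\<alpha>, \<beta>) \<in> Z" "a \<in> gr \<alpha>" "s \<in> gr \<beta>" "s \<noteq> 0"
      using N(4)[OF Z] unfolding frac_gr_def by blast
    have "h * a = s * (h * c Z)" using as by simp
    moreover have "h * a \<in> gr (\<delta> + \<alpha>)" "s * (h * c Z) \<in> gr (\<beta> + d Z)"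
      by (rule gr_mult[OF \<delta>(1) as(3)], rule gr_mult[OF as(4) d[OF Z]])
    moreover have "h * a \<noteq> 0" using Z \<delta> as by (auto simp: N_def)
    ultimately show ?thesis using as(2) degree_unique by metis
  qed
  have inj: "inj_on d N"
  proof (rule inj_onI)
    fix Z Y assume XY: "Z \<in> N" "Y \<in> N" "d Z = d Y"
    obtain \<alpha> \<beta> where Z: "(\<alpha>, \<beta>) \<in> Z" "\<delta> + \<alpha> = \<beta> + d Z" using degree[OF XY(1)] by blast
    obtain \<alpha>' \<beta>' where Y: "(\<alpha>', \<beta>') \<in> Y" "\<delta> + \<alpha>' = \<beta>' + d Z" using degree[OF XY(2)] XY(3) by metis
    have "(\<alpha> + \<beta>') + (\<delta> + d Z) = (\<alpha>' + \<beta>) + (\<delta> + d Z)"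
      using arg_cong2[OF Z(2) Y(2)[symmetric], of "(+)"] by (simp add: ac_simps)
    then have "((\<alpha>, \<beta>), (\<alpha>', \<beta>')) \<in> diff_rel" by (simp add: diff_rel_def)
    moreover have "Z \<in> UNIV // diff_rel" "Y \<in> UNIV // diff_rel"
      using N(2) XY(1,2) by (auto simp: quotient_group_def)
    ultimately show "Z = Y" using quotient_eqI[OF equiv_diff_rel] Z(1) Y(1) by blast
  qed
  define c' where "c' \<gamma> = (if \<gamma> \<in> d ` N then h * c (the_inv_into N d \<gamma>) else 0)" for \<gamma>
  have c': "c' (d Z) = h * c Z" if "Z \<in> N" for Z
    using that by (simp add: c'_def the_inv_into_f_f[OF inj])
  have "component (h * f) = c'"
  proof (rule component_unique[of _ "d ` N"])
    show "c' \<gamma> \<in> gr \<gamma>" for \<gamma>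
      using c' d gr_zero by (cases "\<gamma> \<in> d ` N") (auto, simp add: c'_def)
    show "h * f = sum c' (d ` N)"
      by (simp add: sum.reindex[OF inj] c' N(3) sum_distrib_left)
  qed (use N in \<open>auto simp: c'_def\<close>)
  show "x = 0"
  proof (rule ccontr)
    assume "x \<noteq> 0"
    then have Z0: "Z0 \<in> N" using x0 by (simp add: N_def)
    have eq: "component (h * f) (d Z0) = h * x" using \<open>component (h * f) = c'\<close> c'[OF Z0] x0 by simp
    then obtain \<epsilon> where "d Z0 = \<delta> + \<epsilon>"
      using component_homogeneous_mult(2)[OF \<delta>(1) f, of "d Z0"] \<delta>(2) \<open>x \<noteq> 0\<close> by auto
    then have "x = component f \<epsilon>" using eq component_homogeneous_mult(1)[OF \<delta>(1) f] \<delta>(2) by simp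
    with \<open>\<nexists>\<gamma>. x = component f \<gamma>\<close> show False by blast
  qed
qed

lemma component_mem_homogeneous_components:
  assumes f: "f \<in> R"
  shows "component f \<gamma> \<in> homogeneous_components gr f"
proof -
  \<comment> \<open>The embedding of the monoid into its quotient group; the decomposition of
    \<open>f\<close> is carried along it and extended by 0.\<close>
  define cls where "cls \<epsilon> = diff_rel `` {(\<epsilon>, 0::'g)}" for \<epsilon> :: 'g
  have cls: "cls \<epsilon> \<in> quotient_group" "(\<epsilon>, 0) \<in> cls \<epsilon>" for \<epsilon>
    unfolding cls_def quotient_group_def by (auto intro: quotientI) (simp add: diff_rel_def)
  have inj: "inj cls"
  proof (rule injI)
    fix \<epsilon> \<epsilon>' assume "cls \<epsilon> = cls \<epsilon>'"
    then have "(\<epsilon>', 0) \<in> cls \<epsilon>" using cls by simp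
    then show "\<epsilon> = \<epsilon>'" by (simp add: cls_def diff_rel_def)
  qed
  define c where "c Z = (if Z \<in> range cls then component f (the_inv cls Z) else 0)" for Z
  have c: "c (cls \<epsilon>) = component f \<epsilon>" for \<epsilon> by (simp add: c_def the_inv_f_f[OF inj])
  have supp: "{Z. c Z \<noteq> 0} = cls ` {\<epsilon>. component f \<epsilon> \<noteq> 0}"
    using c by (auto simp: c_def)
  have "decomposition (frac_gr gr) quotient_group f c"
    unfolding decomposition_def
  proof (intro conjI ballI allI impI)
    fix Z :: "('g \<times> 'g) set" assume Z: "Z \<in> quotient_group"
    show "c Z \<in> frac_gr gr Z"
    proof (cases "Z \<in> range cls")
      case True
      then obtain \<epsilon> where "Z = cls \<epsilon>" by blast
      moreover have "component f \<epsilon> / 1 \<in> frac_gr gr (cls \<epsilon>)"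
      proof -
        have "1 \<in> gr 0 - {0}" using one_mem_gr by simp
        then show ?thesis unfolding frac_gr_def using cls(2) component_mem[OF f] by blast
      qed
      ultimately show ?thesis using c by simp
    next
      case False
      obtain \<alpha> \<beta> where "(\<alpha>, \<beta>) \<in> Z" 
        using Z in_quotient_imp_non_empty[OF equiv_diff_rel] unfolding quotient_group_def by fastforce
      \<comment> \<open>To lie in \<open>frac_gr gr Z\<close>, even 0 needs a nonzero denominator of
        degree \<open>\<beta>\<close>; nonvanishing of \<open>gr \<beta>\<close> provides
        it.\<close>
      moreover obtain s where "s \<in> gr \<beta>" "s \<noteq> 0" using gr_nonzero gr_zero by blast
      ultimately have "0 / s \<in> frac_gr gr Z" unfolding frac_gr_def using gr_zero by blast
      then show ?thesis using False by (simp add: c_def)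
    qed
  next
    fix Z :: "('g \<times> 'g) set" assume "Z \<notin> quotient_group"
    then show "c Z = 0" using cls by (auto simp: c_def)
  next
    show "finite {Z. c Z \<noteq> 0}" unfolding supp using finite_component[OF f] by simp
    show "f = (\<Sum>Z | c Z \<noteq> 0. c Z)"
      unfolding supp using sum_component[OF f] by (simp add: sum.reindex[OF inj_on_subset[OF inj]] c)
  qed
  then show ?thesis
    unfolding homogeneous_components_def using cls(1)[of \<gamma>] c[of \<gamma>] by (metis (mono_tags, lifting) mem_Collect_eq)
qed

section \<open>Finiteness of contents and descent from \<open>R\<^sub>H\<close> to
  \<open>R\<close>\<close>

lemma
  assumes Q: "Q \<subseteq> R"
  shows is_submodule_content_ideal: "is_submodule R (content_ideal R gr Q)"
    and content_ideal_subset: "content_ideal R gr Q \<subseteq> R"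
    and component_mem_content_ideal: "f \<in> Q \<Longrightarrow> component f \<gamma> \<in> content_ideal R gr Q"
proof -
  show "is_submodule R (content_ideal R gr Q)"
    unfolding content_ideal_def by (rule is_submodule_hull)
  have "homogeneous_components gr f \<subseteq> R" if "f \<in> Q" for f
    using homogeneous_components_subset[of f] Q that subsetD[OF gr_subset component_mem] zero_mem
    by blast
  then have "content R gr f \<subseteq> R" if "f \<in> Q" for f
    unfolding content_def using that is_submodule_self by (intro hull_minimal) auto
  then show "content_ideal R gr Q \<subseteq> R"
    unfolding content_ideal_def using is_submodule_self by (intro hull_minimal) auto
  assume f: "f \<in> Q"
  then have "component f \<gamma> \<in> content R gr f"
    unfolding content_def using component_mem_homogeneous_components Q by (intro hull_inc) auto
  then show "component f \<gamma> \<in> content_ideal R gr Q"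
    unfolding content_ideal_def using f by (intro hull_inc) auto
qed

text \<open>The claimed property is stable under sums, by uniting the finite sets, and under
  multiples. It thus defines a submodule containing all components, hence both hulls.\<close>

lemma finite_components_of_content_ideal:
  assumes Q: "Q \<subseteq> R" and x: "x \<in> content_ideal R gr Q"
  shows "\<exists>T. finite T \<and> T \<subseteq> Q \<and> (\<forall>y. (\<forall>f\<in>T. \<forall>\<gamma>. y * component f \<gamma> \<in> R) \<longrightarrow> y * x \<in> R)"
    (is "?P x")
proof -
  have sub: "is_submodule R {x. ?P x}"
    unfolding is_submodule_def
  proof (intro conjI ballI)
    show "0 \<in> {x. ?P x}" using zero_mem by (auto intro!: exI[of _ "{}"])
    show "a + b \<in> {x. ?P x}" if "a \<in> {x. ?P x}" "b \<in> {x. ?P x}" for a b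
    proof -
      from that obtain T T' where "finite T" "T \<subseteq> Q" "finite T'" "T' \<subseteq> Q"
        and T: "\<And>y. (\<forall>f\<in>T. \<forall>\<gamma>. y * component f \<gamma> \<in> R) \<Longrightarrow> y * a \<in> R"
          "\<And>y. (\<forall>f\<in>T'. \<forall>\<gamma>. y * component f \<gamma> \<in> R) \<Longrightarrow> y * b \<in> R" by auto
      then show ?thesis
        by (intro CollectI exI[of _ "T \<union> T'"]) (auto simp: distrib_left intro!: add_mem)
    qed
    show "d * a \<in> {x. ?P x}" if "d \<in> R" "a \<in> {x. ?P x}" for d a
    proof -
      from that(2) obtain T where T: "finite T" "T \<subseteq> Q"
        "\<And>y. (\<forall>f\<in>T. \<forall>\<gamma>. y * component f \<gamma> \<in> R) \<Longrightarrow> y * a \<in> R" by auto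
      have "y * (d * a) \<in> R" if "\<forall>f\<in>T. \<forall>\<gamma>. y * component f \<gamma> \<in> R" for y
        using mult_mem[OF \<open>d \<in> R\<close> T(3)[OF that]] by (simp add: mult.left_commute)
      then show ?thesis using T by (intro CollectI exI[of _ T]) auto
    qed
  qed
  have "?P x" if f: "f \<in> Q" and x: "x \<in> homogeneous_components gr f" for f x
  proof -
    have "x = 0 \<or> (\<exists>\<gamma>. x = component f \<gamma>)"
      using homogeneous_components_subset[OF _ x] Q f by blast
    then show ?thesis using f zero_mem by (intro exI[of _ "{f}"]) auto
  qed
  then have "content R gr f \<subseteq> {x. ?P x}" if "f \<in> Q" for f
    unfolding content_def using that by (intro hull_minimal[where S = "is_submodule R"] sub) blast
  then have "content_ideal R gr Q \<subseteq> {x. ?P x}"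
    unfolding content_ideal_def by (intro hull_minimal[where S = "is_submodule R"] sub) blast
  with x show ?thesis by blast
qed

text \<open>That \<open>1\<close> is in the \<open>t\<close>-closure is witnessed by finitely many
  elements of the content ideal, each of which involves components of finitely many elements of
  \<open>Q\<close>.\<close>

lemma finite_unit_content:
  assumes Q: "is_submodule R Q" "Q \<subseteq> R" and C: "t_op R (content_ideal R gr Q) = R"
  obtains T where "finite T" "T \<subseteq> Q" "\<And>y. (\<And>f \<gamma>. f \<in> T \<Longrightarrow> y * component f \<gamma> \<in> R) \<Longrightarrow> y \<in> R"
proof -
  have "1 \<in> t_op R (content_ideal R gr Q)" using C one_mem by simp
  then obtain F where F: "finite F" "F \<subseteq> content_ideal R gr Q" "\<And>y. (\<forall>f\<in>F. y * f \<in> R) \<Longrightarrow> 1 * y \<in> R"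
    unfolding mem_t_op_iff[OF is_submodule_content_ideal[OF Q(2)] content_ideal_subset[OF Q(2)]] by blast
  have "\<forall>x\<in>F. \<exists>T. finite T \<and> T \<subseteq> Q \<and> (\<forall>y. (\<forall>f\<in>T. \<forall>\<gamma>. y * component f \<gamma> \<in> R) \<longrightarrow> y * x \<in> R)"
    using finite_components_of_content_ideal[OF Q(2)] F(2) by blast
  then obtain T where T: "\<And>x. x \<in> F \<Longrightarrow> finite (T x) \<and> T x \<subseteq> Q \<and>
      (\<forall>y. (\<forall>f\<in>T x. \<forall>\<gamma>. y * component f \<gamma> \<in> R) \<longrightarrow> y * x \<in> R)" by metis
  show thesis
  proof (rule that[of "\<Union>x\<in>F. T x"])
    fix y assume y: "\<And>f \<gamma>. f \<in> (\<Union>x\<in>F. T x) \<Longrightarrow> y * component f \<gamma> \<in> R"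
    have "y * x \<in> R" if "x \<in> F" for x
    proof -
      have "\<forall>f\<in>T x. \<forall>\<gamma>. y * component f \<gamma> \<in> R" using y that by blast
      then show ?thesis using T[OF that] by blast
    qed
    then show "y \<in> R" using F(3)[of y] by simp
  qed (use F(1) T in auto)
qed

text \<open>For \<open>x = r / h\<close> the claim is that the components of \<open>r\<close> lie in
  \<open>hR\<close>. The products \<open>f * r = h * (x * f)\<close> have their components there,
  and saturation of \<open>hR\<close> is the hypothesis on \<open>T\<close>. As \<open>r\<close> and
  \<open>f\<close> lie in \<open>R\<close>, an order on the monoid is enough.\<close>

lemma mem_of_unit_content:
  assumes T: "T \<subseteq> R" "\<And>y. (\<And>f \<gamma>. f \<in> T \<Longrightarrow> y * component f \<gamma> \<in> R) \<Longrightarrow> y \<in> R"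
    and x: "x \<in> localization R H" "\<And>f. f \<in> T \<Longrightarrow> x * f \<in> R"
  shows "x \<in> R"
proof -
  obtain P :: "('g \<times> 'g) set" where P: "root_closed_order P" "total P"
    using torsionless torsionless_total_order unfolding multiple_def by metis
  obtain r h where rh: "r \<in> R" "h \<in> H" "x = r / h" using x(1) by (auto simp: localization_def)
  obtain \<delta> where \<delta>: "h \<in> gr \<delta>" "h \<noteq> 0" using rh(2) by (auto simp: H_iff)
  have hR: "h \<in> R" using rh(2) H_subset by blast
  have TR: "component k i \<in> R" if "k \<in> T" for k i using component_mem gr_subset T(1) that by blast
  \<comment> \<open>The coefficient lemma indexes families by a whole type; the index here is the
    element of \<open>T\<close> itself, with empty support outside \<open>T\<close>.\<close>
  define S where "S k = (if k \<in> T then {\<gamma>. component k \<gamma> \<noteq> 0} else {})" for k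
  have comp: "component r j / h \<in> R" if "component r j \<noteq> 0" for j
  proof -
    have "component r j \<in> {z. z / h \<in> R}"
    proof (rule coefficients_mem_of_product[OF P, where S = S and f = component and T = "{\<gamma>. component r \<gamma> \<noteq> 0}"])
      show "0 \<in> {z. z / h \<in> R}" using zero_mem by simp
      show "u - v \<in> {z. z / h \<in> R}" if "u \<in> {z. z / h \<in> R}" "v \<in> {z. z / h \<in> R}" for u v
        using that diff_mem by (simp add: diff_divide_distrib)
      show "component k i * u \<in> {z. z / h \<in> R}" if "i \<in> S k" "u \<in> {z. z / h \<in> R}" for k i u
        using that mult_mem[OF TR] by (auto simp: S_def split: if_splits) (metis times_divide_eq_right)
      show "u \<in> {z. z / h \<in> R}" if u: "\<And>k i. i \<in> S k \<Longrightarrow> component k i * u \<in> {z. z / h \<in> R}" for u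
      proof -
        have "u / h * component k i \<in> R" if "k \<in> T" for k i
          using u[of i k] that zero_mem by (cases "component k i = 0") (auto simp: S_def mult.commute)
        then show ?thesis using T(2)[of "u / h"] by simp
      qed
      show "finite (S k)" for k using T(1) finite_component by (auto simp: S_def)
      show "finite {\<gamma>. component r \<gamma> \<noteq> 0}" by (rule finite_component[OF rh(1)])
      show "(\<Sum>i\<in>S k. \<Sum>j | component r j \<noteq> 0. if i + j = n then component k i * component r j else 0)
          \<in> {z. z / h \<in> R}" for k n
      proof (cases "k \<in> T")
        case True
        then have k: "k \<in> R" using T(1) by blast
        have "(\<Sum>i\<in>S k. \<Sum>j | component r j \<noteq> 0. if i + j = n then component k i * component r j else 0)
            = component (k * r) n"
          by (rule component_mult[symmetric]) (use k rh finite_component True in \<open>auto simp: S_def\<close>)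
        also have "k * r = h * (x * k)" using rh(3) \<delta>(2) by simp
        also have "component (h * (x * k)) n / h \<in> R"
        proof (cases "component (h * (x * k)) n = 0")
          case False
          with component_homogeneous_mult[OF \<delta>(1) x(2)[OF True]] obtain \<epsilon>
            where "component (h * (x * k)) n = h * component (x * k) \<epsilon>" by metis
          then show ?thesis using \<delta>(2) subsetD[OF gr_subset component_mem[OF x(2)[OF True]]] by simp
        qed (simp add: zero_mem)
        finally show ?thesis by simp
      qed (simp add: S_def zero_mem)
      show "j \<in> {\<gamma>. component r \<gamma> \<noteq> 0}" using that by simp
    qed
    then show ?thesis by simp
  qed
  have "(\<Sum>\<gamma> | component r \<gamma> \<noteq> 0. component r \<gamma> / h) \<in> R" by (intro sum_mem comp) simp
  then show ?thesis using rh(3) sum_component[OF rh(1)] by (simp add: sum_divide_distrib[symmetric])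
qed

end


section \<open>Localizing at the prime ideal\<close>

context graded_domain
begin

lemma H_nonzero: "0 \<notin> H"
  by (simp add: H_iff)

lemma unit_divisor_set:
  assumes Q: "t_ideal R Q" and C: "t_op R (content_ideal R gr Q) = R"
  obtains T where "finite T" "T \<subseteq> Q"
    "\<And>x. x \<in> localization R H \<Longrightarrow> (\<And>f. f \<in> T \<Longrightarrow> x * f \<in> R) \<Longrightarrow> x \<in> R"
proof -
  have Q': "is_submodule R Q" "Q \<subseteq> R" using Q unfolding t_ideal_iff by auto
  from finite_unit_content[OF Q' C] obtain T where T: "finite T" "T \<subseteq> Q"
    "\<And>y. (\<And>f \<gamma>. f \<in> T \<Longrightarrow> y * component f \<gamma> \<in> R) \<Longrightarrow> y \<in> R" by blast
  show thesis
  proof (rule that[OF T(1,2)])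
    show "x \<in> R" if "x \<in> localization R H" "\<And>f. f \<in> T \<Longrightarrow> x * f \<in> R" for x
      using T(2) Q'(2) by (intro mem_of_unit_content[OF _ T(3) that]) auto
  qed
qed

text \<open>If \<open>h\<close> is in both, \<open>y * h \<in> R\<close> puts \<open>y\<close> into
  \<open>R\<^sub>H\<close>, and then \<open>T\<close> puts it into \<open>R\<close>. So
  \<open>insert h T\<close> would witness \<open>1 \<in> Q\<close>.\<close>

lemma disjoint_homogeneous:
  assumes Q: "t_ideal R Q" "1 \<notin> Q" and C: "t_op R (content_ideal R gr Q) = R"
  shows "Q \<inter> H = {}"
proof (rule ccontr)
  assume "Q \<inter> H \<noteq> {}"
  then obtain h where h: "h \<in> Q" "h \<in> H" "h \<noteq> 0" using H_nonzero by blast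
  from unit_divisor_set[OF Q(1) C] obtain T where T: "finite T" "T \<subseteq> Q"
    "\<And>x. x \<in> localization R H \<Longrightarrow> (\<And>f. f \<in> T \<Longrightarrow> x * f \<in> R) \<Longrightarrow> x \<in> R" by blast
  have "1 \<in> Q"
  proof (rule t_idealD[OF Q(1), of "insert h T"])
    fix y assume y: "\<And>f. f \<in> insert h T \<Longrightarrow> y * f \<in> R"
    have "y = y * h / h" "y * h \<in> R" using y h by auto
    then have "y \<in> localization R H" using h(2) unfolding localization_def by blast
    then show "1 * y \<in> R" using T(3) y by simp
  qed (use T h in auto)
  with Q(2) show False by simp
qed

lemma valuation_domain_localization:
  assumes Q: "primeideal Q (ring_on R)" "t_ideal R Q" and C: "t_op R (content_ideal R gr Q) = R"
  shows "valuation_domain (localization R (R - Q))"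
proof -
  have Q': "is_submodule R Q" "Q \<subseteq> R" "1 \<notin> Q" "\<And>a b. a \<in> R \<Longrightarrow> b \<in> R \<Longrightarrow> a * b \<in> Q \<Longrightarrow> a \<in> Q \<or> b \<in> Q"
    using Q(1) unfolding primeideal_iff by auto
  interpret A: gcd_subring "localization R H" by (rule gcd_subring_localization)
  let ?V = "localization R (R - Q)"
  have one: "1 \<in> R - Q" using one_mem Q'(3) by simp
  have "field_subring ?V"
  proof (rule field_subring_localization)
    show "0 \<notin> R - Q" using Q'(1) by (simp add: is_submodule_def)
  qed (use one Q'(4) mult_mem in auto)
  moreover have "\<exists>a\<in>?V. \<exists>b\<in>?V - {0}. x = a / b" for x
    using domain subset_localization[OF one] unfolding domain_with_quotient_field_def by blast
  moreover have "x \<in> ?V \<or> inverse x \<in> ?V" if "x \<noteq> 0" for x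
  proof -
    obtain a b where ab: "a \<in> R" "b \<in> R" "b \<noteq> 0" "x = a / b"
      using domain unfolding domain_with_quotient_field_def by blast
    then have "a \<noteq> 0" using that by auto
    have "a \<in> localization R H" "b \<in> localization R H"
      using subset_localization[OF one_mem_H] ab by auto
    then obtain e where e: "e \<noteq> 0"
      "\<And>y. y * a \<in> localization R H \<and> y * b \<in> localization R H \<longleftrightarrow> y / e \<in> localization R H"
      using A.gcd_ex \<open>a \<noteq> 0\<close> by blast
    have "e * a \<in> localization R H" "e * b \<in> localization R H" using e(2)[of e] e(1) A.one_mem by auto
    then obtain r h s k where rs: "e * a = r / h" "r \<in> R" "h \<in> H" "e * b = s / k" "s \<in> R" "k \<in> H"
      unfolding localization_def by blast
    have hk: "h \<noteq> 0" "k \<noteq> 0" "h \<in> R" "k \<in> R" "h * k \<in> H"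
      using rs(3,6) H_subset H_mult H_nonzero by auto
    \<comment> \<open>The pair \<open>e * a, e * b\<close> has \<open>v\<close>-closure
      \<open>R\<^sub>H\<close>. The unit \<open>h * k\<close> of \<open>R\<^sub>H\<close> moves it
      into \<open>R\<close> without changing this.\<close>
    define a' b' where "a' = h * k * (e * a)" and "b' = h * k * (e * b)"
    have "a' = k * r" "b' = h * s" using rs(1,4) hk by (auto simp: a'_def b'_def)
    then have ab': "a' \<in> R" "b' \<in> R" using rs hk mult_mem by auto
    have nz: "a' \<noteq> 0" "b' \<noteq> 0" using hk e(1) ab(3) \<open>a \<noteq> 0\<close> by (auto simp: a'_def b'_def)
    have x: "x = a' / b'" "inverse x = b' / a'" using hk e(1) ab by (auto simp: a'_def b'_def)
    have coprime: "y \<in> localization R H" if "y * a' \<in> R" "y * b' \<in> R" for y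
    proof -
      have "(y * (h * k) * e) * a \<in> localization R H" "(y * (h * k) * e) * b \<in> localization R H"
        using that subset_localization[OF one_mem_H] by (auto simp: a'_def b'_def mult.assoc)
      then have "y * (h * k) \<in> localization R H" using e(2)[of "y * (h * k) * e"] e(1) by simp
      moreover have "1 / (h * k) \<in> localization R H"
        using one_mem hk(5) unfolding localization_def by blast
      ultimately have "y * (h * k) * (1 / (h * k)) \<in> localization R H" by (rule A.mult_mem)
      then show ?thesis using hk by simp
    qed
    have "\<not> (a' \<in> Q \<and> b' \<in> Q)"
    proof
      assume ab'Q: "a' \<in> Q \<and> b' \<in> Q"
      from unit_divisor_set[OF Q(2) C] obtain T where T: "finite T" "T \<subseteq> Q"
        "\<And>x. x \<in> localization R H \<Longrightarrow> (\<And>f. f \<in> T \<Longrightarrow> x * f \<in> R) \<Longrightarrow> x \<in> R" by blast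
      have "1 \<in> Q"
      proof (rule t_idealD[OF Q(2), of "{a', b'} \<union> T"])
        fix y assume "\<And>f. f \<in> {a', b'} \<union> T \<Longrightarrow> y * f \<in> R"
        then show "1 * y \<in> R" using T(3)[OF coprime[of y]] by simp
      qed (use T ab'Q nz in auto)
      with Q'(3) show False by simp
    qed
    then show ?thesis using x ab' unfolding localization_def by blast
  qed
  ultimately show ?thesis
    by (simp add: valuation_domain_def domain_with_quotient_field_def subring_iff_field_subring)
qed

section \<open>Extension of ideals to \<open>R\<^sub>H\<close> and contraction to
  \<open>R\<close>\<close>

lemma submodule_common_denominator:
  assumes "finite F" "F \<subseteq> localization R S" "S \<subseteq> R" "1 \<in> S" "\<And>x y. x \<in> S \<Longrightarrow> y \<in> S \<Longrightarrow> x * y \<in> S" "0 \<notin> S"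
  shows "\<exists>s\<in>S. \<forall>x\<in>F. s * x \<in> R"
  using assms(1,2)
proof (induction rule: finite_induct)
  case empty
  then show ?case using assms(4) by auto
next
  case (insert x F)
  then obtain s where s: "s \<in> S" "\<forall>x\<in>F. s * x \<in> R" by auto
  from insert.prems obtain a t where at: "x = a / t" "a \<in> R" "t \<in> S" by (auto simp: localization_def)
  have "t \<noteq> 0" using at(3) assms(6) by auto
  have "t * s * y \<in> R" if "y \<in> F" for y
    using mult_mem[of t "s * y"] s(2) that at(3) assms(3) by (auto simp: mult.assoc)
  moreover have "t * s * x \<in> R"
    using mult_mem[of s a] s(1) at assms(3) \<open>t \<noteq> 0\<close> by auto
  ultimately show ?case using assms(5)[OF at(3) s(1)] by auto
qed

lemma hull_localization:
  assumes Q: "is_submodule R Q"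
  shows "is_submodule (localization R H) hull Q = {q / h | q h. q \<in> Q \<and> h \<in> H}"
proof -
  have Qcl: "0 \<in> Q" "\<And>x y. x \<in> Q \<Longrightarrow> y \<in> Q \<Longrightarrow> x + y \<in> Q" "\<And>d x. d \<in> R \<Longrightarrow> x \<in> Q \<Longrightarrow> d * x \<in> Q"
    using Q by (auto simp: is_submodule_def)
  show ?thesis
  proof (rule hull_unique)
    show "Q \<subseteq> {q / h | q h. q \<in> Q \<and> h \<in> H}"
      using one_mem_H by (force intro: exI[of _ 1])
    show "is_submodule (localization R H) {q / h | q h. q \<in> Q \<and> h \<in> H}"
      unfolding is_submodule_def
    proof (intro conjI ballI)
      show "0 \<in> {q / h | q h. q \<in> Q \<and> h \<in> H}" using Qcl(1) one_mem_H by force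
      fix x y assume y: "y \<in> {q / h | q h. q \<in> Q \<and> h \<in> H}"
      then obtain q h where q: "y = q / h" "q \<in> Q" "h \<in> H" by blast
      { assume "x \<in> {q / h | q h. q \<in> Q \<and> h \<in> H}"
        then obtain p k where p: "x = p / k" "p \<in> Q" "k \<in> H" by blast
        have "x + y = (h * p + k * q) / (k * h)" using p q by (auto simp: H_iff field_simps)
        then show "x + y \<in> {q / h | q h. q \<in> Q \<and> h \<in> H}"
          using Qcl p q H_subset H_mult by blast }
      { assume "x \<in> localization R H"
        then obtain a k where a: "x = a / k" "a \<in> R" "k \<in> H" unfolding localization_def by blast
        have "x * y = (a * q) / (k * h)" using a q by simp
        then show "x * y \<in> {q / h | q h. q \<in> Q \<and> h \<in> H}"
          using Qcl(3)[OF a(2) q(2)] H_mult[OF a(3) q(3)] by blast }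
    qed
    fix N assume N: "Q \<subseteq> N" "is_submodule (localization R H) N"
    have "q / h \<in> N" if "q \<in> Q" "h \<in> H" for q h
    proof -
      have "1 / h \<in> localization R H" using one_mem that(2) unfolding localization_def by blast
      then have "1 / h * q \<in> N" using N that(1) unfolding is_submodule_def by blast
      then show ?thesis by simp
    qed
    then show "{q / h | q h. q \<in> Q \<and> h \<in> H} \<subseteq> N" by blast
  qed
qed

lemma
  assumes Q: "primeideal Q (ring_on R)" "Q \<inter> H = {}"
  shows localization_contraction: "x \<in> is_submodule (localization R H) hull Q \<Longrightarrow> x \<in> R \<Longrightarrow> x \<in> Q"
    and primeideal_localization:
      "primeideal (is_submodule (localization R H) hull Q) (ring_on (localization R H))"
proof -
  let ?P = "is_submodule (localization R H) hull Q"
  have Q': "is_submodule R Q" "Q \<subseteq> R" "1 \<notin> Q" "\<And>a b. a \<in> R \<Longrightarrow> b \<in> R \<Longrightarrow> a * b \<in> Q \<Longrightarrow> a \<in> Q \<or> b \<in> Q"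
    using Q(1) unfolding primeideal_iff by auto
  interpret A: gcd_subring "localization R H" by (rule gcd_subring_localization)
  have P: "?P = {q / h | q h. q \<in> Q \<and> h \<in> H}" by (rule hull_localization[OF Q'(1)])
  have contr: "x \<in> Q" if "x \<in> ?P" "x \<in> R" for x
  proof -
    from that(1) obtain q h where qh: "x = q / h" "q \<in> Q" "h \<in> H" unfolding P by blast
    then have "h * x \<in> Q" "h \<in> R" "h \<notin> Q" using Q(2) H_subset H_nonzero by auto
    then show ?thesis using Q'(4) that(2) by blast
  qed
  then show "x \<in> ?P \<Longrightarrow> x \<in> R \<Longrightarrow> x \<in> Q" .
  have "a \<in> ?P \<or> b \<in> ?P" if ab: "a \<in> localization R H" "b \<in> localization R H" "a * b \<in> ?P" for a b
  proof -
    from ab(1,2) obtain r h s k where rs: "a = r / h" "b = s / k" "r \<in> R" "s \<in> R" "h \<in> H" "k \<in> H"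
      unfolding localization_def by blast
    have "h * k \<in> localization R H" using subset_localization[OF one_mem_H] H_subset H_mult rs by blast
    then have "h * k * (a * b) \<in> ?P" using A.is_submodule_hull[of Q] ab(3) by (simp add: is_submodule_def)
    moreover have "h * k * (a * b) = r * s" using rs by (auto simp: H_iff)
    ultimately have "r * s \<in> Q" using contr rs mult_mem by simp
    then show ?thesis using Q'(4) rs unfolding P by blast
  qed
  moreover have "1 \<notin> ?P" using contr one_mem Q'(3) by blast
  moreover have "?P \<subseteq> localization R H"     using hull_minimal[of Q "localization R H" "is_submodule (localization R H)"]
      A.is_submodule_self Q'(2) subset_localization[OF one_mem_H] by blast
  ultimately show "primeideal ?P (ring_on (localization R H))"
    unfolding A.primeideal_iff using A.is_submodule_hull by blast
qed

text \<open>Choose \<open>g\<close> of least value in \<open>F\<close>, so \<open>F / g\<close> lies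
  in \<open>R\<^sub>Q\<close>, and \<open>s\<close> outside \<open>Q\<close> clearing the
  denominators. Then \<open>s / g\<close> multiplies \<open>F\<close> into \<open>R\<close>, so
  \<open>x * s\<close> is a multiple of \<open>g\<close> in \<open>R\<^sub>H\<close> and lies in the
  extended prime. Since \<open>s\<close> does not, \<open>x\<close> does.\<close>

lemma t_ideal_localization:
  assumes Q: "primeideal Q (ring_on R)" "t_ideal R Q" "Q \<inter> H = {}"
    and V: "valuation_domain (localization R (R - Q))"
  shows "t_ideal (localization R H) (is_submodule (localization R H) hull Q)"
proof -
  let ?P = "is_submodule (localization R H) hull Q" and ?V = "localization R (R - Q)"
  have Q': "is_submodule R Q" "Q \<subseteq> R" "1 \<notin> Q" "\<And>a b. a \<in> R \<Longrightarrow> b \<in> R \<Longrightarrow> a * b \<in> Q \<Longrightarrow> a \<in> Q \<or> b \<in> Q"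
    "Q \<noteq> {0}" using Q(1,2) unfolding primeideal_iff t_ideal_iff by auto
  interpret A: gcd_subring "localization R H" by (rule gcd_subring_localization)
  interpret V: field_subring ?V
    using V by (simp add: valuation_domain_def domain_with_quotient_field_def subring_iff_field_subring)
  have total: "x \<in> ?V \<or> inverse x \<in> ?V" if "x \<noteq> 0" for x
    using V that by (simp add: valuation_domain_def)
  note P = primeideal_localization[OF Q(1,3), unfolded A.primeideal_iff]
  have RA: "R \<subseteq> localization R H" by (rule subset_localization[OF one_mem_H])
  have divisor: "\<exists>g\<in>F. g \<noteq> 0 \<and> (\<forall>x\<in>F. x / g \<in> ?V)" if "finite F" "\<not> F \<subseteq> {0}" for F
    using that
  proof (induction rule: finite_induct)
    case (insert y F)
    show ?case
    proof (cases "F \<subseteq> {0}")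
      case True
      then show ?thesis using insert.prems V.one_mem V.zero_mem by (intro bexI[of _ y]) auto
    next
      case False
      then obtain g where g: "g \<in> F" "g \<noteq> 0" "\<forall>x\<in>F. x / g \<in> ?V" using insert.IH by blast
      show ?thesis
      proof (cases "y / g \<in> ?V")
        case True
        with g show ?thesis by (intro bexI[of _ g]) auto
      next
        case False
        then have "y \<noteq> 0" using V.zero_mem by auto
        then have gy: "g / y \<in> ?V" using total[of "y / g"] False g(2) by simp
        have "x / y \<in> ?V" if "x \<in> F" for x
        proof -
          have "x / g \<in> ?V" using g(3) that by blast
          then have "x / g * (g / y) \<in> ?V" using gy by (rule V.mult_mem)
          then show ?thesis using g(2) by simp
        qed
        with \<open>y \<noteq> 0\<close> V.one_mem show ?thesis by (intro bexI[of _ y]) auto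
      qed
    qed
  qed simp
  show ?thesis
  proof (rule A.t_idealI)
    show "is_submodule (localization R H) ?P" "?P \<subseteq> localization R H" using P by auto
    show "?P \<noteq> {0}"
      using hull_subset[of Q "is_submodule (localization R H)"] Q'(1,5) by (auto simp: is_submodule_def)
    fix F x
    assume F: "finite F" "F \<subseteq> ?P" "\<not> F \<subseteq> {0}" and xA: "x \<in> localization R H"
      and x: "\<And>y. (\<And>f. f \<in> F \<Longrightarrow> y * f \<in> localization R H) \<Longrightarrow> x * y \<in> localization R H"
    obtain g where g: "g \<in> F" "g \<noteq> 0" "\<forall>f\<in>F. f / g \<in> ?V" using divisor[OF F(1,3)] by blast
    have "\<exists>s\<in>R - Q. \<forall>f\<in>(\<lambda>f. f / g) ` F. s * f \<in> R"
    proof (rule submodule_common_denominator)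
      show "0 \<notin> R - Q" using Q'(1) by (simp add: is_submodule_def)
    qed (use F(1) g(3) one_mem Q'(3,4) mult_mem in auto)
    then obtain s where s: "s \<in> R" "s \<notin> Q" "\<And>f. f \<in> F \<Longrightarrow> s * (f / g) \<in> R" by blast
    have "x * (s / g) \<in> localization R H"
    proof (rule x)
      fix f assume "f \<in> F"
      then have "s * (f / g) \<in> R" by (rule s(3))
      then show "s / g * f \<in> localization R H" using RA by auto
    qed
    moreover have "g \<in> ?P" using F(2) g(1) by blast
    ultimately have "x * (s / g) * g \<in> ?P"
      using A.is_submodule_hull[of Q] unfolding is_submodule_def by blast
    then have "x * s \<in> ?P" using g(2) by simp
    moreover have "s \<notin> ?P" using localization_contraction[OF Q(1,3)] s by blast
    ultimately show "x \<in> ?P" using P xA s(1) RA by blast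
  qed
qed

text \<open>If \<open>y\<close> multiplies the finite set \<open>F\<close> into
  \<open>R\<^sub>H\<close>, some homogeneous \<open>h\<close> makes \<open>h * y\<close> multiply it
  into \<open>R\<close>. The conclusion for \<open>h * y\<close> gives the one for \<open>y\<close>,
  as \<open>h\<close> is a unit of \<open>R\<^sub>H\<close>.\<close>

lemma t_ideal_contraction:
  assumes J: "t_ideal (localization R H) J" and ne: "J \<inter> R \<noteq> {0}"
  shows "t_ideal R (J \<inter> R)"
proof -
  interpret A: gcd_subring "localization R H" by (rule gcd_subring_localization)
  have J': "is_submodule (localization R H) J" using J unfolding A.t_ideal_iff by simp
  have RA: "R \<subseteq> localization R H" by (rule subset_localization[OF one_mem_H])
  show ?thesis
  proof (rule t_idealI)
    show "is_submodule R (J \<inter> R)"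
      using J' RA zero_mem add_mem mult_mem by (auto simp: is_submodule_def)
    fix F x assume F: "finite F" "F \<subseteq> J \<inter> R" "\<not> F \<subseteq> {0}" and xR: "x \<in> R"
      and x: "\<And>y. (\<And>f. f \<in> F \<Longrightarrow> y * f \<in> R) \<Longrightarrow> x * y \<in> R"
    have "x \<in> J"
    proof (rule A.t_idealD[OF J F(1) _ F(3)])
      show "F \<subseteq> J" using F(2) by blast
      fix y assume y: "\<And>f. f \<in> F \<Longrightarrow> y * f \<in> localization R H"
      have "\<exists>s\<in>H. \<forall>z\<in>(\<lambda>f. y * f) ` F. s * z \<in> R"
        by (rule submodule_common_denominator) (use F(1) y H_subset one_mem_H H_mult H_nonzero in auto)
      then obtain h where h: "h \<in> H" "\<And>f. f \<in> F \<Longrightarrow> h * (y * f) \<in> R" by blast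
      have "x * (h * y) \<in> R" using h(2) by (intro x) (simp add: mult.assoc)
      then have "x * (h * y) / h \<in> localization R H" using h(1) unfolding localization_def by blast
      then show "x * y \<in> localization R H" using h(1) by (auto simp: H_iff)
    qed
    then show "x \<in> J \<inter> R" using xR by simp
  qed (use ne in auto)
qed

text \<open>A proper \<open>t\<close>-ideal \<open>J\<close> above the extension of \<open>Q\<close>
  contracts to a proper \<open>t\<close>-ideal above \<open>Q\<close>, hence to \<open>Q\<close>.
  Clearing denominators shows that \<open>J\<close> is the extension of its contraction.\<close>

lemma maximal_t_ideal_localization:
  assumes Q: "maximal_t_ideal R Q" "Q \<inter> H = {}"
    and tP: "t_ideal (localization R H) (is_submodule (localization R H) hull Q)"
  shows "maximal_t_ideal (localization R H) (is_submodule (localization R H) hull Q)"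
proof -
  let ?P = "is_submodule (localization R H) hull Q"
  have prime: "primeideal Q (ring_on R)" by (rule primeideal_of_maximal_t_ideal[OF Q(1)])
  have Q': "is_submodule R Q" "Q \<noteq> {0}"
    using Q(1) unfolding maximal_t_ideal_def t_ideal_iff by auto
  interpret A: gcd_subring "localization R H" by (rule gcd_subring_localization)
  have QP: "Q \<subseteq> ?P" by (rule hull_subset)
  have "J = ?P" if J: "t_ideal (localization R H) J" "J \<noteq> localization R H" "?P \<subseteq> J" for J
  proof -
    have J': "is_submodule (localization R H) J" "J \<subseteq> localization R H"
      using J(1) unfolding A.t_ideal_iff by auto
    have "Q \<subseteq> R" using prime unfolding primeideal_iff by simp
    then have QJ: "Q \<subseteq> J \<inter> R" using QP J(3) by auto
    have "J \<inter> R \<noteq> {0}" using QJ Q' by (auto simp: is_submodule_def)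
    then have "t_ideal R (J \<inter> R)" by (rule t_ideal_contraction[OF J(1)])
    moreover have "1 \<notin> J"
    proof
      assume "1 \<in> J"
      then have "d * 1 \<in> J" if "d \<in> localization R H" for d
        using J'(1) that unfolding is_submodule_def by blast
      then show False using J(2) J'(2) by auto
    qed
    then have "J \<inter> R \<noteq> R" using one_mem by blast
    ultimately have JQ: "J \<inter> R = Q" using Q(1) QJ unfolding maximal_t_ideal_def by blast
    have "x \<in> ?P" if x: "x \<in> J" for x
    proof -
      obtain r h where rh: "x = r / h" "r \<in> R" "h \<in> H"
        using x J'(2) unfolding localization_def by blast
      have "h \<in> localization R H" using rh(3) H_subset subset_localization[OF one_mem_H] by blast
      then have "h * x \<in> J" using J'(1) x unfolding is_submodule_def by blast
      then have "r \<in> J" using rh by (auto simp: H_iff)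
      then have "r \<in> Q" using JQ rh(2) by blast
      then show ?thesis unfolding hull_localization[OF Q'(1)] using rh by blast
    qed
    then show "J = ?P" using J(3) by blast
  qed
  moreover have "?P \<noteq> localization R H"
    using primeideal_localization[OF prime Q(2)] A.one_mem unfolding A.primeideal_iff by blast
  ultimately show ?thesis using tP unfolding maximal_t_ideal_def by blast
qed

text \<open>Each \<open>f \<in> Q\<close> is the sum of its components, so the content ideal
  contains \<open>Q\<close>. It is strictly larger because a nonzero component lies in
  \<open>H\<close>, which avoids \<open>Q\<close>.\<close>

lemma t_op_content_ideal_of_maximal:
  assumes Q: "maximal_t_ideal R Q" "Q \<inter> H = {}"
  shows "t_op R (content_ideal R gr Q) = R"
proof (rule t_op_eq_of_maximal_t_ideal[OF Q(1)])
  have Q': "is_submodule R Q" "Q \<subseteq> R" "Q \<noteq> {0}"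
    using Q(1) unfolding maximal_t_ideal_def t_ideal_iff by auto
  note sub = is_submodule_content_ideal[OF Q'(2)] content_ideal_subset[OF Q'(2)]
  show "is_submodule R (content_ideal R gr Q)" "content_ideal R gr Q \<subseteq> R" by (fact sub)+
  have "f \<in> content_ideal R gr Q" if f: "f \<in> Q" for f
  proof -
    have "(\<Sum>\<gamma>\<in>N. component f \<gamma>) \<in> content_ideal R gr Q" for N
      using component_mem_content_ideal[OF Q'(2) f] sub(1) unfolding is_submodule_def
      by (induction N rule: infinite_finite_induct) auto
    then show ?thesis using sum_component[of f] f Q'(2) by (metis subsetD)
  qed
  moreover obtain f where f: "f \<in> Q" "f \<noteq> 0" using Q'(1,3) by (auto simp: is_submodule_def)
  then obtain \<gamma> where \<gamma>: "component f \<gamma> \<noteq> 0" using component_zero_imp[of f] Q'(2) by blast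
  then have "component f \<gamma> \<notin> Q" using component_mem_H[of f \<gamma>] Q(2) Q'(2) f(1) by blast
  ultimately show "Q \<subset> content_ideal R gr Q" using component_mem_content_ideal[OF Q'(2) f(1), of \<gamma>] by blast
qed

end

theorem theorem2:
  fixes R :: "'k::field set"
    and gr :: "'g::cancel_comm_monoid_add \<Rightarrow> 'k set"
    and Q :: "'k set"
  assumes "graded_domain R gr"
  shows "(maximal_t_ideal R Q \<and> Q \<inter> homogeneous gr = {} \<longrightarrow>
            prime_t_ideal R Q \<and> t_op R (content_ideal R gr Q) = R) \<and>
         (prime_t_ideal R Q \<and> t_op R (content_ideal R gr Q) = R \<longrightarrow>
            valuation_domain (localization R (R - Q)) \<and>
            prime_t_ideal (localization R (homogeneous gr))
              (is_submodule (localization R (homogeneous gr)) hull Q) \<and>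
            (maximal_t_ideal R Q \<longrightarrow>
               maximal_t_ideal (localization R (homogeneous gr))
                 (is_submodule (localization R (homogeneous gr)) hull Q)))"
proof -
  interpret graded_domain R gr by fact
  show ?thesis
  proof (intro conjI impI; (elim conjE)?)
    assume Q: "maximal_t_ideal R Q" "Q \<inter> homogeneous gr = {}"
    then show "prime_t_ideal R Q"
      using primeideal_of_maximal_t_ideal by (simp add: prime_t_ideal_def maximal_t_ideal_def)
    show "t_op R (content_ideal R gr Q) = R" by (rule t_op_content_ideal_of_maximal[OF Q])
  next
    assume "prime_t_ideal R Q" and C: "t_op R (content_ideal R gr Q) = R"
    then have Q: "primeideal Q (ring_on R)" "t_ideal R Q" by (auto simp: prime_t_ideal_def)
    have disj: "Q \<inter> homogeneous gr = {}"
      using Q(1) unfolding primeideal_iff by (intro disjoint_homogeneous[OF Q(2) _ C]) blast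
    show V: "valuation_domain (localization R (R - Q))"
      by (rule valuation_domain_localization[OF Q C])
    note tP = t_ideal_localization[OF Q disj V]
    then show "prime_t_ideal (localization R (homogeneous gr))
        (is_submodule (localization R (homogeneous gr)) hull Q)"
      using primeideal_localization[OF Q(1) disj] by (simp add: prime_t_ideal_def)
    assume "maximal_t_ideal R Q"
    then show "maximal_t_ideal (localization R (homogeneous gr))
        (is_submodule (localization R (homogeneous gr)) hull Q)"
      by (rule maximal_t_ideal_localization[OF _ disj tP])
  qed
qed

end
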